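(* Consider the online risk-averse learning problem and the algorithm (Algorithm 1) described in the context. Assume that: (i) $J(x,\xi)$ is $m$-strongly convex in $x$ for every $\xi\in\Xi$, i.e. $J(y,\xi)\ge J(x,\xi)+\nabla_xJ(x,\xi)^\top(y-x)+\frac m2\|x-y\|^2$ for all $x,y\in\mathcal{X}$ and every $\xi\in\Xi$; (ii) $J(x,\xi)$ is Lipschitz continuous in $x$ for every $\xi\in\Xi$, i.e. there is a constant $L_0>0$ with $|J(x,\xi)-J(y,\xi)|\le L_0\|x-y\|$ for all $x,y\in\mathcal{X}$; (iii) the distributions satisfy the variation budget $\sum_{t=2}^T W_1(\mathcal{D}_{t-1},\mathcal{D}_t)\le V_D$. Suppose that the sampling numbers $n_t=\phi(\tau)$ satisfy $\sum_{\tau=1}^{\Delta_T}\frac{1}{\sqrt{\phi(\tau)}}\le c\,\Delta_T^{1-\frac a2}$ with a constant $a>0$ and some constant $c>0$. Select the learning rate as $\eta_t=\frac{1}{m\tau}$, where $\tau=t-(\lceil t/\Delta_T\rceil-1)\Delta_T$ is the epoch of $t$ within its batch. 1. When $a\in(0,\frac43]$, select $\delta=\left(\frac{V_D}{T}\right)^{\frac{a}{4+a}}$ and $\Delta_T=\left(\frac{T}{V_D}\right)^{\frac{4}{4+a}}$. Then Algorithm 1 achieves $\mathrm{DR}(T)=\tilde{\mathcal{O}}\big(T^{\frac{4}{4+a}}V_D^{\frac{a}{4+a}}\big)$ with high probability. 2. When $a>\frac43$, select $\delta=\left(\frac{V_D}{T}\right)^{\frac14}$ and $\Delta_T=\left(\frac{T}{V_D}\right)^{\frac34}$.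 Then Algorithm 1 achieves $\mathrm{DR}(T)=\tilde{\mathcal{O}}\big(T^{\frac34}V_D^{\frac14}\big)$ with high probability. Here $\tilde{\mathcal{O}}$ hides constants and polylogarithmic factors of $T$, and "with high probability" means with probability at least $1-\gamma$ for a given $\gamma\in(0,1)$ (the hidden factors may depend on $\gamma$).
   Context: **Setting.** $\mathcal{X}\subseteq\mathbb{R}^d$ is the admissible set of decisions; it contains the ball $r\mathbb{B}$ of radius $r$ centered at the origin and has diameter $D_x=\sup_{x,y\in\mathcal{X}}\|x-y\|$, where $\|\cdot\|$ is the $\ell_2$ norm. $J:\mathcal{X}\times\Xi\to\mathbb{R}$ is a cost function of the decision $x$ and a random noise $\xi\in\Xi$, bounded by $U>0$: $|J(x,\xi)|\le U$. At iteration $t=1,\dots,T$ the noise is $\xi_t\sim\mathcal{D}_t$, where $\mathcal{D}_1,\dots,\mathcal{D}_T$ are (time-varying) distributions on a metric space. $W_1$ is the Wasserstein distance, given for any fixed $K>0$ by $W_1(\mathcal{D},\mathcal{D}')=\frac1K\sup_{\|f\|_L\le K}\{\mathbb{E}_{x\sim\mathcal{D}}[f(x)]-\mathbb{E}_{y\sim\mathcal{D}'}[f(y)]\}$, with $\|\cdot\|_L$ the Lipschitz norm. **CVaR.** Fix $\alpha\in(0,1]$. For a cost with cumulative distribution function $F$, the $\alpha$-VaR is $J^\alpha=F^{-1}(\alpha):=\inf\{y:F(y)\ge\alpha\}$, and the $\alpha$-CVaR, which describes the expectation of the $\alpha$-fraction of the worst outcomes, is defined as $\mathrm{CVaR}_\alpha[F]=\mathrm{CVaR}_\alpha[J(x,\xi)]=\mathbb{E}_F[J(x,\xi)\mid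 J(x,\xi)\ge J^\alpha]$. Put $C_t(x)=\mathrm{CVaR}_\alpha[J(x,\xi_t)]$ with $\xi_t\sim\mathcal{D}_t$. **Algorithm 1.** Inputs: an initial point, the horizon $T$, a batch size $\Delta_T\in(1,T)$, a smoothing parameter $\delta$, the risk level $\alpha$, a sampling function $\phi$ and learning rates $\eta_t$. Let $\mathcal{X}^\delta=\{x\in\mathcal{X}:\frac{1}{1-\delta/r}x\in\mathcal{X}\}$ and $\mathcal{P}_{\mathcal{X}^\delta}(x)=\arg\min_{y\in\mathcal{X}^\delta}\|x-y\|^2$. For $t=1,\dots,T$: - identify the batch $j=\lceil t/\Delta_T\rceil$ and the epoch within the batch $\tau=t-(j-1)\Delta_T$; set $n_t=\phi(\tau)$; - sample $u_t$ uniformly from the unit sphere of $\mathbb{R}^d$ and set $\hat{x}_t=x_t+\delta u_t$; - play $\hat{x}_t$ $n_t$ times, obtaining $J(\hat{x}_t,\xi_t^i)$, $i=1,\dots,n_t$, with $\xi_t^i$ samples of $\xi_t\sim\mathcal{D}_t$, and form $\hat F_t(y)=\frac1{n_t}\sum_{i=1}^{n_t}\mathbf{1}\{J(\hat{x}_t,\xi_t^i)\le y\}$; - set $\hat g_t=\frac{d}{\delta}\mathrm{CVaR}_\alpha[\hat F_t]\,u_t$ and $x_{t+1}=\mathcal{P}_{\mathcal{X}^\delta}(x_t-\eta_t\hat g_t)$. **Dynamic regret.** $\mathrm{DR}(T)=\sum_{t=1}^T C_t(\hat{x}_t)-\sum_{t=1}^T C_t(x_t^* )$ with $x_t^*=\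arg\min_{x\in\mathcal{X}}C_t(x)$.
   Formalization: J is also assumed Lipschitz in ξ (false otherwise: W_1 would not control the drift of C_t); CVaR is the mean of the worst α-fraction, counting an atom at VaR only partly, also in the empirical estimate; X is closed and convex, δ<r, the initial point lies in X^δ, and Δ_T is rounded to an integer. *)

theory Defs
  imports "HOL-Probability.Probability"
begin

section \<open>Value at risk and conditional value at risk of a cdf\<close>

text \<open>
  CVaR at level \<open>\<alpha> \<in> (0,1]\<close> is the expectation over the worst (largest) \<open>\<alpha>\<close>-fraction of the
  outcomes, so \<open>VaR\<close> is the quantile that leaves mass \<open>\<alpha>\<close> above it.  The strict inequality
  selects the upper quantile; it keeps \<open>\<alpha> = 1\<close> meaningful (essential infimum), where
  \<open>{y. F y \<ge> 0}\<close> would be unbounded below.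
\<close>

definition VaR :: "real \<Rightarrow> (real \<Rightarrow> real) \<Rightarrow> real" where
  "VaR \<alpha> F = Inf {y. F y > 1 - \<alpha>}"

text \<open>
  \<open>E\<^sub>F[Y | Y \<ge> VaR]\<close>, where \<open>E\<^sub>F\<close> is integration against the Stieltjes measure of \<open>F\<close>.  If \<open>F\<close> has an
  atom at \<open>VaR\<close> (always so for empirical cdfs), only the part of that atom that completes the tail
  mass to \<open>\<alpha>\<close> is counted.  Without such an atom this is the plain conditional expectation, see
  \<open>CVaR_eq_conditional_expectation\<close>.
\<close>

definition CVaR :: "real \<Rightarrow> (real \<Rightarrow> real) \<Rightarrow> real" where
  "CVaR \<alpha> F = ((LINT y:{VaR \<alpha> F<..}|interval_measure F. y)
      + VaR \<alpha> F * (\<alpha> - (1 - F (VaR \<alpha> F)))) / \<alpha>"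

lemma CVaR_eq_conditional_expectation:
  assumes "real_distribution M" and int: "integrable M (\<lambda>y. y)"
    and tail: "measure M {VaR \<alpha> (cdf M)..} = \<alpha>"
  shows "CVaR \<alpha> (cdf M) =
    (LINT y:{VaR \<alpha> (cdf M)..}|M. y) / measure M {VaR \<alpha> (cdf M)..}"
proof -
  interpret real_distribution M by fact
  define q where "q = VaR \<alpha> (cdf M)"
  have IM: "interval_measure (cdf M) = M"
  proof (rule cdf_unique)
    show "real_distribution (interval_measure (cdf M))"
      by (rule real_distribution_interval_measure)
        (auto intro: cdf_nondecreasing cdf_is_right_cont cdf_lim_at_bot cdf_lim_at_top_prob)
    show "cdf (interval_measure (cdf M)) = cdf M"
      by (rule cdf_interval_measure)
        (auto intro: cdf_nondecreasing cdf_is_right_cont cdf_lim_at_bot cdf_lim_at_top_prob)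
  qed fact
  have split: "{q..} = {q} \<union> {q<..}" by auto
  have m1: "measure M {q..} = measure M {q} + measure M {q<..}"
    unfolding split by (rule finite_measure_Union) auto
  have "{q<..} = space M - {..q}" by auto
  then have m2: "measure M {q<..} = 1 - cdf M q"
    using prob_compl[of "{..q}"] by (simp add: cdf_def)
  have si: "set_integrable M A (\<lambda>y. y)" if "A \<in> sets borel" for A
    unfolding set_integrable_def by (rule integrable_mult_indicator) (use int that in auto)
  have "(LINT y:{q..}|M. y) = (LINT y:{q}|M. y) + (LINT y:{q<..}|M. y)"
    unfolding split by (rule set_integral_Un) (auto intro: si)
  also have "(LINT y:{q}|M. y) = q * measure M {q}"
  proof -
    have "(LINT y:{q}|M. y) = (LINT y|M. indicator {q} y * q)"
      unfolding set_lebesgue_integral_def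
      by (rule Bochner_Integration.integral_cong) (auto simp: indicator_def)
    then show ?thesis by simp
  qed
  finally have "(LINT y:{q..}|M. y) = q * measure M {q} + (LINT y:{q<..}|M. y)" .
  moreover have "\<alpha> - (1 - cdf M q) = measure M {q}"
    using tail m1 m2 by (simp add: q_def)
  moreover have "measure M {q..} = \<alpha>"
    using tail by (simp add: q_def)
  ultimately show ?thesis
    unfolding CVaR_def IM q_def[symmetric] by simp
qed


section \<open>Decisions, costs and distributions\<close>

definition strongly_convex_grad :: "real \<Rightarrow> 'a::euclidean_space set \<Rightarrow> ('a \<Rightarrow> real) \<Rightarrow> bool" where
  "strongly_convex_grad m X f \<longleftrightarrow>
    (\<exists>grad. \<forall>x\<in>X. (f has_derivative (\<lambda>h. grad x \<bullet> h)) (at x within X) \<and>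
      (\<forall>y\<in>X. f y \<ge> f x + grad x \<bullet> (y - x) + m / 2 * (norm (x - y))\<^sup>2))"

text \<open>
  The dual form of the Wasserstein distance of two probability measures on the metric subspace
  \<open>S\<close>.  The integrability conditions hold for every Lipschitz \<open>f\<close> when both measures have finite
  first moment; in general they keep the two expectations meaningful.
\<close>

definition wasserstein1 :: "real \<Rightarrow> 'b::metric_space set \<Rightarrow> 'b measure \<Rightarrow> 'b measure \<Rightarrow> ereal" where
  "wasserstein1 K S \<mu> \<nu> =
    (SUP f\<in>{f. K-lipschitz_on S f \<and> integrable \<mu> f \<and> integrable \<nu> f}.
      ereal ((LINT z|\<mu>. f z) - (LINT z|\<nu>. f z))) / ereal K"

definition cvar_cost :: "('a \<Rightarrow> 'b \<Rightarrow> real) \<Rightarrow> real \<Rightarrow> 'b measure \<Rightarrow> 'a \<Rightarrow> real" where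
  "cvar_cost J \<alpha> \<mu> x = CVaR \<alpha> (cdf (distr \<mu> borel (J x)))"


section \<open>The algorithm\<close>

definition epoch :: "nat \<Rightarrow> nat \<Rightarrow> nat" where
  "epoch \<Delta> t = t - (nat \<lceil>real t / real \<Delta>\<rceil> - 1) * \<Delta>"

definition shrunk :: "'a::real_vector set \<Rightarrow> real \<Rightarrow> real \<Rightarrow> 'a set" where
  "shrunk X r \<delta> = {x \<in> X. (1 / (1 - \<delta> / r)) *\<^sub>R x \<in> X}"

definition emp_cdf :: "('b \<Rightarrow> real) \<Rightarrow> nat \<Rightarrow> (nat \<Rightarrow> 'b) \<Rightarrow> real \<Rightarrow> real" where
  "emp_cdf f n z y = (1 / real n) * (\<Sum>i=1..n. of_bool (f (z i) \<le> y))"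

definition grad_estimate ::
  "(real^'d \<Rightarrow> 'b \<Rightarrow> real) \<Rightarrow> real \<Rightarrow> real \<Rightarrow> nat \<Rightarrow> real^'d \<Rightarrow> real^'d \<Rightarrow> (nat \<Rightarrow> 'b) \<Rightarrow> real^'d" where
  "grad_estimate J \<alpha> \<delta> n x u z =
    (real CARD('d) / \<delta> * CVaR \<alpha> (emp_cdf (J (x + \<delta> *\<^sub>R u)) n z)) *\<^sub>R u"

text \<open>
  \<open>iterate \<dots> t\<close> is the \<open>t\<close>-th iterate for \<open>t \<ge> 1\<close> (the value at \<open>0\<close> plays no role), as a function
  of the directions \<open>u t\<close> and of the samples \<open>\<xi> (t, i)\<close>, \<open>1 \<le> i \<le> \<phi> (epoch \<Delta> t)\<close>.
\<close>

primrec iterate ::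
  "(real^'d \<Rightarrow> 'b \<Rightarrow> real) \<Rightarrow> (real^'d) set \<Rightarrow> real \<Rightarrow> real \<Rightarrow> nat \<Rightarrow> real \<Rightarrow> (nat \<Rightarrow> nat) \<Rightarrow>
    (nat \<Rightarrow> real) \<Rightarrow> real^'d \<Rightarrow> (nat \<Rightarrow> real^'d) \<Rightarrow> (nat \<times> nat \<Rightarrow> 'b) \<Rightarrow> nat \<Rightarrow> real^'d" where
  "iterate J X r \<alpha> \<Delta> \<delta> \<phi> \<eta> x1 u \<xi> 0 = x1"
| "iterate J X r \<alpha> \<Delta> \<delta> \<phi> \<eta> x1 u \<xi> (Suc t) =
    (if t = 0 then x1
     else closest_point (shrunk X r \<delta>)
       (iterate J X r \<alpha> \<Delta> \<delta> \<phi> \<eta> x1 u \<xi> t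
         - \<eta> t *\<^sub>R grad_estimate J \<alpha> \<delta> (\<phi> (epoch \<Delta> t))
                     (iterate J X r \<alpha> \<Delta> \<delta> \<phi> \<eta> x1 u \<xi> t) (u t) (\<lambda>i. \<xi> (t, i))))"

text \<open>
  The uniform distribution on the unit sphere (normalised surface measure), as the law of the
  direction \<open>sgn v = v /\<^sub>R norm v\<close> of a point \<open>v\<close> drawn uniformly from the unit ball.  Its space is
  the sphere itself, so that along every sample path only points of \<open>X\<close> are queried.
\<close>

definition uniform_sphere :: "'a::euclidean_space measure" where
  "uniform_sphere =
    restrict_space (distr (uniform_measure lborel (ball 0 1)) borel sgn) (sphere 0 1)"

text \<open>The joint law of all directions and all noise samples, which are mutually independent.\<close>

definition sampling_measure ::
  "nat \<Rightarrow> (nat \<Rightarrow> nat) \<Rightarrow> (nat \<Rightarrow> 'b measure) \<Rightarrow>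
    ((nat \<Rightarrow> 'a::euclidean_space) \<times> (nat \<times> nat \<Rightarrow> 'b)) measure" where
  "sampling_measure T n D =
    (\<Pi>\<^sub>M t\<in>{1..T}. uniform_sphere) \<Otimes>\<^sub>M (\<Pi>\<^sub>M (t, i)\<in>(SIGMA t:{1..T}. {1..n t}). D t)"

definition dynamic_regret ::
  "('a \<Rightarrow> 'b \<Rightarrow> real) \<Rightarrow> 'a set \<Rightarrow> real \<Rightarrow> (nat \<Rightarrow> 'b measure) \<Rightarrow> nat \<Rightarrow> (nat \<Rightarrow> 'a) \<Rightarrow> real" where
  "dynamic_regret J X \<alpha> D T xhat =
    (\<Sum>t=1..T. cvar_cost J \<alpha> (D t) (xhat t))
    - (\<Sum>t=1..T. cvar_cost J \<alpha> (D t) (arg_min_on (cvar_cost J \<alpha> (D t)) X))"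

definition algorithm_regret ::
  "(real^'d \<Rightarrow> 'b \<Rightarrow> real) \<Rightarrow> (real^'d) set \<Rightarrow> real \<Rightarrow> real \<Rightarrow> (nat \<Rightarrow> 'b measure) \<Rightarrow> nat \<Rightarrow>
    nat \<Rightarrow> real \<Rightarrow> (nat \<Rightarrow> nat) \<Rightarrow> (nat \<Rightarrow> real) \<Rightarrow> real^'d \<Rightarrow>
    (nat \<Rightarrow> real^'d) \<times> (nat \<times> nat \<Rightarrow> 'b) \<Rightarrow> real" where
  "algorithm_regret J X r \<alpha> D T \<Delta> \<delta> \<phi> \<eta> x1 = (\<lambda>(u, \<xi>).
    dynamic_regret J X \<alpha> D T
      (\<lambda>t. iterate J X r \<alpha> \<Delta> \<delta> \<phi> \<eta> x1 u \<xi> t + \<delta> *\<^sub>R u t))"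

text \<open>
  The regret is at most \<open>B\<close> with probability at least \<open>1 - \<gamma>\<close>, where the step size within a batch
  is \<open>1 / (m \<tau>)\<close> with \<open>\<tau>\<close> the epoch.
\<close>

definition achieves_regret ::
  "(real^'d \<Rightarrow> 'b \<Rightarrow> real) \<Rightarrow> (real^'d) set \<Rightarrow> real \<Rightarrow> real \<Rightarrow> real \<Rightarrow> (nat \<Rightarrow> 'b measure) \<Rightarrow> nat \<Rightarrow>
    nat \<Rightarrow> real \<Rightarrow> (nat \<Rightarrow> nat) \<Rightarrow> real^'d \<Rightarrow> real \<Rightarrow> real \<Rightarrow> bool" where
  "achieves_regret J X r m \<alpha> D T \<Delta> \<delta> \<phi> x1 \<gamma> B \<longleftrightarrow>
    (let P = sampling_measure T (\<lambda>t. \<phi> (epoch \<Delta> t)) D;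
         \<eta> = (\<lambda>t. 1 / (m * real (epoch \<Delta> t)))
     in measure P {\<omega> \<in> space P. algorithm_regret J X r \<alpha> D T \<Delta> \<delta> \<phi> \<eta> x1 \<omega> \<le> B} \<ge> 1 - \<gamma>)"

text \<open>\<open>k\<close> is an integer rounding (either way) of the real number \<open>q\<close>; it equals \<open>q\<close> if \<open>q\<close> is integral.\<close>

definition rounds :: "nat \<Rightarrow> real \<Rightarrow> bool" where
  "rounds k q \<longleftrightarrow> \<bar>real k - q\<bar> < 1"

end

theory Submission
  imports Defs
begin

text \<open>
  The bound is obtained in expectation; the regret is nonnegative, so Markov's inequality turns it
  into a bound with probability \<open>1 - \<gamma>\<close> at the price of a factor \<open>1 / \<gamma>\<close>.

  By the Rockafellar--Uryasev formula, CVaR is the minimum over \<open>v\<close> of \<open>v + E[max 0 (Y - v)] / \<alpha>\<close>.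
  Hence the costs \<open>C t\<close> inherit strong convexity and Lipschitz continuity from \<open>J\<close>, move by at most
  \<open>L\<^sub>\<xi> / \<alpha>\<close> times the Wasserstein distance from one step to the next, and the error of the empirical
  CVaR of \<open>n\<close> samples is, through the integral of the deviation of the cdfs, of order \<open>1 / sqrt n\<close>.

  The one-point estimate is handled without differentiating the smoothed cost: translating a
  radial cutoff function and letting its transition layer shrink to the sphere shows that
  \<open>d / \<delta> * E[C t (x + \<delta> *\<^sub>R u) * (u \<bullet> (y - x))]\<close> is at most
  \<open>C t y - C t x + 2 * L\<^sub>0 * \<delta> - m / 2 * (norm (y - x))\<^sup>2\<close>. This replaces the subgradient inequality
  in the analysis of gradient descent with steps \<open>1 / (m * \<tau>)\<close>, which telescopes over each batch
  against the shrunk minimiser of the first cost of the batch.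
\<close>

section \<open>Rockafellar--Uryasev formula and empirical CVaR\<close>

text \<open>No conditional expectations are formed. The iterate of round \<open>t\<close> reads only
  directions and samples of earlier rounds, so under the product law the coordinates of round
  \<open>t\<close> can be integrated with all others frozen; this is done once for the noise block
  (error of the empirical CVaR) and once for the direction (gradient inequality). Projecting onto
  the shrunk set keeps every query in \<open>X\<close> along every path, which supplies both the
  bound \<open>U\<close> and the nonnegative regret.

  With steps 1/(m \<tau>) the quadratic gain of strong convexity cancels the initial distance
  exactly. A batch then costs its variance ln(\<Delta>)/\<delta>^2, its sampling error
  \<Delta>^(1-a/2)/\<delta>, the bias \<Delta>\<delta>, and \<Delta> times the variation inside it.
  Put \<delta> = (V/T)^p and \<Delta> = (T/V)^w. Over about T/\<Delta> batches every term is at most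
  of order T\<delta>, up to a logarithm, when 3p \<le> w, 4p \<le> wa and w + p \<le> 1. The largest
  such p is the minimum of a/(4+a) and 1/4, which cross at a = 4/3.\<close>

lemma (in prob_space) bounded_integrable:
  fixes f :: "'a \<Rightarrow> real"
  assumes "f \<in> borel_measurable M" "\<And>x. x \<in> space M \<Longrightarrow> \<bar>f x\<bar> \<le> B"
  shows "integrable M f"
  using assms by (intro integrable_const_bound[where B = B]) auto

lemma (in prob_space) bounded_integral_le:
  fixes f :: "'a \<Rightarrow> real"
  assumes "integrable M f" "\<And>x. x \<in> space M \<Longrightarrow> f x \<le> B"
  shows "(\<integral>x. f x \<partial>M) \<le> B"
  using integral_mono[OF assms(1) integrable_const[of B]] assms(2) by (simp add: prob_space)

lemma (in prob_space) bounded_integral_ge: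
  fixes f :: "'a \<Rightarrow> real"
  assumes "integrable M f" "\<And>x. x \<in> space M \<Longrightarrow> B \<le> f x"
  shows "B \<le> (\<integral>x. f x \<partial>M)"
  using integral_mono[OF integrable_const[of B] assms(1)] assms(2) by (simp add: prob_space)

definition ru_objective :: "real \<Rightarrow> 'a measure \<Rightarrow> ('a \<Rightarrow> real) \<Rightarrow> real \<Rightarrow> real" where
  "ru_objective \<alpha> N f v = v + (\<integral>x. max 0 (f x - v) \<partial>N) / \<alpha>"

lemma (in real_distribution) interval_measure_cdf: "interval_measure (cdf M) = M"
proof (rule cdf_unique)
  show "real_distribution (interval_measure (cdf M))"
    by (rule real_distribution_interval_measure)
      (auto intro: cdf_nondecreasing cdf_is_right_cont cdf_lim_at_bot cdf_lim_at_top_prob)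
  show "cdf (interval_measure (cdf M)) = cdf M"
    by (rule cdf_interval_measure)
      (auto intro: cdf_nondecreasing cdf_is_right_cont cdf_lim_at_bot cdf_lim_at_top_prob)
qed unfold_locales

lemma (in real_distribution) measure_greaterThan: "measure M {q<..} = 1 - cdf M q"
proof -
  have "{q<..} = space M - {..q}" by auto
  then show ?thesis
    using prob_compl[of "{..q}"] by (simp add: cdf_def)
qed

text \<open>The infimum defining \<open>VaR\<close> need not belong to its set, so at the quantile
  itself only the weak inequality survives, by right continuity of the cdf. The two conditions on
  \<open>U\<close> make the set nonempty and bounded below.\<close>

lemma (in real_distribution) VaR_quantile:
  assumes U: "\<And>y. y < - U \<Longrightarrow> cdf M y = 0" "cdf M U = 1" and \<alpha>: "0 < \<alpha>" "\<alpha> \<le> 1"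
  shows "1 - \<alpha> \<le> cdf M (VaR \<alpha> (cdf M))" "y < VaR \<alpha> (cdf M) \<Longrightarrow> cdf M y \<le> 1 - \<alpha>"
proof -
  let ?S = "{y. cdf M y > 1 - \<alpha>}"
  have ne: "U \<in> ?S" using U \<alpha> by simp
  have bdd: "bdd_below ?S"
    using U(1) \<alpha> by (intro bdd_belowI[of _ "- U"]) (force simp: not_less[symmetric])
  show "cdf M y \<le> 1 - \<alpha>" if "y < VaR \<alpha> (cdf M)" for y
    using that cInf_lower[OF _ bdd, of y] unfolding VaR_def by force
  have above: "1 - \<alpha> < cdf M y" if y: "VaR \<alpha> (cdf M) < y" for y
  proof -
    obtain z where "z \<in> ?S" "z < y"
      using y ne cInf_less_iff[OF _ bdd, of y] unfolding VaR_def by auto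
    then show ?thesis using cdf_nondecreasing[of z y] by simp
  qed
  have "eventually (\<lambda>y. 1 - \<alpha> \<le> cdf M y) (at_right (VaR \<alpha> (cdf M)))"
    unfolding eventually_at_right_field
    by (intro exI[of _ "VaR \<alpha> (cdf M) + 1"]) (auto dest: above less_imp_le)
  then show "1 - \<alpha> \<le> cdf M (VaR \<alpha> (cdf M))"
    using cdf_is_right_cont[of "VaR \<alpha> (cdf M)"] unfolding continuous_within
    by (intro tendsto_lowerbound[where F = "at_right (VaR \<alpha> (cdf M))"]) auto
qed

text \<open>The slope of the objective at \<open>v\<close> is 1 - P(f > v)/\<alpha>, which changes
  sign at the quantile \<open>q\<close>; both cases below are this slope bound in integrated form.
  The partial atom counted in \<open>CVaR\<close> is exactly what turns the value at
  \<open>q\<close> into an identity.\<close>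

lemma (in prob_space) rockafellar_uryasev:
  fixes f :: "'a \<Rightarrow> real"
  assumes f[measurable]: "f \<in> borel_measurable M" and U: "\<And>x. x \<in> space M \<Longrightarrow> \<bar>f x\<bar> \<le> U"
    and \<alpha>: "0 < \<alpha>" "\<alpha> \<le> 1"
  shows "\<exists>q. CVaR \<alpha> (cdf (distr M borel f)) = ru_objective \<alpha> M f q
    \<and> (\<forall>v. ru_objective \<alpha> M f q \<le> ru_objective \<alpha> M f v)"
proof -
  define N where "N = distr M borel f"
  interpret N: real_distribution N unfolding N_def by (rule real_distribution_distr) simp
  define q where "q = VaR \<alpha> (cdf N)"
  have cdfN: "cdf N y = prob {x \<in> space M. f x \<le> y}" for y
    unfolding N_def cdf_def by (subst measure_distr) (auto intro!: arg_cong[where f = prob])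
  have "cdf N y = 0" if "y < - U" for y
  proof -
    have "{x \<in> space M. f x \<le> y} = {}" using U that by force
    then show ?thesis unfolding cdfN by (simp only: measure_empty)
  qed
  moreover have "cdf N U = 1"
  proof -
    have "{x \<in> space M. f x \<le> U} = space M" using U by force
    then show ?thesis unfolding cdfN by (simp only: prob_space)
  qed
  ultimately have q: "1 - \<alpha> \<le> cdf N q" "\<And>y. y < q \<Longrightarrow> cdf N y \<le> 1 - \<alpha>"
    using N.VaR_quantile[of U \<alpha>] \<alpha> unfolding q_def by blast+
  have int: "integrable N (\<lambda>y. y)"
    unfolding N_def using U by (subst integrable_distr_eq) (auto intro!: bounded_integrable[of _ U])
  have int': "integrable N (\<lambda>y. max 0 (y - v))" for v
    using int by auto
  have tail: "measure N {w<..} = 1 - cdf N w" for w by (rule N.measure_greaterThan)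
  have ind: "integrable N (indicator {w<..} :: _ \<Rightarrow> real)"
    "(\<integral>y. indicator {w<..} y \<partial>N) = 1 - cdf N w" for w
    using tail[of w] by (auto simp: N.emeasure_eq_measure)
  have ru: "ru_objective \<alpha> M f v = v + (\<integral>y. max 0 (y - v) \<partial>N) / \<alpha>" for v
    unfolding ru_objective_def N_def by (subst integral_distr) auto
  have "(LINT y:{q<..}|N. y) = (\<integral>y. max 0 (y - q) + q * indicator {q<..} y \<partial>N)"
    unfolding set_lebesgue_integral_def
    by (intro Bochner_Integration.integral_cong) (auto simp: indicator_def)
  also have "\<dots> = (\<integral>y. max 0 (y - q) \<partial>N) + q * (1 - cdf N q)"
    using int' ind by (subst Bochner_Integration.integral_add) auto
  finally have "CVaR \<alpha> (cdf N) = ru_objective \<alpha> M f q"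
    unfolding CVaR_def N.interval_measure_cdf q_def[symmetric] ru
    using \<alpha> by (simp add: field_simps)
  moreover have "ru_objective \<alpha> M f q \<le> ru_objective \<alpha> M f v" for v
  proof (cases "v < q")
    case True
    \<comment> \<open>The tail beyond \<open>q\<close> may have mass below \<alpha> when
      \<open>q\<close> is an atom. The tail beyond any \<open>w < q\<close> has mass at least
      \<alpha>, so the bound is proved for such \<open>w\<close>, and \<open>w\<close> is then moved
      up to \<open>q\<close> by density.\<close>
    have "(w - v) * \<alpha> \<le> (\<integral>y. max 0 (y - v) \<partial>N) - (\<integral>y. max 0 (y - q) \<partial>N)"
      if w: "v < w" "w < q" for w
    proof -
      have "(w - v) * \<alpha> \<le> (w - v) * (1 - cdf N w)"
        using w q(2)[of w] by (intro mult_left_mono) auto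
      also have "\<dots> = (\<integral>y. (w - v) * indicator {w<..} y \<partial>N)"
        using ind by simp
      also have "\<dots> \<le> (\<integral>y. max 0 (y - v) - max 0 (y - q) \<partial>N)"
      proof (rule integral_mono)
        show "(w - v) * indicator {w<..} y \<le> max 0 (y - v) - max 0 (y - q)" for y
          using w by (auto simp: indicator_def max_def)
      qed (use int' ind in auto)
      finally show ?thesis using int' by simp
    qed
    then have "w - v \<le> ((\<integral>y. max 0 (y - v) \<partial>N) - (\<integral>y. max 0 (y - q) \<partial>N)) / \<alpha>"
      if "v < w" "w < q" for w
      using that \<alpha> by (simp add: pos_le_divide_eq)
    then have "w \<le> v + ((\<integral>y. max 0 (y - v) \<partial>N) - (\<integral>y. max 0 (y - q) \<partial>N)) / \<alpha>"
      if "v < w" "w < q" for w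
      using that by fastforce
    then have "q \<le> v + ((\<integral>y. max 0 (y - v) \<partial>N) - (\<integral>y. max 0 (y - q) \<partial>N)) / \<alpha>"
      using True by (rule dense_le_bounded[rotated])
    then show ?thesis by (simp add: ru diff_divide_distrib)
  next
    case False
    \<comment> \<open>Here \<open>q - v\<close> is nonpositive and the tail mass at \<open>q\<close>
      is at most \<alpha>, so the inequality reverses and no approximation of \<open>q\<close> is
      necessary.\<close>
    have "(q - v) * \<alpha> \<le> (q - v) * (1 - cdf N q)"
      using False q(1) by (intro mult_left_mono_neg) auto
    also have "\<dots> = (\<integral>y. (q - v) * indicator {q<..} y \<partial>N)"
      using ind by simp
    also have "\<dots> \<le> (\<integral>y. max 0 (y - v) - max 0 (y - q) \<partial>N)"
    proof (rule integral_mono)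
      show "(q - v) * indicator {q<..} y \<le> max 0 (y - v) - max 0 (y - q)" for y
        using False by (auto simp: indicator_def max_def)
    qed (use int' ind in auto)
    finally have "(q - v) * \<alpha> \<le> (\<integral>y. max 0 (y - v) \<partial>N) - (\<integral>y. max 0 (y - q) \<partial>N)"
      using int' by simp
    then have "q - v \<le> ((\<integral>y. max 0 (y - v) \<partial>N) - (\<integral>y. max 0 (y - q) \<partial>N)) / \<alpha>"
      using \<alpha> by (simp add: field_simps)
    then show ?thesis by (simp add: ru diff_divide_distrib)
  qed
  ultimately show ?thesis unfolding N_def by blast
qed

text \<open>The random variable keeps its own probability space, so the noise law and the uniform
  law on sample indices are handled by the same lemmas.\<close>

definition cvar_of :: "real \<Rightarrow> 'a measure \<Rightarrow> ('a \<Rightarrow> real) \<Rightarrow> real" where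
  "cvar_of \<alpha> N f = CVaR \<alpha> (cdf (distr N borel f))"

lemma (in prob_space) cvar_of_le:
  assumes "f \<in> borel_measurable M" "\<And>x. x \<in> space M \<Longrightarrow> \<bar>f x\<bar> \<le> U" "0 < \<alpha>" "\<alpha> \<le> 1"
  shows "cvar_of \<alpha> M f \<le> ru_objective \<alpha> M f v"
  using rockafellar_uryasev[OF assms] unfolding cvar_of_def by auto

lemma (in prob_space) cvar_of_attained:
  assumes "f \<in> borel_measurable M" "\<And>x. x \<in> space M \<Longrightarrow> \<bar>f x\<bar> \<le> U" "0 < \<alpha>" "\<alpha> \<le> 1"
  obtains q where "cvar_of \<alpha> M f = ru_objective \<alpha> M f q"
  using rockafellar_uryasev[OF assms] unfolding cvar_of_def by auto

lemma (in prob_space) integrable_hinge: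
  fixes f :: "'a \<Rightarrow> real"
  assumes [measurable]: "f \<in> borel_measurable M" and "\<And>x. x \<in> space M \<Longrightarrow> \<bar>f x\<bar> \<le> U"
  shows "integrable M (\<lambda>x. max 0 (f x - v))"
  using bounded_integrable[OF assms] by auto

text \<open>The threshold \<open>a * v + b * w + s\<close>, built from minimisers for
  \<open>g\<close> and \<open>h\<close>, is tested for \<open>f\<close>; the hinge is monotone and
  convex. The shift \<open>s\<close> may be negative, which is how the strong convexity term is
  transported.\<close>

lemma (in prob_space) cvar_of_convex:
  assumes f: "f \<in> borel_measurable M" "\<And>x. x \<in> space M \<Longrightarrow> \<bar>f x\<bar> \<le> U"
    and g: "g \<in> borel_measurable M" "\<And>x. x \<in> space M \<Longrightarrow> \<bar>g x\<bar> \<le> U"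
    and h: "h \<in> borel_measurable M" "\<And>x. x \<in> space M \<Longrightarrow> \<bar>h x\<bar> \<le> U"
    and \<alpha>: "0 < \<alpha>" "\<alpha> \<le> 1" and ab: "0 \<le> a" "0 \<le> b" "a + b = 1"
    and le: "\<And>x. x \<in> space M \<Longrightarrow> f x \<le> a * g x + b * h x + s"
  shows "cvar_of \<alpha> M f \<le> a * cvar_of \<alpha> M g + b * cvar_of \<alpha> M h + s"
proof -
  obtain v where v: "cvar_of \<alpha> M g = ru_objective \<alpha> M g v" using cvar_of_attained[OF g \<alpha>] .
  obtain w where w: "cvar_of \<alpha> M h = ru_objective \<alpha> M h w" using cvar_of_attained[OF h \<alpha>] .
  let ?z = "a * v + b * w + s"
  have hinge: "max 0 (f x - ?z) \<le> a * max 0 (g x - v) + b * max 0 (h x - w)"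
    if x: "x \<in> space M" for x
  proof -
    have "a * (g x - v) \<le> a * max 0 (g x - v)" "b * (h x - w) \<le> b * max 0 (h x - w)"
      "0 \<le> a * max 0 (g x - v)" "0 \<le> b * max 0 (h x - w)"
      using ab by (auto intro: mult_left_mono)
    then show ?thesis using le[OF x] by (auto simp: algebra_simps)
  qed
  have "cvar_of \<alpha> M f \<le> ru_objective \<alpha> M f ?z" by (rule cvar_of_le[OF f \<alpha>])
  also have "\<dots> \<le> ?z + (\<integral>x. a * max 0 (g x - v) + b * max 0 (h x - w) \<partial>M) / \<alpha>"
    unfolding ru_objective_def using \<alpha>
    by (intro add_left_mono divide_right_mono integral_mono hinge integrable_hinge[OF f]
        Bochner_Integration.integrable_add integrable_mult_right
        integrable_hinge[OF g] integrable_hinge[OF h]) auto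
  also have "\<dots> = a * cvar_of \<alpha> M g + b * cvar_of \<alpha> M h + s"
    unfolding v w ru_objective_def using integrable_hinge[OF g] integrable_hinge[OF h]
    by (simp add: algebra_simps add_divide_distrib)
  finally show ?thesis .
qed

lemma (in prob_space) cvar_of_shift:
  assumes f: "f \<in> borel_measurable M" "\<And>x. x \<in> space M \<Longrightarrow> \<bar>f x\<bar> \<le> U"
    and g: "g \<in> borel_measurable M" "\<And>x. x \<in> space M \<Longrightarrow> \<bar>g x\<bar> \<le> U"
    and \<alpha>: "0 < \<alpha>" "\<alpha> \<le> 1"
    and le: "\<And>x. x \<in> space M \<Longrightarrow> f x \<le> g x + s"
  shows "cvar_of \<alpha> M f \<le> cvar_of \<alpha> M g + s"
  using cvar_of_convex[OF f g g \<alpha>, of 1 0 s] le by simp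

lemma (in prob_space) cvar_of_bounded:
  assumes f: "f \<in> borel_measurable M" "\<And>x. x \<in> space M \<Longrightarrow> \<bar>f x\<bar> \<le> U" and \<alpha>: "0 < \<alpha>" "\<alpha> \<le> 1"
  shows "\<bar>cvar_of \<alpha> M f\<bar> \<le> U"
proof -
  obtain q where q: "cvar_of \<alpha> M f = ru_objective \<alpha> M f q" using cvar_of_attained[OF f \<alpha>] .
  have "ru_objective \<alpha> M f U = U + (\<integral>x. 0 \<partial>M) / \<alpha>"
    unfolding ru_objective_def using f(2)
    by (intro arg_cong2[where f = "(+)"] arg_cong2[where f = "(/)"]
        Bochner_Integration.integral_cong refl) (force simp: max_def)
  then have 1: "cvar_of \<alpha> M f \<le> U" using cvar_of_le[OF f \<alpha>, of U] by simp
  have "- U \<le> (\<integral>x. q + max 0 (f x - q) \<partial>M)"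
    using f(2) integrable_hinge[OF f, of q] by (intro bounded_integral_ge) (force simp: max_def)+
  also have "\<dots> = q + (\<integral>x. max 0 (f x - q) \<partial>M)"
    using integrable_hinge[OF f, of q] by (simp add: prob_space)
  also have "\<dots> \<le> ru_objective \<alpha> M f q"
  proof -
    have "0 \<le> (\<integral>x. max 0 (f x - q) \<partial>M)" by (intro integral_nonneg_AE) auto
    then show ?thesis unfolding ru_objective_def using \<alpha>
      by (simp add: le_divide_eq mult_left_le)
  qed
  finally show ?thesis using 1 q by auto
qed

text \<open>A minimiser for \<open>g\<close> is a legitimate threshold for \<open>f\<close>, so a
  bound on hinge expectations that is uniform in \<open>v\<close> passes to CVaR at the price of
  1/\<alpha>. Both the drift bound and the sampling error rest on this comparison.\<close>

lemma cvar_of_measure_diff: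
  assumes M: "prob_space M" and N: "prob_space N" and \<alpha>: "0 < \<alpha>" "\<alpha> \<le> 1"
    and f: "f \<in> borel_measurable M" "\<And>x. x \<in> space M \<Longrightarrow> \<bar>f x\<bar> \<le> U"
    and g: "g \<in> borel_measurable N" "\<And>x. x \<in> space N \<Longrightarrow> \<bar>g x\<bar> \<le> U"
    and diff: "\<And>v. (\<integral>x. max 0 (f x - v) \<partial>M) \<le> (\<integral>x. max 0 (g x - v) \<partial>N) + e"
  shows "cvar_of \<alpha> M f \<le> cvar_of \<alpha> N g + e / \<alpha>"
proof -
  interpret M: prob_space M by fact
  interpret N: prob_space N by fact
  obtain q where q: "cvar_of \<alpha> N g = ru_objective \<alpha> N g q" using N.cvar_of_attained[OF g \<alpha>] .
  have "cvar_of \<alpha> M f \<le> ru_objective \<alpha> M f q" by (rule M.cvar_of_le[OF f \<alpha>])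
  also have "\<dots> \<le> ru_objective \<alpha> N g q + e / \<alpha>"
    unfolding ru_objective_def add_divide_distrib[symmetric] add.assoc
    using diff[of q] \<alpha> by (intro add_left_mono divide_right_mono) auto
  finally show ?thesis unfolding q .
qed

text \<open>The hinge function as an integral of tail indicators: this reduces the deviation of an
  empirical CVaR to the pointwise deviation of the empirical cdf.\<close>

lemma hinge_layer_cake:
  fixes y v U :: real
  assumes "\<bar>y\<bar> \<le> U"
  shows "max 0 (y - v) = max 0 (- U - v)
    + (\<integral>s. indicator {v..} s * indicator {s. s < y} s \<partial>restrict_space lborel {-U..U})"
proof -
  have "(\<integral>s. indicator {v..} s * indicator {s. s < y} s \<partial>restrict_space lborel {-U..U})
    = (\<integral>s. indicator {-U..U} s *\<^sub>R (indicator {v..} s * indicator {s. s < y} s :: real) \<partial>lborel)"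
    by (subst integral_restrict_space) auto
  also have "\<dots> = (\<integral>s. indicator {max v (-U)..<y} s \<partial>lborel)"
    using assms by (intro Bochner_Integration.integral_cong) (auto simp: indicator_def)
  also have "\<dots> = measure lborel {max v (-U)..<y}"
    by simp
  also have "\<dots> = max 0 (y - max v (-U))"
    by (auto simp: max_def)
  finally show ?thesis using assms by (auto simp: max_def)
qed

lemma finite_measure_Fubini:
  fixes f :: "'a \<times> 'b \<Rightarrow> real"
  assumes M: "finite_measure M" and N: "finite_measure N" and f[measurable]: "f \<in> borel_measurable (M \<Otimes>\<^sub>M N)"
    and B: "\<And>x y. x \<in> space M \<Longrightarrow> y \<in> space N \<Longrightarrow> \<bar>f (x, y)\<bar> \<le> B"
  shows "(\<integral>y. \<integral>x. f (x, y) \<partial>M \<partial>N) = (\<integral>x. \<integral>y. f (x, y) \<partial>N \<partial>M)"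
    and "integral\<^sup>L (M \<Otimes>\<^sub>M N) f = (\<integral>x. \<integral>y. f (x, y) \<partial>N \<partial>M)"
    and "integrable (M \<Otimes>\<^sub>M N) f"
    and "integrable M (\<lambda>x. \<integral>y. f (x, y) \<partial>N)"
    and "integrable N (\<lambda>y. \<integral>x. f (x, y) \<partial>M)"
proof -
  interpret M: finite_measure M by fact
  interpret N: finite_measure N by fact
  interpret pair_sigma_finite M N ..
  interpret MN: finite_measure "M \<Otimes>\<^sub>M N" by (rule finite_measure_pair_measure[OF N M])
  show int: "integrable (M \<Otimes>\<^sub>M N) f"
    using B by (intro MN.integrable_const_bound[where B = B] AE_I2) (auto simp: space_pair_measure)
  have int': "integrable (M \<Otimes>\<^sub>M N) (case_prod (\<lambda>x y. f (x, y)))" using int by simp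
  show "(\<integral>y. \<integral>x. f (x, y) \<partial>M \<partial>N) = (\<integral>x. \<integral>y. f (x, y) \<partial>N \<partial>M)"
    using Fubini_integral[OF int'] by simp
  show "integral\<^sup>L (M \<Otimes>\<^sub>M N) f = (\<integral>x. \<integral>y. f (x, y) \<partial>N \<partial>M)"
    using integral_fst'[OF int] by simp
  show "integrable M (\<lambda>x. \<integral>y. f (x, y) \<partial>N)" by (rule integrable_fst'[OF int])
  show "integrable N (\<lambda>y. \<integral>x. f (x, y) \<partial>M)" using integrable_snd[OF int'] by simp
qed

lemma finite_measure_Icc: "finite_measure (restrict_space lborel {a..b::real})"
  by (rule finite_measureI) (simp add: emeasure_restrict_space space_restrict_space emeasure_lborel_Icc_eq)

text \<open>The summand \<open>max 0 (- U - v)\<close> does not depend on the law and cancels when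
  two laws with the same bound \<open>U\<close> are compared.\<close>

lemma (in prob_space) expectation_hinge:
  fixes f :: "'a \<Rightarrow> real"
  assumes f[measurable]: "f \<in> borel_measurable M" and U: "\<And>x. x \<in> space M \<Longrightarrow> \<bar>f x\<bar> \<le> U"
  shows "(\<integral>x. max 0 (f x - v) \<partial>M) = max 0 (- U - v)
    + (\<integral>s. indicat_real {v..} s * (1 - cdf (distr M borel f) s) \<partial>restrict_space lborel {-U..U})"
proof -
  let ?R = "restrict_space lborel {-U..U}"
  note fub = finite_measure_Fubini[OF finite_measure_axioms finite_measure_Icc[of "-U" U],
      where f = "\<lambda>(x, s). indicat_real {v..} s * indicat_real {(s, y). s < y} (s, f x)" and B = 1]
  have [measurable]: "(\<lambda>s. s) \<in> borel_measurable ?R"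
    by (intro measurable_restrict_space1) simp
  have "(\<lambda>p. (snd p, f (fst p))) \<in> measurable (M \<Otimes>\<^sub>M ?R) (borel \<Otimes>\<^sub>M borel)"
    by measurable
  moreover have "{p \<in> space (borel \<Otimes>\<^sub>M borel). fst p < (snd p :: real)} \<in> sets (borel \<Otimes>\<^sub>M borel)"
    by measurable
  then have "{(s::real, y). s < y} \<in> sets (borel \<Otimes>\<^sub>M borel)"
    by (simp add: space_pair_measure case_prod_unfold)
  ultimately have meas: "(\<lambda>(x, s). indicat_real {v..} s * indicat_real {(s, y). s < y} (s, f x))
     \<in> borel_measurable (M \<Otimes>\<^sub>M ?R)"
    unfolding case_prod_beta
    by (intro borel_measurable_times measurable_compose[where g = "indicat_real {(s, y). s < y}"]) auto
  have bd: "\<bar>(\<lambda>(x, s). indicat_real {v..} s * indicat_real {(s, y). s < y} (s, f x)) (x, s)\<bar> \<le> 1" for x s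
    by (auto simp: indicator_def)
  note fub' = fub(1,4)[OF meas bd, unfolded prod.case]
  have tail: "(\<integral>x. indicat_real {(s, y). s < y} (s, f x) \<partial>M) = 1 - cdf (distr M borel f) s" for s
  proof -
    interpret N: real_distribution "distr M borel f" by (rule real_distribution_distr) simp
    have "(\<integral>x. indicat_real {(s, y). s < y} (s, f x) \<partial>M) = (\<integral>x. indicat_real {s<..} (f x) \<partial>M)"
      by (intro Bochner_Integration.integral_cong) (auto simp: indicator_def)
    also have "\<dots> = (\<integral>y. indicator {s<..} y \<partial>distr M borel f)"
      by (subst integral_distr) auto
    finally show ?thesis by (simp add: N.measure_greaterThan)
  qed
  have "(\<integral>x. max 0 (f x - v) \<partial>M) = (\<integral>x. max 0 (- U - v)
    + (\<integral>s. indicat_real {v..} s * indicat_real {(s, y). s < y} (s, f x) \<partial>?R) \<partial>M)"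
    using hinge_layer_cake[OF U, of _ v] by (intro Bochner_Integration.integral_cong) (auto simp: indicator_def)
  also have "\<dots> = max 0 (- U - v)
    + (\<integral>x. \<integral>s. indicat_real {v..} s * indicat_real {(s, y). s < y} (s, f x) \<partial>?R \<partial>M)"
    using fub'(2) by (subst Bochner_Integration.integral_add) (simp_all add: prob_space del: indicator_simps)
  also have "(\<integral>x. \<integral>s. indicat_real {v..} s * indicat_real {(s, y). s < y} (s, f x) \<partial>?R \<partial>M)
    = (\<integral>s. \<integral>x. indicat_real {v..} s * indicat_real {(s, y). s < y} (s, f x) \<partial>M \<partial>?R)"
    by (rule fub'(1)[symmetric])
  finally show ?thesis by (simp add: tail)
qed

text \<open>The integral is the 1-Wasserstein distance of the two laws, both carried by [-U, U].
  Hinges are 1-Lipschitz, so their expectations differ by at most this distance.\<close>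

lemma cvar_of_cdf_diff:
  assumes M: "prob_space M" and N: "prob_space N" and \<alpha>: "0 < \<alpha>" "\<alpha> \<le> 1"
    and f: "f \<in> borel_measurable M" "\<And>x. x \<in> space M \<Longrightarrow> \<bar>f x\<bar> \<le> U"
    and g: "g \<in> borel_measurable N" "\<And>x. x \<in> space N \<Longrightarrow> \<bar>g x\<bar> \<le> U"
  shows "\<bar>cvar_of \<alpha> M f - cvar_of \<alpha> N g\<bar>
    \<le> (\<integral>s. \<bar>cdf (distr M borel f) s - cdf (distr N borel g) s\<bar> \<partial>restrict_space lborel {-U..U}) / \<alpha>"
proof -
  interpret M: prob_space M by fact
  interpret N: prob_space N by fact
  interpret M': real_distribution "distr M borel f" by (rule M.real_distribution_distr) (use f in auto)
  interpret N': real_distribution "distr N borel g" by (rule N.real_distribution_distr) (use g in auto)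
  let ?R = "restrict_space lborel {-U..U}"
  let ?F = "cdf (distr M borel f)" and ?G = "cdf (distr N borel g)"
  interpret R: finite_measure ?R by (rule finite_measure_Icc)
  have mono: "mono ?F" "mono ?G" 
    by (auto intro!: monoI M'.cdf_nondecreasing N'.cdf_nondecreasing)
  have [measurable]: "?F \<in> borel_measurable ?R" "?G \<in> borel_measurable ?R"
    by (auto intro!: measurable_restrict_space1 borel_measurable_mono mono)
  have [measurable]: "indicator {v..} \<in> borel_measurable ?R" for v :: real
    by (auto intro!: measurable_restrict_space1)
  have bds: "0 \<le> ?F s" "?F s \<le> 1" "0 \<le> ?G s" "?G s \<le> 1" for s
    using M'.cdf_nonneg M'.cdf_bounded_prob N'.cdf_nonneg N'.cdf_bounded_prob by auto
  have intF: "integrable ?R (\<lambda>s. indicator {v..} s * (1 - ?F s))" for v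
  proof (intro R.integrable_const_bound[where B = 1] AE_I2)
    show "norm (indicator {v..} s * (1 - ?F s)) \<le> 1" for s using bds[of s] by (auto simp: indicator_def)
  qed measurable
  have intG: "integrable ?R (\<lambda>s. indicator {v..} s * (1 - ?G s))" for v
  proof (intro R.integrable_const_bound[where B = 1] AE_I2)
    show "norm (indicator {v..} s * (1 - ?G s)) \<le> 1" for s using bds[of s] by (auto simp: indicator_def)
  qed measurable
  have intd: "integrable ?R (\<lambda>s. \<bar>?F s - ?G s\<bar>)"
  proof (intro R.integrable_const_bound[where B = 1] AE_I2)
    show "norm \<bar>?F s - ?G s\<bar> \<le> 1" for s using bds[of s] by auto
  qed measurable
  have pt: "indicator {v..} s * (1 - ?F s) \<le> indicator {v..} s * (1 - ?G s) + \<bar>?F s - ?G s\<bar>"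
    "indicator {v..} s * (1 - ?G s) \<le> indicator {v..} s * (1 - ?F s) + \<bar>?F s - ?G s\<bar>" for v s
    by (auto simp: indicator_def)
  have *: "(\<integral>s. indicator {v..} s * (1 - ?F s) \<partial>?R) \<le> (\<integral>s. indicator {v..} s * (1 - ?G s) \<partial>?R) + (\<integral>s. \<bar>?F s - ?G s\<bar> \<partial>?R)" for v
    unfolding Bochner_Integration.integral_add[OF intG intd, symmetric]
    by (intro integral_mono intF intG intd Bochner_Integration.integrable_add pt)
  have **: "(\<integral>s. indicator {v..} s * (1 - ?G s) \<partial>?R) \<le> (\<integral>s. indicator {v..} s * (1 - ?F s) \<partial>?R) + (\<integral>s. \<bar>?F s - ?G s\<bar> \<partial>?R)" for v
    unfolding Bochner_Integration.integral_add[OF intF intd, symmetric]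
    by (intro integral_mono intF intG intd Bochner_Integration.integrable_add pt)
  have "cvar_of \<alpha> M f \<le> cvar_of \<alpha> N g + (\<integral>s. \<bar>?F s - ?G s\<bar> \<partial>?R) / \<alpha>"
    using * by (intro cvar_of_measure_diff[OF M N \<alpha> f g])
      (auto simp: M.expectation_hinge[OF f] N.expectation_hinge[OF g])
  moreover have "cvar_of \<alpha> N g \<le> cvar_of \<alpha> M f + (\<integral>s. \<bar>?F s - ?G s\<bar> \<partial>?R) / \<alpha>"
    using ** by (intro cvar_of_measure_diff[OF N M \<alpha> g f])
      (auto simp: M.expectation_hinge[OF f] N.expectation_hinge[OF g])
  ultimately show ?thesis by linarith
qed

text \<open>Drawing an index uniformly from \<open>{1..n}\<close> realises the empirical law as the
  law of a bounded random variable, to which the general theory applies.\<close>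

lemma CVaR_emp_cdf:
  assumes "0 < n"
  shows "CVaR \<alpha> (emp_cdf f n z) = cvar_of \<alpha> (uniform_count_measure {1..n}) (\<lambda>i. f (z i))"
    and "cdf (distr (uniform_count_measure {1..n}) borel (\<lambda>i. f (z i))) = emp_cdf f n z"
proof -
  let ?N = "uniform_count_measure {1..n}"
  show *: "cdf (distr ?N borel (\<lambda>i. f (z i))) = emp_cdf f n z"
  proof
    fix y
    have "cdf (distr ?N borel (\<lambda>i. f (z i))) y = measure ?N {i\<in>{1..n}. f (z i) \<le> y}"
      unfolding cdf_def by (subst measure_distr)
        (auto intro!: arg_cong2[where f = measure] simp: measurable_def space_uniform_count_measure sets_uniform_count_measure)
    also have "\<dots> = card {i\<in>{1..n}. f (z i) \<le> y} / n"
      by (subst measure_uniform_count_measure) auto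
    finally show "cdf (distr ?N borel (\<lambda>i. f (z i))) y = emp_cdf f n z y"
      unfolding emp_cdf_def by (simp add: of_bool_def sum.If_cases Int_def)
  qed
  show "CVaR \<alpha> (emp_cdf f n z) = cvar_of \<alpha> ?N (\<lambda>i. f (z i))"
    unfolding cvar_of_def * ..
qed

section \<open>Second-moment bounds for empirical distributions\<close>

lemma integral_uniform_count_measure:
  fixes f :: "'a \<Rightarrow> real"
  assumes "finite A"
  shows "integral\<^sup>L (uniform_count_measure A) f = (\<Sum>i\<in>A. f i) / real (card A)"
  unfolding uniform_count_measure_def using assms
  by (subst lebesgue_integral_point_measure_finite) (auto simp: sum_divide_distrib)

text \<open>Independence kills the cross terms and each diagonal term is at most 1. The injection
  \<open>\<kappa>\<close> selects \<open>n\<close> coordinates of a larger product, as the samples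
  of one round are indexed by pairs.\<close>

lemma (in product_prob_space) sum_centred_square:
  assumes I: "finite I" and \<kappa>: "inj_on \<kappa> {1..n}" "\<kappa> ` {1..n} \<subseteq> I"
    and D: "\<And>i. i \<in> {1..n} \<Longrightarrow> M (\<kappa> i) = D"
    and g[measurable]: "g \<in> borel_measurable D" and g1: "\<And>x. x \<in> space D \<Longrightarrow> \<bar>g x\<bar> \<le> 1"
    and g0: "(\<integral>x. g x \<partial>D) = (0::real)"
  shows "(\<integral>z. (\<Sum>i=1..n. g (z (\<kappa> i)))\<^sup>2 \<partial>Pi\<^sub>M I M) \<le> real n"
proof -
  have meas[measurable]: "(\<lambda>z. g (z (\<kappa> i))) \<in> borel_measurable (Pi\<^sub>M I M)" if "i \<in> {1..n}" for i
  proof -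
    have "(\<lambda>z. z (\<kappa> i)) \<in> measurable (Pi\<^sub>M I M) (M (\<kappa> i))"
      using that \<kappa> by (intro measurable_component_singleton) auto
    then show ?thesis using that D[OF that] by simp
  qed
  have g1': "\<bar>g (z (\<kappa> i))\<bar> \<le> 1" if "z \<in> space (Pi\<^sub>M I M)" "i \<in> {1..n}" for z i
  proof -
    have "\<kappa> i \<in> I" using that \<kappa> by auto
    then have "z (\<kappa> i) \<in> space (M (\<kappa> i))" using that by (auto simp: space_PiM PiE_iff)
    then show ?thesis using that D g1 by auto
  qed
  have int: "integrable (Pi\<^sub>M I M) (\<lambda>z. g (z (\<kappa> i)) * g (z (\<kappa> j)))" if "i \<in> {1..n}" "j \<in> {1..n}" for i j
    using that g1' by (intro P.bounded_integrable[where B = 1]) (auto simp: abs_mult intro!: mult_le_one)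
  have off: "(\<integral>z. g (z (\<kappa> i)) * g (z (\<kappa> j)) \<partial>Pi\<^sub>M I M) = 0"
    if ij: "i \<in> {1..n}" "j \<in> {1..n}" "i \<noteq> j" for i j
  proof -
    \<comment> \<open>Padding with the factor 1 at all other coordinates writes the cross term as a
      full product over \<open>I\<close>; its integral factorises, and the factor at
      \<open>\<kappa> i\<close> is zero.\<close>
    let ?F = "\<lambda>k. if k = \<kappa> i \<or> k = \<kappa> j then g else (\<lambda>_. 1)"
    have ne: "\<kappa> i \<noteq> \<kappa> j" using ij \<kappa> by (auto dest: inj_onD)
    have "(\<Prod>k\<in>I. ?F k (z k)) = (\<Prod>k\<in>{\<kappa> i, \<kappa> j}. ?F k (z k))" for z
      using ij \<kappa> I by (intro prod.mono_neutral_right) auto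
    then have "(\<integral>z. g (z (\<kappa> i)) * g (z (\<kappa> j)) \<partial>Pi\<^sub>M I M) = (\<integral>z. (\<Prod>k\<in>I. ?F k (z k)) \<partial>Pi\<^sub>M I M)"
      using ne by simp
    also have "\<dots> = (\<Prod>k\<in>I. integral\<^sup>L (M k) (?F k))"
    proof (rule product_integral_prod[OF I])
      fix k assume "k \<in> I"
      interpret D: prob_space D using prob_space[of "\<kappa> i"] D[OF ij(1)] by simp
      have "integrable D g" using g1 by (intro D.bounded_integrable) auto
      then show "integrable (M k) (?F k)" using D ij by auto
    qed
    also have "\<dots> = 0"
      using I ij \<kappa> D g0 by (intro prod_zero) (auto intro!: bexI[of _ "\<kappa> i"])
    finally show ?thesis .
  qed
  have diag: "(\<integral>z. g (z (\<kappa> i)) * g (z (\<kappa> i)) \<partial>Pi\<^sub>M I M) \<le> 1" if "i \<in> {1..n}" for i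
    using int[OF that that] g1' that
    by (intro P.bounded_integral_le) (auto simp: abs_mult[symmetric] power2_eq_square[symmetric] abs_square_le_1)
  have "(\<integral>z. (\<Sum>i=1..n. g (z (\<kappa> i)))\<^sup>2 \<partial>Pi\<^sub>M I M)
    = (\<Sum>i=1..n. \<Sum>j=1..n. \<integral>z. g (z (\<kappa> i)) * g (z (\<kappa> j)) \<partial>Pi\<^sub>M I M)"
    unfolding power2_eq_square sum_product
    by (subst Bochner_Integration.integral_sum)
      (auto intro!: sum.cong Bochner_Integration.integral_sum Bochner_Integration.integrable_sum int
        simp del: atLeastAtMost_iff)
  also have "\<dots> \<le> (\<Sum>i=1..n. \<Sum>j=1..n. if i = j then 1 else 0)"
    using off diag by (intro sum_mono) auto
  also have "\<dots> = (\<Sum>i=1..n. 1)" by (intro sum.cong refl) simp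
  also have "\<dots> = real n" by simp
  finally show ?thesis .
qed

lemma (in product_prob_space) expectation_emp_cdf_deviation:
  assumes I: "finite I" and \<kappa>: "inj_on \<kappa> {1..n}" "\<kappa> ` {1..n} \<subseteq> I"
    and D: "\<And>i. i \<in> {1..n} \<Longrightarrow> M (\<kappa> i) = D" and n: "0 < n"
    and f[measurable]: "f \<in> borel_measurable D"
  shows "(\<integral>z. \<bar>emp_cdf f n (\<lambda>i. z (\<kappa> i)) s - cdf (distr D borel f) s\<bar> \<partial>Pi\<^sub>M I M) \<le> 1 / sqrt n"
proof -
  interpret D: prob_space D using prob_space[of "\<kappa> 1"] D[of 1] n by simp
  interpret F: real_distribution "distr D borel f" by (rule D.real_distribution_distr) simp
  let ?p = "cdf (distr D borel f) s"
  define g where "g x = indicator {..s} (f x) - ?p" for x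
  have [measurable]: "g \<in> borel_measurable D" unfolding g_def by simp
  have p: "0 \<le> ?p" "?p \<le> 1" using F.cdf_nonneg F.cdf_bounded_prob by auto
  then have g1: "\<bar>g x\<bar> \<le> 1" for x unfolding g_def by (auto simp: indicator_def)
  have intind: "integrable D (\<lambda>x. indicator {..s} (f x) :: real)"
    by (intro D.bounded_integrable[where B = 1]) (auto simp: indicator_def)
  have "(\<integral>x. indicat_real {..s} (f x) \<partial>D) = (\<integral>y. indicator {..s} y \<partial>distr D borel f)"
    using integral_distr[OF f, of "indicator {..s} :: real \<Rightarrow> real"] by simp
  then have g0: "(\<integral>x. g x \<partial>D) = 0"
    unfolding g_def using intind by (simp add: D.prob_space cdf_def)
  have meas[measurable]: "(\<lambda>z. g (z (\<kappa> i))) \<in> borel_measurable (Pi\<^sub>M I M)" if "i \<in> {1..n}" for i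
  proof -
    have "(\<lambda>z. z (\<kappa> i)) \<in> measurable (Pi\<^sub>M I M) (M (\<kappa> i))"
      using that \<kappa> by (intro measurable_component_singleton) auto
    then show ?thesis using that D[OF that] by simp
  qed
  let ?S = "\<lambda>z. \<Sum>i=1..n. g (z (\<kappa> i))"
  have Sn: "\<bar>?S z\<bar> \<le> n" for z
  proof -
    have "(\<Sum>i=1..n. \<bar>g (z (\<kappa> i))\<bar>) \<le> (\<Sum>i=1..n. 1)" by (intro sum_mono g1)
    also have "\<dots> = real n" by simp
    finally show ?thesis by (rule order_trans[OF sum_abs])
  qed
  have int: "integrable (Pi\<^sub>M I M) (\<lambda>z. (?S z)\<^sup>2)"
    using power_mono[OF Sn, where n = 2] by (intro P.bounded_integrable[where B = "(real n)\<^sup>2"]) auto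
  have emp: "emp_cdf f n (\<lambda>i. z (\<kappa> i)) s - ?p = ?S z / n" for z
    using n unfolding emp_cdf_def g_def
    by (simp add: sum_subtractf indicator_def of_bool_def field_simps)
  \<comment> \<open>The arithmetic-geometric inequality with weight \<open>sqrt n\<close> replaces
    Cauchy-Schwarz. The weight matches the second moment bound \<open>n\<close>, so the constant 1
    is kept.\<close>
  have "\<bar>?S z / n\<bar> \<le> ((?S z)\<^sup>2 / n + 1) / (2 * sqrt n)" for z
  proof -
    have "0 \<le> (\<bar>?S z\<bar> - sqrt n)\<^sup>2" by simp
    then have "2 * \<bar>?S z\<bar> * sqrt n \<le> (?S z)\<^sup>2 + n"
      by (simp add: power2_diff algebra_simps)
    then have "\<bar>?S z\<bar> * (2 * sqrt n) / n \<le> (?S z)\<^sup>2 / n + 1" using n by (simp add: field_simps)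
    then show ?thesis using n by (simp add: field_simps)
  qed
  then have "(\<integral>z. \<bar>?S z / n\<bar> \<partial>Pi\<^sub>M I M) \<le> (\<integral>z. ((?S z)\<^sup>2 / n + 1) / (2 * sqrt n) \<partial>Pi\<^sub>M I M)"
    using int by (intro integral_mono') auto
  also have "\<dots> = ((\<integral>z. (?S z)\<^sup>2 \<partial>Pi\<^sub>M I M) / n + 1) / (2 * sqrt n)"
    using int by (simp add: P.prob_space)
  also have "\<dots> \<le> (n / n + 1) / (2 * sqrt n)"
    using sum_centred_square[OF I \<kappa> D _ _ g0] g1 by (intro divide_right_mono add_right_mono) auto
  also have "\<dots> = 1 / sqrt n" using n by simp
  finally show ?thesis unfolding emp .
qed

text \<open>For each sample the error is at most 1/\<alpha> times the integrated cdf deviation.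
  After exchanging the integrals the pointwise rate \<open>1 / sqrt n\<close> is integrated over
  [-U, U], whose length is the factor \<open>2 * U\<close>.\<close>

lemma (in product_prob_space) expectation_emp_CVaR_deviation:
  assumes I: "finite I" and \<kappa>: "inj_on \<kappa> {1..n}" "\<kappa> ` {1..n} \<subseteq> I"
    and D: "\<And>i. i \<in> {1..n} \<Longrightarrow> M (\<kappa> i) = D" and n: "0 < n"
    and f[measurable]: "f \<in> borel_measurable D" and U: "\<And>x. x \<in> space D \<Longrightarrow> \<bar>f x\<bar> \<le> U"
    and \<alpha>: "0 < \<alpha>" "\<alpha> \<le> 1"
  shows "(\<integral>z. \<bar>CVaR \<alpha> (emp_cdf f n (\<lambda>i. z (\<kappa> i))) - cvar_of \<alpha> D f\<bar> \<partial>Pi\<^sub>M I M) \<le> 2 * U / (\<alpha> * sqrt n)"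
proof -
  interpret D: prob_space D using prob_space[of "\<kappa> 1"] D[of 1] n by simp
  interpret F: real_distribution "distr D borel f" by (rule D.real_distribution_distr) simp
  let ?F = "cdf (distr D borel f)"
  let ?R = "restrict_space lborel {-U..U}"
  interpret R: finite_measure ?R by (rule finite_measure_Icc)
  interpret N: prob_space "uniform_count_measure {1..n}"
    using n by (intro prob_space_uniform_count_measure) auto
  have U0: "0 \<le> U" using U D.not_empty by force
  have comp: "(\<lambda>z. z (\<kappa> i)) \<in> measurable (Pi\<^sub>M I M) D" if "i \<in> {1..n}" for i
  proof -
    have "\<kappa> i \<in> I" using that \<kappa> by auto
    from measurable_component_singleton[OF this, of M] show ?thesis using D[OF that] by simp
  qed
  have emp01: "0 \<le> emp_cdf f n (\<lambda>i. z (\<kappa> i)) s" "emp_cdf f n (\<lambda>i. z (\<kappa> i)) s \<le> 1" for z s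
    using n sum_mono[of "{1..n}" "\<lambda>i. of_bool (f (z (\<kappa> i)) \<le> s)" "\<lambda>_. 1::real"]
    unfolding emp_cdf_def by (auto simp: field_simps intro!: sum_nonneg)
  have F01: "0 \<le> ?F s" "?F s \<le> 1" for s
    using F.cdf_nonneg F.cdf_bounded_prob by auto
  have [measurable]: "(\<lambda>s. s) \<in> borel_measurable ?R"
    by (intro measurable_restrict_space1) simp
  have [measurable]: "?F \<in> borel_measurable borel"
    by (auto intro!: borel_measurable_mono monoI F.cdf_nondecreasing)
  have Fm: "(\<lambda>p. ?F (snd p)) \<in> borel_measurable (Pi\<^sub>M I M \<Otimes>\<^sub>M ?R)"
    by measurable
  have em: "(\<lambda>p. emp_cdf f n (\<lambda>i. fst p (\<kappa> i)) (snd p)) \<in> borel_measurable (Pi\<^sub>M I M \<Otimes>\<^sub>M ?R)"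
  proof -
    have "(\<lambda>p. indicator {(y, s). y \<le> s} (f (fst p (\<kappa> i)), snd p) :: real) \<in> borel_measurable (Pi\<^sub>M I M \<Otimes>\<^sub>M ?R)"
      if i: "i \<in> {1..n}" for i
    proof -
      have "(\<lambda>p. fst p (\<kappa> i)) \<in> measurable (Pi\<^sub>M I M \<Otimes>\<^sub>M ?R) D"
        by (rule measurable_compose[OF measurable_fst comp[OF i]])
      then have "(\<lambda>p. (f (fst p (\<kappa> i)), snd p)) \<in> measurable (Pi\<^sub>M I M \<Otimes>\<^sub>M ?R) (borel \<Otimes>\<^sub>M borel)"
        by measurable
      moreover have "{p \<in> space (borel \<Otimes>\<^sub>M borel). fst p \<le> (snd p :: real)} \<in> sets (borel \<Otimes>\<^sub>M borel)"
        by measurable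
      then have "{(s::real, y). s \<le> y} \<in> sets (borel \<Otimes>\<^sub>M borel)"
        by (simp add: space_pair_measure case_prod_unfold)
      ultimately show ?thesis
        by (rule measurable_compose[OF _ borel_measurable_indicator])
    qed
    then have "(\<lambda>p. 1 / n * (\<Sum>i=1..n. indicator {(y, s). y \<le> s} (f (fst p (\<kappa> i)), snd p)) :: real)
      \<in> borel_measurable (Pi\<^sub>M I M \<Otimes>\<^sub>M ?R)"
      by (intro borel_measurable_times borel_measurable_sum) auto
    then show ?thesis by (simp add: emp_cdf_def indicator_def of_bool_def)
  qed
  let ?d = "\<lambda>p. \<bar>emp_cdf f n (\<lambda>i. fst p (\<kappa> i)) (snd p) - ?F (snd p)\<bar>"
  have dm: "?d \<in> borel_measurable (Pi\<^sub>M I M \<Otimes>\<^sub>M ?R)"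
    using em Fm by simp
  have d1: "?d (z, s) \<le> 1" for z s
    using emp01[of z s] F01[of s] by (auto simp: abs_le_iff)
  note fub = finite_measure_Fubini[OF P.finite_measure_axioms R.finite_measure_axioms dm, where B = 1]
  have path: "\<bar>CVaR \<alpha> (emp_cdf f n (\<lambda>i. z (\<kappa> i))) - cvar_of \<alpha> D f\<bar> \<le> (\<integral>s. ?d (z, s) \<partial>?R) / \<alpha>"
    if z: "z \<in> space (Pi\<^sub>M I M)" for z
  proof -
    have zD: "z (\<kappa> i) \<in> space D" if "i \<in> {1..n}" for i
      using measurable_space[OF comp[OF that] z] .
    have "\<bar>cvar_of \<alpha> (uniform_count_measure {1..n}) (\<lambda>i. f (z (\<kappa> i))) - cvar_of \<alpha> D f\<bar>
      \<le> (\<integral>s. \<bar>cdf (distr (uniform_count_measure {1..n}) borel (\<lambda>i. f (z (\<kappa> i)))) s - ?F s\<bar> \<partial>?R) / \<alpha>"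
      by (intro cvar_of_cdf_diff N.prob_space_axioms D.prob_space_axioms \<alpha> f U)
        (use zD in \<open>auto simp: measurable_def space_uniform_count_measure sets_uniform_count_measure
          simp del: One_nat_def\<close>)
    then show ?thesis
      unfolding CVaR_emp_cdf(2)[OF n, of f "\<lambda>i. z (\<kappa> i)"]
      by (simp only: CVaR_emp_cdf(1)[OF n] fst_conv snd_conv)
  qed
  have "(\<integral>z. \<bar>CVaR \<alpha> (emp_cdf f n (\<lambda>i. z (\<kappa> i))) - cvar_of \<alpha> D f\<bar> \<partial>Pi\<^sub>M I M)
    \<le> (\<integral>z. (\<integral>s. ?d (z, s) \<partial>?R) / \<alpha> \<partial>Pi\<^sub>M I M)"
    using fub(4) d1 \<alpha> by (intro integral_mono' path) auto
  also have "\<dots> = (\<integral>s. \<integral>z. ?d (z, s) \<partial>Pi\<^sub>M I M \<partial>?R) / \<alpha>"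
    using fub(1) d1 by simp
  also have "\<dots> \<le> (\<integral>s. 1 / sqrt n \<partial>?R) / \<alpha>"
    using expectation_emp_cdf_deviation[OF I \<kappa> D n f] \<alpha> fub(5) d1
    by (intro divide_right_mono integral_mono) auto
  also have "(\<integral>s. 1 / sqrt n \<partial>?R) = 2 * U / sqrt n"
    using U0 by (simp add: measure_restrict_space space_restrict_space)
  finally show ?thesis by (simp add: field_simps)
qed

section \<open>One-point gradient estimates on the sphere\<close>

lemma sets_borel_balls [measurable]:
  fixes c :: "'a::euclidean_space"
  shows "ball c r \<in> sets borel" "sphere c r \<in> sets borel"
  by (simp_all add: borel_closed)

section \<open>Uniform law on the sphere and integrals of radially constant functions\<close>

lemma integral_lborel_scaleR:
  fixes f :: "'a::euclidean_space \<Rightarrow> real"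
  assumes [measurable]: "f \<in> borel_measurable borel" and c: "0 < c"
  shows "(\<integral>x. f x \<partial>lborel) = c ^ DIM('a) * (\<integral>x. f (c *\<^sub>R x) \<partial>lborel)"
proof -
  have "(\<integral>x. f x \<partial>lborel) = (\<integral>x. f x \<partial>density (distr lborel borel (\<lambda>x. 0 + c *\<^sub>R x)) (\<lambda>_. ennreal (c ^ DIM('a))))"
    using lborel_affine[of c "0::'a"] c by (simp add: ennreal_power)
  also have "\<dots> = (\<integral>x. c ^ DIM('a) * f x \<partial>distr lborel borel (\<lambda>x. 0 + c *\<^sub>R x))"
    using c by (subst integral_density) auto
  also have "\<dots> = (\<integral>x. c ^ DIM('a) * f (c *\<^sub>R x) \<partial>lborel)"
    by (subst integral_distr) auto
  finally show ?thesis by simp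
qed

lemma integral_lborel_translate:
  fixes f :: "'a::euclidean_space \<Rightarrow> real"
  assumes [measurable]: "f \<in> borel_measurable borel"
  shows "(\<integral>x. f x \<partial>lborel) = (\<integral>x. f (x + c) \<partial>lborel)"
proof -
  have "(\<integral>x. f x \<partial>lborel) = (\<integral>x. f x \<partial>distr lborel borel ((+) c))"
    by (simp add: lborel_distr_plus)
  also have "\<dots> = (\<integral>x. f (c + x) \<partial>lborel)" by (subst integral_distr) auto
  finally show ?thesis by (simp add: add.commute)
qed

lemma AE_lborel_norm_neq:
  assumes "0 < r"
  shows "AE w in lborel. norm (w::'a::euclidean_space) \<noteq> r"
proof -
  have "negligible (sphere (0::'a) r)"
    using negligible_convex_frontier[of "cball (0::'a) r"] by simp
  then have "sphere (0::'a) r \<in> null_sets lborel"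
    by (simp add: negligible_iff_null_sets null_sets_completion_iff)
  then show ?thesis
    by (rule AE_I') auto
qed

lemma emeasure_unit_ball:
  "emeasure lborel (ball (0::'a::euclidean_space) 1) = ennreal (measure lborel (ball (0::'a) 1))"
  "0 < measure lborel (ball (0::'a::euclidean_space) 1)"
  using content_ball_pos[of 1 "0::'a"] emeasure_bounded_finite[of "ball (0::'a) 1"]
  by (auto simp: emeasure_eq_ennreal_measure)

lemma uniform_measure_unit_ball:
  "uniform_measure lborel (ball (0::'a::euclidean_space) 1)
    = density lborel (\<lambda>w. ennreal (indicator (ball 0 1) w / measure lborel (ball (0::'a) 1)))"
  unfolding uniform_measure_def using emeasure_unit_ball[where 'a='a]
  by (intro density_cong AE_I2) (auto simp: divide_ennreal[symmetric] indicator_def)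

lemma prob_space_uniform_sphere:
  "prob_space (uniform_sphere :: 'a::euclidean_space measure)"
proof -
  let ?U = "uniform_measure lborel (ball (0::'a) 1)"
  interpret U: prob_space ?U
    by (rule prob_space_uniform_measure) (use emeasure_unit_ball[where 'a='a] in auto)
  interpret D: prob_space "distr ?U borel sgn"
    by (rule U.prob_space_distr) simp
  have "AE w in ?U. sgn w \<in> sphere 0 1"
    by (rule AE_uniform_measureI) (use AE_lborel_singleton[of "0::'a"] in \<open>auto simp: norm_sgn\<close>)
  then have "AE u in distr ?U borel sgn. u \<in> sphere 0 1"
    by (subst AE_distr_iff) auto
  then show ?thesis
    unfolding uniform_sphere_def
    by (intro prob_space_restrict_space D.emeasure_eq_1_AE) auto
qed

lemma space_uniform_sphere: "space (uniform_sphere :: 'a::euclidean_space measure) = sphere 0 1"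
  by (simp add: uniform_sphere_def space_restrict_space)

lemma sets_uniform_sphere:
  "sets (uniform_sphere :: 'a::euclidean_space measure) = sets (restrict_space borel (sphere 0 1))"
  by (simp add: uniform_sphere_def sets_restrict_space)

lemma integral_uniform_sphere:
  fixes g :: "'a::euclidean_space \<Rightarrow> real"
  assumes [measurable]: "g \<in> borel_measurable borel"
  shows "(\<integral>u. g u \<partial>uniform_sphere)
    = (\<integral>w. indicator (ball 0 1) w * g (sgn w) \<partial>lborel) / measure lborel (ball (0::'a) 1)"
proof -
  let ?V = "measure lborel (ball (0::'a) 1)"
  have "(\<integral>u. g u \<partial>uniform_sphere)
    = (\<integral>w. indicator (sphere 0 1) (sgn w) * g (sgn w) \<partial>uniform_measure lborel (ball (0::'a) 1))"
    unfolding uniform_sphere_def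
    by (subst integral_restrict_space; (subst integral_distr)?; simp)
  also have "\<dots> = (\<integral>w. (indicator (ball 0 1) w / ?V) * (indicator (sphere 0 1) (sgn w) * g (sgn w)) \<partial>lborel)"
    unfolding uniform_measure_unit_ball using emeasure_unit_ball(2)[where 'a='a]
    by (subst integral_density) auto
  also have "\<dots> = (\<integral>w. indicator (ball 0 1) w * g (sgn w) / ?V \<partial>lborel)"
  proof (rule integral_cong_AE)
    show "AE w in lborel. indicator (ball 0 1) w / ?V * (indicator (sphere 0 1) (sgn w) * g (sgn w))
      = indicator (ball 0 1) w * g (sgn w) / ?V"
      using AE_lborel_singleton[of "0::'a"] by eventually_elim (auto simp: indicator_def norm_sgn)
  qed measurable
  finally show ?thesis by simp
qed

text \<open>This homogeneity stands in for polar coordinates: the difference of two radii gives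
  integrals over thin shells in terms of the spherical mean.\<close>

lemma integral_ball_radial:
  fixes g :: "'a::euclidean_space \<Rightarrow> real"
  assumes [measurable]: "g \<in> borel_measurable borel" and r: "0 < r"
  shows "(\<integral>w. indicator (ball 0 r) w * g (sgn w) \<partial>lborel)
    = r ^ DIM('a) * (\<integral>w. indicator (ball 0 1) w * g (sgn w) \<partial>lborel)"
proof -
  have "sgn (r *\<^sub>R w) = sgn w" for w :: 'a using r by (simp add: sgn_scaleR)
  moreover have "r *\<^sub>R w \<in> ball 0 r \<longleftrightarrow> w \<in> ball 0 1" for w :: 'a using r by simp
  ultimately show ?thesis
    by (subst integral_lborel_scaleR[OF _ r]) (auto simp: indicator_def)
qed

lemma integrable_indicator_ball:
  fixes g :: "'a::euclidean_space \<Rightarrow> real"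
  assumes [measurable]: "g \<in> borel_measurable borel" and "\<And>x. norm x \<le> r \<Longrightarrow> \<bar>g x\<bar> \<le> B"
  shows "integrable lborel (\<lambda>w. indicator (ball 0 r) w * g w)"
proof (rule Bochner_Integration.integrable_bound)
  have "emeasure lborel (ball (0::'a) r) < \<infinity>"
    by (rule emeasure_bounded_finite) simp
  then show "integrable lborel (\<lambda>w. B * indicator (ball (0::'a) r) w)"
    by (intro integrable_mult_right integrable_real_indicator) auto
  show "AE w in lborel. norm (indicator (ball 0 r) w * g w) \<le> norm (B * indicator (ball 0 r) w)"
  proof (rule AE_I2)
    fix w show "norm (indicator (ball 0 r) w * g w) \<le> norm (B * indicator (ball 0 r) w)"
      using assms(2)[of w] by (cases "w \<in> ball 0 r") auto
  qed
qed simp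

text \<open>The relative volume of a shell of thickness \<open>x\<close>, divided by
  \<open>x\<close>: the source of the dimension factor in the gradient estimate.\<close>

lemma LIM_one_minus_power: "((\<lambda>x::real. (1 - (1 - x) ^ d) / x) \<longlongrightarrow> real d) (at_right 0)"
proof -
  have "((\<lambda>x::real. 1 - (1 - x) ^ d) has_field_derivative real d) (at 0)"
    by (auto intro!: derivative_eq_intros)
  then have "((\<lambda>x::real. (1 - (1 - x) ^ d) / x) \<longlongrightarrow> real d) (at 0)"
    by (simp add: DERIV_def)
  then show ?thesis by (rule tendsto_within_subset) auto
qed

text \<open>A Lipschitz approximation of the indicator of the unit ball. Its gradient is the inward
  normal divided by \<eta> on the shell of radii between 1 - \<eta> and 1, and zero elsewhere, so
  pairing with it approximates a surface integral.\<close>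

definition cutoff :: "real \<Rightarrow> 'a::real_normed_vector \<Rightarrow> real" where
  "cutoff \<eta> v = max 0 (min 1 ((1 - norm v) / \<eta>))"

lemma cutoff_bounds: "0 \<le> cutoff \<eta> v" "cutoff \<eta> v \<le> 1"
  by (auto simp: cutoff_def)

lemma cutoff_outside: "0 < \<eta> \<Longrightarrow> 1 \<le> norm v \<Longrightarrow> cutoff \<eta> v = 0"
  unfolding cutoff_def by (intro max_absorb1 min.coboundedI2 divide_nonpos_pos) auto

lemma cutoff_inside: "0 < \<eta> \<Longrightarrow> norm v \<le> 1 - \<eta> \<Longrightarrow> cutoff \<eta> v = 1"
  by (simp add: cutoff_def max_def min_def field_simps)

lemma cutoff_Lipschitz:
  assumes "0 < \<eta>"
  shows "\<bar>cutoff \<eta> v - cutoff \<eta> w\<bar> \<le> norm (v - w) / \<eta>"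
proof -
  have "\<bar>cutoff \<eta> v - cutoff \<eta> w\<bar> \<le> \<bar>(1 - norm v) / \<eta> - (1 - norm w) / \<eta>\<bar>"
    unfolding cutoff_def by (auto simp: max_def min_def)
  also have "\<dots> = \<bar>norm v - norm w\<bar> / \<eta>"
    using assms by (simp add: diff_divide_distrib[symmetric] abs_divide)
  also have "\<dots> \<le> norm (v - w) / \<eta>"
    using assms norm_triangle_ineq3[of v w] by (intro divide_right_mono) auto
  finally show ?thesis .
qed

text \<open>The two excluded radii are the kinks of the profile; those spheres are null sets. The
  translation by \<open>- e *\<^sub>R h\<close> gives the limit a positive sign along the outward
  normal.\<close>

lemma cutoff_deriv:
  fixes h w :: "'a::real_inner"
  assumes \<eta>: "0 < \<eta>" "\<eta> < 1" and w: "norm w \<noteq> 1" "norm w \<noteq> 1 - \<eta>"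
  shows "((\<lambda>e. (cutoff \<eta> (w - e *\<^sub>R h) - cutoff \<eta> w) / e) \<longlongrightarrow>
    (if 1 - \<eta> \<le> norm w \<and> norm w < 1 then (sgn w \<bullet> h) / \<eta> else 0)) (at 0)"
proof -
  have cont: "((\<lambda>e. norm (w - e *\<^sub>R h)) \<longlongrightarrow> norm w) (at 0)"
    by (auto intro!: tendsto_eq_intros)
  consider (inside) "norm w < 1 - \<eta>" | (shell) "1 - \<eta> < norm w" "norm w < 1" | (outside) "1 < norm w"
    using w by linarith
  then show ?thesis
  proof cases
    case inside
    then have "\<forall>\<^sub>F e in at 0. norm (w - e *\<^sub>R h) < 1 - \<eta>"
      using cont by (simp add: order_tendstoD)
    then have "\<forall>\<^sub>F e in at 0. (cutoff \<eta> (w - e *\<^sub>R h) - cutoff \<eta> w) / e = 0"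
      by eventually_elim (use inside \<eta> in \<open>simp add: cutoff_def min_def field_simps\<close>)
    then show ?thesis using inside by (simp add: tendsto_eventually)
  next
    case outside
    then have "\<forall>\<^sub>F e in at 0. 1 < norm (w - e *\<^sub>R h)"
      using cont by (simp add: order_tendstoD)
    then have "\<forall>\<^sub>F e in at 0. (cutoff \<eta> (w - e *\<^sub>R h) - cutoff \<eta> w) / e = 0"
      by eventually_elim (use outside \<eta> in \<open>simp add: cutoff_def max_def min_def field_simps\<close>)
    then show ?thesis using outside by (simp add: tendsto_eventually)
  next
    case shell
    then have w0: "w \<noteq> 0" using \<eta> by auto
    have "((\<lambda>e. norm (w - e *\<^sub>R h)) has_derivative (\<lambda>e. (- e *\<^sub>R h) \<bullet> sgn w)) (at 0)"
      by (rule has_derivative_eq_rhs, rule has_derivative_compose[where g = norm, OF _ has_derivative_norm])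
        (use w0 in \<open>auto intro!: derivative_eq_intros\<close>)
    then have "((\<lambda>e. (1 - norm (w - e *\<^sub>R h)) / \<eta>) has_field_derivative ((sgn w \<bullet> h) / \<eta>)) (at 0)"
      unfolding has_field_derivative_def using \<eta>
      by (auto intro!: derivative_eq_intros simp: fun_eq_iff inner_commute field_simps)
    then have "((\<lambda>e. ((1 - norm (w - e *\<^sub>R h)) / \<eta> - (1 - norm w) / \<eta>) / e) \<longlongrightarrow> (sgn w \<bullet> h) / \<eta>) (at 0)"
      by (simp add: DERIV_def)
    moreover have "\<forall>\<^sub>F e in at 0. norm (w - e *\<^sub>R h) < 1" "\<forall>\<^sub>F e in at 0. 1 - \<eta> < norm (w - e *\<^sub>R h)"
      using cont shell by (simp_all add: order_tendstoD)
    then have "\<forall>\<^sub>F e in at 0. ((1 - norm (w - e *\<^sub>R h)) / \<eta> - (1 - norm w) / \<eta>) / e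
      = (cutoff \<eta> (w - e *\<^sub>R h) - cutoff \<eta> w) / e"
      by eventually_elim (use shell \<eta> in \<open>simp add: cutoff_def max_def min_def field_simps\<close>)
    ultimately show ?thesis using shell by (simp add: tendsto_cong)
  qed
qed

lemma integral_cutoff_bounds:
  assumes \<eta>: "0 < \<eta>" "\<eta> < 1"
  shows "integrable lborel (cutoff \<eta> :: 'a::euclidean_space \<Rightarrow> real)"
    and "(\<integral>v. cutoff \<eta> (v::'a) \<partial>lborel) \<le> measure lborel (ball (0::'a) 1)"
    and "(1 - \<eta>) ^ DIM('a) * measure lborel (ball (0::'a) 1) \<le> (\<integral>v. cutoff \<eta> (v::'a) \<partial>lborel)"
proof -
  have [measurable]: "(cutoff \<eta> :: 'a \<Rightarrow> real) \<in> borel_measurable borel"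
    unfolding cutoff_def by simp
  have ind: "integrable lborel (indicator (ball (0::'a) r) :: 'a \<Rightarrow> real)" for r
    using integrable_indicator_ball[of "\<lambda>_. 1" r 1] by simp
  have "(\<lambda>v. indicator (ball 0 1) v * cutoff \<eta> v) = (cutoff \<eta> :: 'a \<Rightarrow> real)"
    using \<eta> by (auto simp: fun_eq_iff indicator_def cutoff_outside)
  then show int: "integrable lborel (cutoff \<eta> :: 'a \<Rightarrow> real)"
    using integrable_indicator_ball[of "cutoff \<eta> :: 'a \<Rightarrow> real" 1 1]
    by (simp add: cutoff_bounds)
  have "cutoff \<eta> v \<le> indicator (ball 0 1) v" for v :: 'a
    using \<eta> by (auto simp: indicator_def cutoff_bounds cutoff_outside)
  then have "(\<integral>v. cutoff \<eta> (v::'a) \<partial>lborel) \<le> (\<integral>v. indicator (ball (0::'a) 1) v \<partial>lborel)"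
    by (intro integral_mono int ind)
  then show "(\<integral>v. cutoff \<eta> (v::'a) \<partial>lborel) \<le> measure lborel (ball (0::'a) 1)" by simp
  have "indicator (ball 0 (1 - \<eta>)) v \<le> cutoff \<eta> v" for v :: 'a
    using \<eta> by (auto simp: indicator_def cutoff_bounds cutoff_inside)
  then have "(\<integral>v. indicator (ball (0::'a) (1 - \<eta>)) v \<partial>lborel) \<le> (\<integral>v. cutoff \<eta> (v::'a) \<partial>lborel)"
    by (intro integral_mono int ind)
  moreover have "(\<integral>v. indicator (ball (0::'a) (1 - \<eta>)) v \<partial>lborel)
    = (1 - \<eta>) ^ DIM('a) * measure lborel (ball (0::'a) 1)"
    using integral_ball_radial[of "\<lambda>_::'a. 1" "1 - \<eta>"] \<eta> by simp
  ultimately show "(1 - \<eta>) ^ DIM('a) * measure lborel (ball (0::'a) 1) \<le> (\<integral>v. cutoff \<eta> (v::'a) \<partial>lborel)"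
    by simp
qed

text \<open>Integration by parts through translation invariance: a difference quotient of
  \<open>f\<close>, for which only a one-sided bound is known, is moved to the cutoff, which is
  differentiable almost everywhere. The growth bound is used only where the cutoff is nonzero,
  inside the unit ball, and the \<open>e * Q\<close> part vanishes in the limit.\<close>

lemma shell_integral_le:
  fixes f :: "'a::euclidean_space \<Rightarrow> real" and h :: 'a
  assumes "0 \<le> L" and Lip: "\<And>x y. \<bar>f x - f y\<bar> \<le> L * norm (x - y)" and bdd: "\<And>x. \<bar>f x\<bar> \<le> M"
    and \<eta>: "0 < \<eta>" "\<eta> < 1"
    and growth: "\<And>v e. norm v \<le> 1 \<Longrightarrow> 0 < e \<Longrightarrow> e \<le> 1 \<Longrightarrow> f (v + e *\<^sub>R h) - f v \<le> e * (K + e * Q)"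
  shows "(\<integral>w. f w * (if 1 - \<eta> \<le> norm w \<and> norm w < 1 then (sgn w \<bullet> h) / \<eta> else 0) \<partial>lborel)
    \<le> K * (\<integral>v. cutoff \<eta> (v::'a) \<partial>lborel)"
proof -
  let ?\<psi> = "cutoff \<eta> :: 'a \<Rightarrow> real"
  let ?e = "\<lambda>k::nat. 1 / real (Suc k)"
  let ?s = "\<lambda>k w. f w * ((?\<psi> (w - ?e k *\<^sub>R h) - ?\<psi> w) / ?e k)"
  have "continuous_on UNIV f"
    using Lip \<open>0 \<le> L\<close>
    by (intro lipschitz_on_continuous_on[of L]) (auto simp: lipschitz_on_def dist_norm)
  then have [measurable]: "f \<in> borel_measurable borel" by (rule borel_measurable_continuous_onI)
  have [measurable]: "?\<psi> \<in> borel_measurable borel" unfolding cutoff_def by simp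
  note int\<psi> = integral_cutoff_bounds(1)[OF \<eta>, where 'a='a]
  have \<psi>0: "0 \<le> ?\<psi> v" for v by (rule cutoff_bounds)
  have \<psi>out: "?\<psi> v = 0" if "1 \<le> norm v" for v
    using that \<eta> by (simp add: cutoff_outside)
  have int\<psi>f: "integrable lborel (\<lambda>v. ?\<psi> v * g v)"
    if [measurable]: "g \<in> borel_measurable borel" and "\<And>v. \<bar>g v\<bar> \<le> B" for g B
    by (rule Bochner_Integration.integrable_bound[OF integrable_mult_left[OF int\<psi>, of B]])
      (use that \<psi>0 in \<open>auto simp: abs_mult intro!: AE_I2 mult_left_mono order_trans[OF _ abs_ge_self]\<close>)
  have step: "(\<integral>w. ?s k w \<partial>lborel) \<le> (K + ?e k * Q) * (\<integral>v. ?\<psi> v \<partial>lborel)" for k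
  proof -
    let ?c = "?e k *\<^sub>R h"
    have i1: "integrable lborel (\<lambda>v. ?\<psi> v * f (v + ?c))" using bdd by (intro int\<psi>f) auto
    have i2: "integrable lborel (\<lambda>v. ?\<psi> v * f v)" using bdd by (intro int\<psi>f) auto
    have i3: "integrable lborel (\<lambda>w. ?\<psi> (w - ?c) * f w)"
    proof -
      have "integrable (distr lborel borel ((+) ?c)) (\<lambda>w. ?\<psi> (w - ?c) * f w)"
        using i1 by (subst integrable_distr_eq) (auto simp: add.commute)
      then show ?thesis by (simp add: lborel_distr_plus)
    qed
    have "(\<integral>w. ?s k w \<partial>lborel) = ((\<integral>w. ?\<psi> (w - ?c) * f w \<partial>lborel) - (\<integral>w. ?\<psi> w * f w \<partial>lborel)) / ?e k"
      unfolding Bochner_Integration.integral_diff[OF i3 i2, symmetric]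
      by (subst integral_divide_zero[symmetric]) (simp add: algebra_simps)
    also have "(\<integral>w. ?\<psi> (w - ?c) * f w \<partial>lborel) = (\<integral>v. ?\<psi> v * f (v + ?c) \<partial>lborel)"
      using integral_lborel_translate[of "\<lambda>w. ?\<psi> (w - ?c) * f w" ?c] by simp
    also have "\<dots> - (\<integral>w. ?\<psi> w * f w \<partial>lborel) = (\<integral>v. ?\<psi> v * (f (v + ?c) - f v) \<partial>lborel)"
      unfolding Bochner_Integration.integral_diff[OF i1 i2, symmetric] by (simp add: algebra_simps)
    also have "\<dots> \<le> (\<integral>v. ?\<psi> v * (?e k * (K + ?e k * Q)) \<partial>lborel)"
    proof (rule integral_mono)
      show "integrable lborel (\<lambda>v. ?\<psi> v * (f (v + ?c) - f v))"
        using Bochner_Integration.integrable_diff[OF i1 i2] by (simp add: algebra_simps)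
      show "integrable lborel (\<lambda>v. ?\<psi> v * (?e k * (K + ?e k * Q)))"
        using int\<psi> by simp
      show "?\<psi> v * (f (v + ?c) - f v) \<le> ?\<psi> v * (?e k * (K + ?e k * Q))" for v
      proof (cases "norm v \<le> 1")
        case True
        then show ?thesis by (intro mult_left_mono growth \<psi>0) auto
      qed (simp add: \<psi>out)
    qed
    also have "\<dots> = ?e k * ((K + ?e k * Q) * (\<integral>v. ?\<psi> v \<partial>lborel))" by simp
    finally show ?thesis by (simp add: divide_right_mono)
  qed
  let ?lim = "\<lambda>w. f w * (if 1 - \<eta> \<le> norm w \<and> norm w < 1 then (sgn w \<bullet> h) / \<eta> else 0)"
  have e0: "?e \<longlonglongrightarrow> 0" using LIMSEQ_inverse_real_of_nat by (simp add: inverse_eq_divide)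
  then have ef: "filterlim ?e (at 0) sequentially"
    by (intro filterlim_atI) auto
  have "(\<lambda>k. \<integral>w. ?s k w \<partial>lborel) \<longlonglongrightarrow> (\<integral>w. ?lim w \<partial>lborel)"
  \<comment> \<open>All increments are at most 1, so both the cutoff and its translates vanish
    outside the ball of radius \<open>1 + norm h\<close>. The Lipschitz constant 1/\<eta> of the
    cutoff bounds the quotient inside.\<close>
  proof (rule integral_dominated_convergence[where w = "\<lambda>w. indicator (ball 0 (1 + norm h)) w * (M * (norm h / \<eta>))"])
    have "AE w in lborel. norm (w::'a) \<noteq> 1" "AE w in lborel. norm (w::'a) \<noteq> 1 - \<eta>"
      using \<eta> by (auto intro!: AE_lborel_norm_neq)
    then show "AE w in lborel. (\<lambda>k. ?s k w) \<longlonglongrightarrow> ?lim w"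
    proof eventually_elim
      case (elim w)
      show ?case
        by (intro tendsto_mult tendsto_const filterlim_compose[OF cutoff_deriv[OF \<eta> elim] ef])
    qed
    have quot: "0 < e \<Longrightarrow> \<bar>A\<bar> \<le> e * B \<Longrightarrow> \<bar>A / e\<bar> \<le> B" for e A B :: real
      by (simp add: abs_divide pos_divide_le_eq mult.commute)
    show "AE w in lborel. norm (?s k w) \<le> indicator (ball 0 (1 + norm h)) w * (M * (norm h / \<eta>))" for k
    proof (rule AE_I2)
      fix w :: 'a
      have "\<bar>?\<psi> (w - ?e k *\<^sub>R h) - ?\<psi> w\<bar> \<le> norm (w - ?e k *\<^sub>R h - w) / \<eta>"
        by (rule cutoff_Lipschitz[OF \<eta>(1)])
      also have "\<dots> = ?e k * (norm h / \<eta>)" by simp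
      finally have "\<bar>(?\<psi> (w - ?e k *\<^sub>R h) - ?\<psi> w) / ?e k\<bar> \<le> norm h / \<eta>"
        by (rule quot[rotated]) simp
      then have b: "norm (?s k w) \<le> M * (norm h / \<eta>)"
        unfolding real_norm_def abs_mult using bdd[of w] \<eta> by (intro mult_mono) auto
      show "norm (?s k w) \<le> indicator (ball 0 (1 + norm h)) w * (M * (norm h / \<eta>))"
      proof (cases "w \<in> ball 0 (1 + norm h)")
        case False
        have "?e k * norm h \<le> 1 * norm h" by (intro mult_right_mono) auto
        then have "1 \<le> norm (w - ?e k *\<^sub>R h)"
          using False norm_triangle_ineq2[of w "?e k *\<^sub>R h"] by simp
        moreover have "1 \<le> norm w" using False norm_ge_zero[of h] by (simp del: norm_ge_zero)
        ultimately show ?thesis using False by (simp add: \<psi>out)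
      qed (use b in simp)
    qed
    show "integrable lborel (\<lambda>w. indicator (ball (0::'a) (1 + norm h)) w * (M * (norm h / \<eta>)))"
      by (rule integrable_indicator_ball) auto
  qed measurable
  moreover have "(\<lambda>k. (K + ?e k * Q) * (\<integral>v. ?\<psi> v \<partial>lborel)) \<longlonglongrightarrow> (K + 0 * Q) * (\<integral>v. ?\<psi> v \<partial>lborel)"
    by (intro tendsto_intros e0)
  ultimately show ?thesis
    using step by (simp add: LIMSEQ_le)
qed

text \<open>For smooth \<open>f\<close> this is the divergence theorem: the left side is the mean
  over the unit ball of the derivative of \<open>f\<close> along \<open>h\<close>, and
  \<open>growth\<close> bounds that derivative by \<open>K\<close>.\<close>

lemma uniform_sphere_gradient_le:
  fixes f :: "'a::euclidean_space \<Rightarrow> real" and h :: 'a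
  assumes L: "0 \<le> L" and Lip: "\<And>x y. \<bar>f x - f y\<bar> \<le> L * norm (x - y)" and bdd: "\<And>x. \<bar>f x\<bar> \<le> M"
    and growth: "\<And>v e. norm v \<le> 1 \<Longrightarrow> 0 < e \<Longrightarrow> e \<le> 1 \<Longrightarrow> f (v + e *\<^sub>R h) - f v \<le> e * (K + e * Q)"
  shows "real DIM('a) * (\<integral>u. f u * (u \<bullet> h) \<partial>uniform_sphere) \<le> K"
proof -
  let ?V = "measure lborel (ball (0::'a) 1)"
  let ?E = "\<integral>u. f u * (u \<bullet> h) \<partial>(uniform_sphere :: 'a measure)"
  let ?d = "DIM('a)"
  have V: "0 < ?V" by (rule emeasure_unit_ball)
  have "continuous_on UNIV f"
    using Lip L by (intro lipschitz_on_continuous_on[of L]) (auto simp: lipschitz_on_def dist_norm)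
  then have fm[measurable]: "f \<in> borel_measurable borel" by (rule borel_measurable_continuous_onI)
  let ?g = "\<lambda>u. f u * (u \<bullet> h)"
  have gm: "?g \<in> borel_measurable borel" by simp
  have sgn1: "norm (sgn w) \<le> 1" for w :: 'a by (simp add: norm_sgn)
  have M0: "0 \<le> M" using bdd[of 0] by linarith
  have gb: "\<bar>?g (sgn w)\<bar> \<le> M * norm h" for w
    unfolding abs_mult using bdd Cauchy_Schwarz_ineq2[of "sgn w" h] mult_right_mono[OF sgn1 norm_ge_zero[of h], of w]
    by (intro mult_mono M0) auto
  \<comment> \<open>Two errors, both of the order of the shell volume. Replacing \<open>f w\<close>
    by \<open>f (sgn w)\<close> on the shell costs \<open>L * norm h\<close>; replacing the mass of
    the cutoff by the ball volume costs the absolute value of \<open>K\<close>, whose sign is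
    unknown. As \<eta> tends to 0 both vanish and the left quotient yields the dimension.\<close>
  have main: "?E * ((1 - (1 - \<eta>) ^ ?d) / \<eta>) \<le> K + \<bar>K\<bar> * (1 - (1 - \<eta>) ^ ?d) + L * norm h * (1 - (1 - \<eta>) ^ ?d)"
    if \<eta>: "0 < \<eta>" "\<eta> < 1" for \<eta>
  proof -
    let ?p = "1 - (1 - \<eta>) ^ ?d"
    let ?S = "\<lambda>w::'a. indicator (ball 0 1) w - indicator (ball 0 (1 - \<eta>)) w :: real"
    have S: "?S w = (if 1 - \<eta> \<le> norm w \<and> norm w < 1 then 1 else 0)" for w
      using \<eta> by (auto simp: indicator_def)
    have rad: "integrable lborel (\<lambda>w. ?S w * q (sgn w))"
      "(\<integral>w. ?S w * q (sgn w) \<partial>lborel) = ?p * (\<integral>w. indicator (ball 0 1) w * q (sgn w) \<partial>lborel)"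
      if [measurable]: "q \<in> borel_measurable borel" and q: "\<And>w. \<bar>q (sgn w)\<bar> \<le> B" for q :: "'a \<Rightarrow> real" and B
    proof -
      have i: "integrable lborel (\<lambda>w. indicator (ball 0 r) w * q (sgn w))" for r
        by (rule integrable_indicator_ball) (use q in auto)
      show "integrable lborel (\<lambda>w. ?S w * q (sgn w))"
        unfolding left_diff_distrib by (intro Bochner_Integration.integrable_diff i)
      show "(\<integral>w. ?S w * q (sgn w) \<partial>lborel) = ?p * (\<integral>w. indicator (ball 0 1) w * q (sgn w) \<partial>lborel)"
        unfolding left_diff_distrib Bochner_Integration.integral_diff[OF i i]
        using integral_ball_radial[of q "1 - \<eta>"] \<eta> by (simp add: algebra_simps)
    qed
    have E: "(\<integral>w. ?S w * ?g (sgn w) \<partial>lborel) = ?p * (?V * ?E)"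
      using rad(2)[OF gm gb] integral_uniform_sphere[OF gm] V by simp
    have Svol: "(\<integral>w. ?S w \<partial>lborel) = ?p * ?V" and Sint: "integrable lborel ?S"
      using rad[of "\<lambda>_. 1" 1] by simp_all
    have le: "?S w * ?g (sgn w) - L * \<eta> * norm h * ?S w \<le> \<eta> * (f w * (if 1 - \<eta> \<le> norm w \<and> norm w < 1 then (sgn w \<bullet> h) / \<eta> else 0))" for w
    proof (cases "1 - \<eta> \<le> norm w \<and> norm w < 1")
      case True
      have "norm (sgn w - w) \<le> \<eta>"
      proof -
        have "w \<noteq> 0" using True \<eta> by auto
        then have "sgn w - w = (1 - norm w) *\<^sub>R sgn w"
          by (simp add: sgn_div_norm algebra_simps)
        then have "norm (sgn w - w) \<le> \<bar>1 - norm w\<bar> * norm (sgn w)" by simp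
        also have "\<dots> \<le> \<eta> * 1" using True \<eta> sgn1 by (intro mult_mono) auto
        finally show ?thesis by simp
      qed
      then have "\<bar>f (sgn w) - f w\<bar> \<le> L * \<eta>"
        using Lip[of "sgn w" w] L by (meson mult_left_mono order_trans)
      moreover have "\<bar>sgn w \<bullet> h\<bar> \<le> norm h"
        using Cauchy_Schwarz_ineq2[of "sgn w" h] mult_right_mono[OF sgn1 norm_ge_zero[of h], of w] by simp
      ultimately have "\<bar>(f (sgn w) - f w) * (sgn w \<bullet> h)\<bar> \<le> L * \<eta> * norm h"
        unfolding abs_mult using L \<eta> by (intro mult_mono) auto
      then have "f (sgn w) * (sgn w \<bullet> h) - L * \<eta> * norm h \<le> f w * (sgn w \<bullet> h)"
        unfolding left_diff_distrib by linarith
      then show ?thesis unfolding S using True \<eta> by simp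
    next
      case False
      show ?thesis by (simp only: S if_not_P[OF False])
    qed
    have li: "integrable lborel (\<lambda>w. f w * (if 1 - \<eta> \<le> norm w \<and> norm w < 1 then (sgn w \<bullet> h) / \<eta> else 0))"
    proof -
      have "integrable lborel (\<lambda>w. indicator (ball 0 1) w * (f w * (if 1 - \<eta> \<le> norm w \<and> norm w < 1 then (sgn w \<bullet> h) / \<eta> else 0)))"
      proof (rule integrable_indicator_ball)
        fix w :: 'a
        have "\<bar>sgn w \<bullet> h\<bar> \<le> norm h"
          using Cauchy_Schwarz_ineq2[of "sgn w" h] mult_right_mono[OF sgn1 norm_ge_zero[of h], of w] by simp
        then show "\<bar>f w * (if 1 - \<eta> \<le> norm w \<and> norm w < 1 then (sgn w \<bullet> h) / \<eta> else 0)\<bar> \<le> M * (norm h / \<eta>)"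
          unfolding abs_mult using bdd[of w] \<eta> by (intro mult_mono M0) (auto simp: divide_right_mono)
      qed measurable
      moreover have "(\<lambda>w. indicator (ball 0 1) w * (f w * (if 1 - \<eta> \<le> norm w \<and> norm w < 1 then (sgn w \<bullet> h) / \<eta> else 0)))
        = (\<lambda>w. f w * (if 1 - \<eta> \<le> norm w \<and> norm w < 1 then (sgn w \<bullet> h) / \<eta> else 0))"
        by (auto simp: fun_eq_iff indicator_def)
      ultimately show ?thesis by simp
    qed
    have "?p * (?V * ?E) - L * \<eta> * norm h * (?p * ?V)
      = (\<integral>w. ?S w * ?g (sgn w) - L * \<eta> * norm h * ?S w \<partial>lborel)"
      unfolding E[symmetric] Svol[symmetric] using rad(1)[OF gm gb] Sint
      by (subst Bochner_Integration.integral_diff) auto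
    also have "\<dots> \<le> (\<integral>w. \<eta> * (f w * (if 1 - \<eta> \<le> norm w \<and> norm w < 1 then (sgn w \<bullet> h) / \<eta> else 0)) \<partial>lborel)"
      by (rule integral_mono[OF Bochner_Integration.integrable_diff[OF rad(1)[OF gm gb]
            integrable_mult_right[OF Sint]] integrable_mult_right[OF li] le])
    also have "\<dots> \<le> \<eta> * (K * (\<integral>v. cutoff \<eta> (v::'a) \<partial>lborel))"
      using shell_integral_le[OF L Lip bdd \<eta> growth] \<eta> by simp
    also have "\<dots> \<le> \<eta> * (?V * K + \<bar>K\<bar> * (?p * ?V))"
    proof -
      have "K * ((\<integral>v. cutoff \<eta> (v::'a) \<partial>lborel) - ?V) \<le> \<bar>K\<bar> * \<bar>(\<integral>v. cutoff \<eta> (v::'a) \<partial>lborel) - ?V\<bar>"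
        by (metis abs_ge_self abs_mult)
      also have "\<dots> \<le> \<bar>K\<bar> * (?p * ?V)"
        using integral_cutoff_bounds(2,3)[OF \<eta>, where 'a='a]
        by (intro mult_left_mono) (auto simp: algebra_simps)
      finally have "K * (\<integral>v. cutoff \<eta> (v::'a) \<partial>lborel) \<le> ?V * K + \<bar>K\<bar> * (?p * ?V)"
        by (simp add: right_diff_distrib mult.commute)
      then show ?thesis using \<eta> by (intro mult_left_mono) auto
    qed
    finally have "?V * (?p * ?E) \<le> ?V * (\<eta> * (K + \<bar>K\<bar> * ?p + L * norm h * ?p))"
      by (simp add: algebra_simps)
    then have "?p * ?E \<le> \<eta> * (K + \<bar>K\<bar> * ?p + L * norm h * ?p)"
      using V by simp
    then show ?thesis using \<eta> by (simp add: field_simps)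
  qed
  have p0: "((\<lambda>\<eta>::real. 1 - (1 - \<eta>) ^ ?d) \<longlongrightarrow> 1 - (1 - 0) ^ ?d) (at_right 0)"
    by (intro tendsto_intros)
  have "?E * real ?d \<le> K + \<bar>K\<bar> * 0 + L * norm h * 0"
  proof (rule tendsto_le)
    show "((\<lambda>\<eta>. ?E * ((1 - (1 - \<eta>) ^ ?d) / \<eta>)) \<longlongrightarrow> ?E * real ?d) (at_right 0)"
      by (intro tendsto_intros LIM_one_minus_power)
    show "((\<lambda>\<eta>. K + \<bar>K\<bar> * (1 - (1 - \<eta>) ^ ?d) + L * norm h * (1 - (1 - \<eta>) ^ ?d)) \<longlongrightarrow> K + \<bar>K\<bar> * 0 + L * norm h * 0) (at_right 0)"
      using p0 by (intro tendsto_add tendsto_mult tendsto_const) simp_all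
    show "\<forall>\<^sub>F \<eta> in at_right 0. ?E * ((1 - (1 - \<eta>) ^ ?d) / \<eta>) \<le> K + \<bar>K\<bar> * (1 - (1 - \<eta>) ^ ?d) + L * norm h * (1 - (1 - \<eta>) ^ ?d)"
      unfolding eventually_at_right_field by (intro exI[of _ 1]) (use main in auto)
  qed simp
  then show ?thesis by (simp add: mult.commute)
qed

section \<open>Risk-averse costs\<close>

lemma wasserstein1_nonneg:
  assumes "0 < K"
  shows "0 \<le> wasserstein1 K S \<mu> \<nu>"
proof -
  have "ereal 0 \<le> (SUP f\<in>{f. K-lipschitz_on S f \<and> integrable \<mu> f \<and> integrable \<nu> f}.
      ereal ((LINT z|\<mu>. f z) - (LINT z|\<nu>. f z)))"
    using assms by (intro SUP_upper2[of "\<lambda>_. 0"]) (auto simp: lipschitz_on_def)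
  then show ?thesis
    using assms by (simp add: wasserstein1_def zero_ereal_def[symmetric])
qed

text \<open>Scaling \<open>g\<close> by plus or minus \<open>K / L\<close> makes it admissible in
  the supremum. The normalisation by \<open>K\<close> then cancels, so the bound does not depend on
  the choice of \<open>K\<close>.\<close>

lemma wasserstein1_Lipschitz_bound:
  assumes K: "0 < K" and L: "0 < L" and g: "L-lipschitz_on S g" "integrable \<mu> g" "integrable \<nu> g"
    and W: "wasserstein1 K S \<mu> \<nu> \<le> ereal W"
  shows "\<bar>(\<integral>z. g z \<partial>\<mu>) - (\<integral>z. g z \<partial>\<nu>)\<bar> \<le> L * W"
proof -
  let ?F = "{f. K-lipschitz_on S f \<and> integrable \<mu> f \<and> integrable \<nu> f}"
  have sup: "(SUP f\<in>?F. ereal ((LINT z|\<mu>. f z) - (LINT z|\<nu>. f z))) \<le> ereal K * ereal W"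
    using W K unfolding wasserstein1_def by (subst (asm) ereal_divide_le_pos) auto
  have *: "s * ((\<integral>z. g z \<partial>\<mu>) - (\<integral>z. g z \<partial>\<nu>)) \<le> L * W" if s: "\<bar>s\<bar> = 1" for s
  proof -
    let ?f = "\<lambda>z. (s * K / L) * g z"
    have "(K / L * L)-lipschitz_on S ?f"
      using g(1) s K L by (auto simp: lipschitz_on_def dist_real_def right_diff_distrib[symmetric] abs_mult
          simp del: times_divide_eq_left intro!: mult_left_mono)
    then have "?f \<in> ?F" using g L by simp
    then have "ereal ((\<integral>z. ?f z \<partial>\<mu>) - (\<integral>z. ?f z \<partial>\<nu>)) \<le> ereal K * ereal W"
      by (rule order_trans[OF SUP_upper sup])
    then have "(s * K / L) * ((\<integral>z. g z \<partial>\<mu>) - (\<integral>z. g z \<partial>\<nu>)) \<le> K * W"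
      by (simp add: right_diff_distrib)
    then have "K * (s * ((\<integral>z. g z \<partial>\<mu>) - (\<integral>z. g z \<partial>\<nu>))) \<le> K * (L * W)"
      using L by (simp add: field_simps)
    then show ?thesis using K by simp
  qed
  show ?thesis using *[of 1] *[of "-1"] by (auto simp: abs_le_iff)
qed

lemma cvar_cost_eq_cvar_of: "cvar_cost J \<alpha> \<mu> x = cvar_of \<alpha> \<mu> (J x)"
  by (simp add: cvar_cost_def cvar_of_def)

text \<open>The gradient inequality is applied at the intermediate point towards both ends; in the
  convex combination the linear terms cancel and the squares add up to e(1 - e). This gradient-free
  form is the one that passes through CVaR.\<close>

lemma strongly_convex_grad_convex:
  assumes sc: "strongly_convex_grad m X f" and X: "convex X" and xy: "x \<in> X" "y \<in> X" and e: "0 \<le> e" "e \<le> 1"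
  shows "f (x + e *\<^sub>R (y - x)) \<le> (1 - e) * f x + e * f y - m / 2 * (e * (1 - e)) * (norm (y - x))\<^sup>2"
proof -
  let ?z = "x + e *\<^sub>R (y - x)"
  have "?z = (1 - e) *\<^sub>R x + e *\<^sub>R y" by (simp add: algebra_simps)
  then have z: "?z \<in> X" using X xy e by (simp add: convexD_alt)
  obtain grad where grad: "\<And>x y. x \<in> X \<Longrightarrow> y \<in> X \<Longrightarrow> f y \<ge> f x + grad x \<bullet> (y - x) + m / 2 * (norm (x - y))\<^sup>2"
    using sc unfolding strongly_convex_grad_def by blast
  let ?N = "(norm (y - x))\<^sup>2" and ?g = "grad ?z \<bullet> (y - x)"
  have 1: "x - ?z = (- e) *\<^sub>R (y - x)" "y - ?z = (1 - e) *\<^sub>R (y - x)"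
    "?z - x = e *\<^sub>R (y - x)" "?z - y = (e - 1) *\<^sub>R (y - x)"
    by (simp_all add: algebra_simps)
  have "f x \<ge> f ?z + (- e) * ?g + m / 2 * (e\<^sup>2 * ?N)"
    using grad[OF z xy(1)] unfolding 1 by (simp add: power_mult_distrib)
  moreover have "f y \<ge> f ?z + (1 - e) * ?g + m / 2 * ((e - 1)\<^sup>2 * ?N)"
    using grad[OF z xy(2)] unfolding 1 by (simp add: power_mult_distrib)
  ultimately have "(1 - e) * f x + e * f y
    \<ge> (1 - e) * (f ?z + (- e) * ?g + m / 2 * (e\<^sup>2 * ?N)) + e * (f ?z + (1 - e) * ?g + m / 2 * ((e - 1)\<^sup>2 * ?N))"
    using e by (intro add_mono mult_left_mono) auto
  also have "(1 - e) * (f ?z + (- e) * ?g + m / 2 * (e\<^sup>2 * ?N)) + e * (f ?z + (1 - e) * ?g + m / 2 * ((e - 1)\<^sup>2 * ?N))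
    = f ?z + m / 2 * (e * (1 - e)) * ?N"
    by (simp add: field_simps power2_eq_square)
  finally show ?thesis by linarith
qed

locale risk_averse_cost =
  fixes J :: "real^'d \<Rightarrow> 'b::metric_space \<Rightarrow> real" and X :: "(real^'d) set" and \<Xi> :: "'b set"
    and D :: "nat \<Rightarrow> 'b measure" and r Dx U m L\<^sub>0 L\<^sub>\<xi> \<alpha> :: real
  assumes r_pos: "0 < r" and U_pos: "0 < U" and m_pos: "0 < m" and L0_pos: "0 < L\<^sub>0" and L\<xi>_pos: "0 < L\<^sub>\<xi>"
    and \<alpha>: "0 < \<alpha>" "\<alpha> \<le> 1"
    and closed_X: "closed X" and convex_X: "convex X" and bounded_X: "bounded X"
    and ball_X: "cball 0 r \<subseteq> X" and diam_X: "diameter X = Dx"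
    and J_bounded: "\<And>x \<xi>. x \<in> X \<Longrightarrow> \<xi> \<in> \<Xi> \<Longrightarrow> \<bar>J x \<xi>\<bar> \<le> U"
    and J_convex: "\<And>\<xi>. \<xi> \<in> \<Xi> \<Longrightarrow> strongly_convex_grad m X (\<lambda>x. J x \<xi>)"
    and J_Lipschitz: "\<And>\<xi> x y. \<xi> \<in> \<Xi> \<Longrightarrow> x \<in> X \<Longrightarrow> y \<in> X \<Longrightarrow> \<bar>J x \<xi> - J y \<xi>\<bar> \<le> L\<^sub>0 * norm (x - y)"
    and J_Lipschitz_noise: "\<And>x. x \<in> X \<Longrightarrow> L\<^sub>\<xi>-lipschitz_on \<Xi> (J x)"
    and prob_D: "\<And>t. prob_space (D t)"
    and sets_D: "\<And>t. sets (D t) = sets (restrict_space borel \<Xi>)"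
begin

abbreviation C :: "nat \<Rightarrow> real^'d \<Rightarrow> real" where
  "C t \<equiv> cvar_cost J \<alpha> (D t)"

lemma space_D: "space (D t) = \<Xi>"
  using sets_eq_imp_space_eq[OF sets_D] by (simp add: space_restrict_space)

lemma J_measurable: "x \<in> X \<Longrightarrow> J x \<in> borel_measurable (D t)"
  using borel_measurable_continuous_on_restrict[OF lipschitz_on_continuous_on[OF J_Lipschitz_noise]]
    measurable_cong_sets[OF sets_D[of t] refl] by blast

lemma zero_in_X: "0 \<in> X"
  using ball_X r_pos by auto

lemma norm_diff_X: "x \<in> X \<Longrightarrow> y \<in> X \<Longrightarrow> norm (x - y) \<le> Dx"
  using diameter_bounded_bound[OF bounded_X] diam_X by (simp add: dist_norm)

lemma Dx_nonneg: "0 \<le> Dx"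
  using norm_diff_X[OF zero_in_X zero_in_X] by simp

lemma C_bounded: "x \<in> X \<Longrightarrow> \<bar>C t x\<bar> \<le> U"
  unfolding cvar_cost_eq_cvar_of
  by (rule prob_space.cvar_of_bounded[OF prob_D J_measurable _ \<alpha>]) (auto simp: space_D J_bounded)

lemma C_Lipschitz:
  assumes "x \<in> X" "y \<in> X"
  shows "\<bar>C t x - C t y\<bar> \<le> L\<^sub>0 * norm (x - y)"
proof -
  have "C t x \<le> C t y + L\<^sub>0 * norm (x - y)" if "x \<in> X" "y \<in> X" for x y
    unfolding cvar_cost_eq_cvar_of
    by (rule prob_space.cvar_of_shift[OF prob_D J_measurable _ J_measurable _ \<alpha>])
      (use that J_bounded J_Lipschitz in \<open>force simp: space_D abs_le_iff\<close>)+
  from this[OF assms] this[OF assms(2,1)] show ?thesis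
    by (auto simp: abs_le_iff norm_minus_commute)
qed

text \<open>The quadratic gain is the same for every noise value, hence a constant shift, and CVaR
  lets constant shifts through unchanged.\<close>

lemma C_strongly_convex:
  assumes xy: "x \<in> X" "y \<in> X" and e: "0 \<le> e" "e \<le> 1"
  shows "C t (x + e *\<^sub>R (y - x)) \<le> (1 - e) * C t x + e * C t y - m / 2 * (e * (1 - e)) * (norm (y - x))\<^sup>2"
proof -
  have "x + e *\<^sub>R (y - x) = (1 - e) *\<^sub>R x + e *\<^sub>R y" by (simp add: algebra_simps)
  then have z: "x + e *\<^sub>R (y - x) \<in> X" using convex_X xy e by (simp add: convexD_alt)
  have "C t (x + e *\<^sub>R (y - x)) \<le> (1 - e) * C t x + e * C t y + (- (m / 2 * (e * (1 - e)) * (norm (y - x))\<^sup>2))"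
    unfolding cvar_cost_eq_cvar_of
  proof (rule prob_space.cvar_of_convex[where U = U, OF prob_D J_measurable _ J_measurable _ J_measurable _ \<alpha>])
    fix \<xi> assume "\<xi> \<in> space (D t)"
    then show "J (x + e *\<^sub>R (y - x)) \<xi> \<le> (1 - e) * J x \<xi> + e * J y \<xi> + - (m / 2 * (e * (1 - e)) * (norm (y - x))\<^sup>2)"
      using strongly_convex_grad_convex[OF J_convex convex_X xy e, of \<xi>] by (simp add: space_D)
  qed (use xy z e in \<open>auto simp: space_D J_bounded\<close>)
  then show ?thesis by simp
qed

lemma C_drift:
  assumes x: "x \<in> X" and K: "0 < K" and W: "wasserstein1 K \<Xi> (D s) (D t) \<le> ereal W"
  shows "\<bar>C s x - C t x\<bar> \<le> L\<^sub>\<xi> / \<alpha> * W"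
proof -
  have hinge: "L\<^sub>\<xi>-lipschitz_on \<Xi> (\<lambda>\<xi>. max 0 (J x \<xi> - v))" for v
  proof (rule lipschitz_onI)
    fix a b assume "a \<in> \<Xi>" "b \<in> \<Xi>"
    have "dist (max 0 (J x a - v)) (max 0 (J x b - v)) \<le> dist (J x a) (J x b)"
      by (auto simp: dist_real_def max_def)
    also have "\<dots> \<le> L\<^sub>\<xi> * dist a b"
      using J_Lipschitz_noise[OF x] \<open>a \<in> \<Xi>\<close> \<open>b \<in> \<Xi>\<close> by (rule lipschitz_onD)
    finally show "dist (max 0 (J x a - v)) (max 0 (J x b - v)) \<le> L\<^sub>\<xi> * dist a b" .
  qed (use L\<xi>_pos in simp)
  have bd: "\<bar>J x \<xi>\<bar> \<le> U" if "\<xi> \<in> space (D t)" for \<xi> t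
    using that x J_bounded by (simp add: space_D)
  have int: "integrable (D t) (\<lambda>\<xi>. max 0 (J x \<xi> - v))" for v t
    by (rule prob_space.integrable_hinge[OF prob_D J_measurable[OF x] bd])
  have "\<bar>(\<integral>\<xi>. max 0 (J x \<xi> - v) \<partial>D s) - (\<integral>\<xi>. max 0 (J x \<xi> - v) \<partial>D t)\<bar> \<le> L\<^sub>\<xi> * W" for v
    by (rule wasserstein1_Lipschitz_bound[OF K L\<xi>_pos hinge int int W])
  then have "(\<integral>\<xi>. max 0 (J x \<xi> - v) \<partial>D s) \<le> (\<integral>\<xi>. max 0 (J x \<xi> - v) \<partial>D t) + L\<^sub>\<xi> * W"
    "(\<integral>\<xi>. max 0 (J x \<xi> - v) \<partial>D t) \<le> (\<integral>\<xi>. max 0 (J x \<xi> - v) \<partial>D s) + L\<^sub>\<xi> * W" for v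
    by (auto simp: abs_le_iff algebra_simps)
  then have "C s x \<le> C t x + L\<^sub>\<xi> * W / \<alpha>" "C t x \<le> C s x + L\<^sub>\<xi> * W / \<alpha>"
    unfolding cvar_cost_eq_cvar_of
    by (auto intro!: cvar_of_measure_diff[OF prob_D prob_D \<alpha> J_measurable bd J_measurable bd] x)
  then show ?thesis by (simp add: abs_le_iff)
qed

text \<open>\<open>arg_min_on\<close> is a choice; compactness of \<open>X\<close> and continuity of
  the cost ensure that there is a minimiser to choose.\<close>

lemma C_argmin:
  shows "arg_min_on (C t) X \<in> X" "y \<in> X \<Longrightarrow> C t (arg_min_on (C t) X) \<le> C t y"
proof -
  have "compact X" using closed_X bounded_X by (simp add: compact_eq_bounded_closed)
  moreover have "continuous_on X (C t)"
    using C_Lipschitz L0_pos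
    by (intro lipschitz_on_continuous_on[of L\<^sub>0]) (auto simp: lipschitz_on_def dist_norm)
  ultimately obtain x where "x \<in> X" "\<And>y. y \<in> X \<Longrightarrow> C t x \<le> C t y"
    using continuous_attains_inf[of X "C t"] zero_in_X by blast
  then have "is_arg_min (C t) (\<lambda>x. x \<in> X) x"
    by (auto simp: is_arg_min_def not_less)
  then have "is_arg_min (C t) (\<lambda>x. x \<in> X) (arg_min_on (C t) X)"
    unfolding arg_min_on_def arg_min_def by (rule someI)
  then show "arg_min_on (C t) X \<in> X" "y \<in> X \<Longrightarrow> C t (arg_min_on (C t) X) \<le> C t y"
    by (auto simp: is_arg_min_def not_less)
qed

end

section \<open>The shrunk decision set and the one-point gradient inequality\<close>

locale shrunk_domain = risk_averse_cost J X \<Xi> D r Dx U m L\<^sub>0 L\<^sub>\<xi> \<alpha>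
  for J :: "real^'d \<Rightarrow> 'b::metric_space \<Rightarrow> real" and X \<Xi> D r Dx U m L\<^sub>0 L\<^sub>\<xi> \<alpha> +
  fixes \<delta> :: real
  assumes \<delta>: "0 < \<delta>" "\<delta> < r"
begin

abbreviation X\<^sub>\<delta> where "X\<^sub>\<delta> \<equiv> shrunk X r \<delta>"

lemma \<delta>_ratio: "0 < \<delta> / r" "\<delta> / r < 1" "0 < 1 - \<delta> / r"
  using \<delta> r_pos by auto

lemma shrunk_subset: "X\<^sub>\<delta> \<subseteq> X"
  by (auto simp: shrunk_def)

lemma scale_in_shrunk:
  assumes "x \<in> X"
  shows "(1 - \<delta> / r) *\<^sub>R x \<in> X\<^sub>\<delta>"
proof -
  have "(1 - \<delta> / r) *\<^sub>R x + (\<delta> / r) *\<^sub>R 0 \<in> X"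
    using convexD[OF convex_X assms zero_in_X, of "1 - \<delta> / r" "\<delta> / r"] \<delta>_ratio by simp
  then show ?thesis using assms \<delta> r_pos by (simp add: shrunk_def)
qed

text \<open>The shrinking ratio is chosen for this: the perturbed point is a convex combination,
  with weights 1 - \<delta>/r and \<delta>/r, of the rescaled \<open>x\<close> in \<open>X\<close>
  and of \<open>r *\<^sub>R u\<close> in the inscribed ball.\<close>

lemma shrunk_add_in_X:
  assumes "x \<in> X\<^sub>\<delta>" "norm u \<le> 1"
  shows "x + \<delta> *\<^sub>R u \<in> X"
proof -
  have "(1 / (1 - \<delta> / r)) *\<^sub>R x \<in> X" using assms by (simp add: shrunk_def)
  moreover have "r *\<^sub>R u \<in> X"
    using assms r_pos ball_X by (auto simp: mult_left_le)
  ultimately have "(1 - \<delta> / r) *\<^sub>R ((1 / (1 - \<delta> / r)) *\<^sub>R x) + (\<delta> / r) *\<^sub>R (r *\<^sub>R u) \<in> X"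
    using \<delta>_ratio by (intro convexD[OF convex_X]) auto
  then show ?thesis using \<delta> r_pos by simp
qed

lemma shrunk_closed: "closed X\<^sub>\<delta>"
proof -
  have "X\<^sub>\<delta> = X \<inter> (\<lambda>x. (1 / (1 - \<delta> / r)) *\<^sub>R x) -` X" by (auto simp: shrunk_def)
  moreover have "closed ((\<lambda>x. (1 / (1 - \<delta> / r)) *\<^sub>R x) -` X)"
    by (intro closed_vimage closed_X continuous_intros)
  ultimately show ?thesis using closed_X by (simp add: closed_Int)
qed

lemma shrunk_convex: "convex X\<^sub>\<delta>"
proof -
  have "X\<^sub>\<delta> = X \<inter> (\<lambda>x. (1 / (1 - \<delta> / r)) *\<^sub>R x) -` X" by (auto simp: shrunk_def)
  moreover have "convex ((\<lambda>x. (1 / (1 - \<delta> / r)) *\<^sub>R x) -` X)"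
    by (intro convex_linear_vimage convex_X) (simp add: linear_scaleR)
  ultimately show ?thesis using convex_X by (simp add: convex_Int)
qed

lemma shrunk_nonempty: "X\<^sub>\<delta> \<noteq> {}"
  using scale_in_shrunk[OF zero_in_X] by auto

lemma sphere_gradient_le:
  assumes x: "x \<in> X\<^sub>\<delta>" and y: "y \<in> X\<^sub>\<delta>"
  shows "real CARD('d) / \<delta> * (\<integral>u. C t (x + \<delta> *\<^sub>R u) * (u \<bullet> (y - x)) \<partial>uniform_sphere)
    \<le> C t y - C t x + 2 * L\<^sub>0 * \<delta> - m / 2 * (norm (y - x))\<^sup>2"
proof -
  let ?K = "C t y - C t x + 2 * L\<^sub>0 * \<delta> - m / 2 * (norm (y - x))\<^sup>2"
  let ?Q = "m / 2 * (norm (y - x))\<^sup>2"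
  \<comment> \<open>The cost is controlled on \<open>X\<close> only, whereas the sphere lemma asks
    for a global Lipschitz function; the nonexpansive projection extends it. The direction
    \<open>?h\<close> on the next line is scaled so that an increment \<open>e\<close> moves the
    query by the fraction \<open>e\<close> of \<open>y - x\<close>.\<close>
  let ?f = "\<lambda>v. C t (closest_point X (x + \<delta> *\<^sub>R v))"
  let ?h = "(1 / \<delta>) *\<^sub>R (y - x)"
  have X0: "X \<noteq> {}" using zero_in_X by auto
  have cpX: "closest_point X z \<in> X" for z by (rule closest_point_in_set[OF closed_X X0])
  have f: "?f v = C t (x + \<delta> *\<^sub>R v)" if "norm v \<le> 1" for v
    using shrunk_add_in_X[OF x that] by (simp add: closest_point_self)
  have "real DIM(real^'d) * (\<integral>u. ?f u * (u \<bullet> ?h) \<partial>uniform_sphere) \<le> ?K"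
  proof (rule uniform_sphere_gradient_le[where L = "L\<^sub>0 * \<delta>" and M = U and Q = ?Q])
    show "0 \<le> L\<^sub>0 * \<delta>" using L0_pos \<delta> by simp
    show "\<bar>?f v\<bar> \<le> U" for v by (rule C_bounded[OF cpX])
    show "\<bar>?f v - ?f w\<bar> \<le> L\<^sub>0 * \<delta> * norm (v - w)" for v w
    proof -
      have "\<bar>?f v - ?f w\<bar> \<le> L\<^sub>0 * dist (closest_point X (x + \<delta> *\<^sub>R v)) (closest_point X (x + \<delta> *\<^sub>R w))"
        using C_Lipschitz[OF cpX cpX] by (simp add: dist_norm)
      also have "\<dots> \<le> L\<^sub>0 * dist (x + \<delta> *\<^sub>R v) (x + \<delta> *\<^sub>R w)"
        using L0_pos by (intro mult_left_mono closest_point_lipschitz convex_X closed_X X0) auto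
      also have "\<dots> = L\<^sub>0 * \<delta> * norm (v - w)"
        using \<delta> by (simp add: dist_norm scaleR_diff_right[symmetric])
      finally show ?thesis .
    qed
    show "?f (v + e *\<^sub>R ?h) - ?f v \<le> e * (?K + e * ?Q)" if v: "norm v \<le> 1" and e: "0 < e" "e \<le> 1" for v e
    proof -
      \<comment> \<open>The target is shifted by the same vector as the start, so the displacement
        stays \<open>y - x\<close>; this is where \<open>y\<close> must lie in the shrunk set.
        Undoing the two shifts in the cost values gives \<open>2 * L\<^sub>0 * \<delta>\<close>. The
        loss of \<open>e * ?Q\<close> in the quadratic term is of second order and disappears in the
        sphere lemma.\<close>
      let ?x = "x + \<delta> *\<^sub>R v" and ?y = "y + \<delta> *\<^sub>R v"
      have in_X: "?x \<in> X" "?y \<in> X" "x \<in> X" "y \<in> X"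
        using shrunk_add_in_X[OF x v] shrunk_add_in_X[OF y v] x y shrunk_subset by auto
      have seg: "x + \<delta> *\<^sub>R (v + e *\<^sub>R ?h) = ?x + e *\<^sub>R (?y - ?x)"
        using \<delta> by (simp add: algebra_simps)
      have "?x + e *\<^sub>R (?y - ?x) = (1 - e) *\<^sub>R ?x + e *\<^sub>R ?y" by (simp add: algebra_simps)
      then have seg_X: "?x + e *\<^sub>R (?y - ?x) \<in> X" using convex_X in_X(1,2) e by (simp add: convexD_alt)
      have "?f (v + e *\<^sub>R ?h) = C t (?x + e *\<^sub>R (?y - ?x))"
        unfolding seg using seg_X by (simp only: closest_point_self)
      also have "\<dots> \<le> (1 - e) * C t ?x + e * C t ?y - m / 2 * (e * (1 - e)) * (norm (?y - ?x))\<^sup>2"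
        using e in_X by (intro C_strongly_convex) auto
      finally have "?f (v + e *\<^sub>R ?h) - ?f v \<le> e * (C t ?y - C t ?x - (1 - e) * ?Q)"
        using f[OF v] by (simp add: algebra_simps)
      also have "\<dots> \<le> e * (?K + e * ?Q)"
      proof (intro mult_left_mono)
        have "L\<^sub>0 * (\<delta> * norm v) \<le> L\<^sub>0 * \<delta>" using v \<delta> L0_pos by (intro mult_left_mono) (auto simp: mult_left_le)
        then have "C t ?y \<le> C t y + L\<^sub>0 * \<delta>" "C t x - L\<^sub>0 * \<delta> \<le> C t ?x"
          using C_Lipschitz[OF in_X(2,4), of t] C_Lipschitz[OF in_X(1,3), of t] \<delta> by (auto simp: abs_le_iff)
        moreover have "(1 - e) * ?Q = ?Q - e * ?Q" by (simp only: left_diff_distrib mult_1)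
        ultimately show "C t ?y - C t ?x - (1 - e) * ?Q \<le> ?K + e * ?Q" by linarith
      qed (use e in simp)
      finally show ?thesis .
    qed
  qed
  moreover have "(\<integral>u. ?f u * (u \<bullet> ?h) \<partial>uniform_sphere)
    = (\<integral>u. (C t (x + \<delta> *\<^sub>R u) * (u \<bullet> (y - x))) / \<delta> \<partial>uniform_sphere)"
    by (intro Bochner_Integration.integral_cong refl) (simp add: space_uniform_sphere f)
  ultimately show ?thesis by (simp add: field_simps)
qed

end

section \<open>Measurability and integration over blocks of coordinates\<close>

text \<open>A countable infimum makes CVaR measurable in its data. Rational thresholds suffice
  because raising \<open>v\<close> above the minimiser lowers the hinge term and adds only the
  increment itself.\<close>

lemma (in prob_space) cvar_of_eq_INF_rational:
  fixes f :: "'a \<Rightarrow> real"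
  assumes f: "f \<in> borel_measurable M" "\<And>x. x \<in> space M \<Longrightarrow> \<bar>f x\<bar> \<le> U" and \<alpha>: "0 < \<alpha>" "\<alpha> \<le> 1"
  shows "cvar_of \<alpha> M f = (INF v\<in>\<rat>. ru_objective \<alpha> M f v)"
    and "bdd_below (ru_objective \<alpha> M f ` \<rat>)"
proof -
  obtain q where q: "cvar_of \<alpha> M f = ru_objective \<alpha> M f q" using cvar_of_attained[OF f \<alpha>] .
  have low: "cvar_of \<alpha> M f \<le> ru_objective \<alpha> M f v" for v by (rule cvar_of_le[OF f \<alpha>])
  then show bdd: "bdd_below (ru_objective \<alpha> M f ` \<rat>)" by (intro bdd_belowI2)
  show "cvar_of \<alpha> M f = (INF v\<in>\<rat>. ru_objective \<alpha> M f v)"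
  proof (rule antisym)
    show "cvar_of \<alpha> M f \<le> (INF v\<in>\<rat>. ru_objective \<alpha> M f v)"
      using Rats_0 by (intro cINF_greatest low) auto
    show "(INF v\<in>\<rat>. ru_objective \<alpha> M f v) \<le> cvar_of \<alpha> M f"
    proof (rule field_le_epsilon)
      fix e :: real assume e: "0 < e"
      obtain v where v: "v \<in> \<rat>" "q < v" "v < q + e"
        using Rats_dense_in_real[of q "q + e"] e by auto
      have "(\<integral>x. max 0 (f x - v) \<partial>M) \<le> (\<integral>x. max 0 (f x - q) \<partial>M)"
        using v integrable_hinge[OF f] by (intro integral_mono) auto
      then have "ru_objective \<alpha> M f v \<le> ru_objective \<alpha> M f q + e"
        unfolding ru_objective_def using v \<alpha>
        by (smt (verit) divide_right_mono)
      then show "(INF v\<in>\<rat>. ru_objective \<alpha> M f v) \<le> cvar_of \<alpha> M f + e"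
        unfolding q using cINF_lower[OF bdd v(1)] by linarith
    qed
  qed
qed

lemma emp_cdf_cong:
  assumes "\<And>i. i \<in> {1..n} \<Longrightarrow> z i = z' i"
  shows "emp_cdf f n z = emp_cdf f n z'"
  using assms unfolding emp_cdf_def by (intro ext arg_cong2[where f = "(*)"] sum.cong refl) auto

lemma CVaR_emp_cdf_bounded:
  assumes n: "0 < n" and f: "\<And>i. i \<in> {1..n} \<Longrightarrow> \<bar>f (z i)\<bar> \<le> U" and \<alpha>: "0 < \<alpha>" "\<alpha> \<le> 1"
  shows "\<bar>CVaR \<alpha> (emp_cdf f n z)\<bar> \<le> U"
proof -
  interpret N: prob_space "uniform_count_measure {1..n}"
    using n by (intro prob_space_uniform_count_measure) auto
  show ?thesis
    unfolding CVaR_emp_cdf(1)[OF n] using f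
    by (intro N.cvar_of_bounded \<alpha>)
      (auto simp: measurable_def space_uniform_count_measure sets_uniform_count_measure simp del: One_nat_def)
qed

lemma borel_measurable_CVaR_emp_cdf:
  assumes n: "0 < n" and \<alpha>: "0 < \<alpha>" "\<alpha> \<le> 1"
    and m: "\<And>i. i \<in> {1..n} \<Longrightarrow> (\<lambda>\<omega>. f \<omega> (z \<omega> i)) \<in> borel_measurable N"
    and U: "\<And>\<omega> i. \<omega> \<in> space N \<Longrightarrow> i \<in> {1..n} \<Longrightarrow> \<bar>f \<omega> (z \<omega> i)\<bar> \<le> U"
  shows "(\<lambda>\<omega>. CVaR \<alpha> (emp_cdf (f \<omega>) n (z \<omega>))) \<in> borel_measurable N"
proof -
  let ?M = "uniform_count_measure {1..n}"
  interpret M: prob_space ?M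
    using n by (intro prob_space_uniform_count_measure) auto
  have ru: "ru_objective \<alpha> ?M g v = v + ((\<Sum>i=1..n. max 0 (g i - v)) / n) / \<alpha>" for g v
    unfolding ru_objective_def by (subst integral_uniform_count_measure) auto
  have any: "g \<in> borel_measurable ?M" for g :: "nat \<Rightarrow> real"
    by (auto simp: measurable_def space_uniform_count_measure sets_uniform_count_measure)
  have gU: "\<bar>f \<omega> (z \<omega> i)\<bar> \<le> U" if "\<omega> \<in> space N" "i \<in> space ?M" for \<omega> i
    using U that by (simp add: space_uniform_count_measure)
  have eq: "CVaR \<alpha> (emp_cdf (f \<omega>) n (z \<omega>)) = (INF v\<in>\<rat>. ru_objective \<alpha> ?M (\<lambda>i. f \<omega> (z \<omega> i)) v)"
    and bdd: "bdd_below ((\<lambda>v. ru_objective \<alpha> ?M (\<lambda>i. f \<omega> (z \<omega> i)) v) ` \<rat>)" if "\<omega> \<in> space N" for \<omega>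
    unfolding CVaR_emp_cdf(1)[OF n] using M.cvar_of_eq_INF_rational[OF any gU \<alpha>] that by auto
  have "(\<lambda>\<omega>. INF v\<in>\<rat>. ru_objective \<alpha> ?M (\<lambda>i. f \<omega> (z \<omega> i)) v) \<in> borel_measurable N"
  proof (rule borel_measurable_cINF)
    show "(\<lambda>\<omega>. ru_objective \<alpha> ?M (\<lambda>i. f \<omega> (z \<omega> i)) v) \<in> borel_measurable N" for v
      unfolding ru
      by (intro borel_measurable_add borel_measurable_divide borel_measurable_sum borel_measurable_max
          borel_measurable_diff m borel_measurable_const)
  qed (use bdd countable_rat in auto)
  then show ?thesis
    using eq by (subst measurable_cong) auto
qed

text \<open>A substitute for conditioning: a bound on the integral over the block \<open>A\<close>,
  uniform in the remaining coordinates, bounds the full integral.\<close>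

lemma (in product_prob_space) integral_block_le:
  fixes f :: "('i \<Rightarrow> 'a) \<Rightarrow> real"
  assumes I: "finite I" and A: "A \<subseteq> I"
    and f: "f \<in> borel_measurable (Pi\<^sub>M I M)" "\<And>x. x \<in> space (Pi\<^sub>M I M) \<Longrightarrow> \<bar>f x\<bar> \<le> K"
    and B: "\<And>x. x \<in> space (Pi\<^sub>M (I - A) M) \<Longrightarrow> (\<integral>y. f (merge (I - A) A (x, y)) \<partial>Pi\<^sub>M A M) \<le> B"
  shows "(\<integral>x. f x \<partial>Pi\<^sub>M I M) \<le> B"
proof -
  have un: "I = (I - A) \<union> A" using A by auto
  interpret R: prob_space "Pi\<^sub>M (I - A) M" by (rule prob_space_PiM) (simp add: prob_space)
  interpret PA: prob_space "Pi\<^sub>M A M" by (rule prob_space_PiM) (simp add: prob_space)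
  have merge_m: "merge (I - A) A \<in> measurable (Pi\<^sub>M (I - A) M \<Otimes>\<^sub>M Pi\<^sub>M A M) (Pi\<^sub>M I M)"
    using measurable_merge[of "I - A" A M] un by simp
  have fm: "(\<lambda>p. f (merge (I - A) A p)) \<in> borel_measurable (Pi\<^sub>M (I - A) M \<Otimes>\<^sub>M Pi\<^sub>M A M)"
    by (rule measurable_compose[OF merge_m f(1)])
  have fb: "\<bar>f (merge (I - A) A (x, y))\<bar> \<le> K" if "x \<in> space (Pi\<^sub>M (I - A) M)" "y \<in> space (Pi\<^sub>M A M)" for x y
    using measurable_space[OF merge_m, of "(x, y)"] that by (intro f(2)) (simp add: space_pair_measure)
  have int: "integrable (Pi\<^sub>M I M) f" by (rule P.bounded_integrable[OF f])
  have "(\<integral>x. f x \<partial>Pi\<^sub>M I M) = (\<integral>x. \<integral>y. f (merge (I - A) A (x, y)) \<partial>Pi\<^sub>M A M \<partial>Pi\<^sub>M (I - A) M)"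
    using product_integral_fold[of "I - A" A f] int I A un by (metis Diff_disjoint finite_Diff finite_subset inf_commute)
  also have "\<dots> \<le> B"
    by (intro R.bounded_integral_le B
        finite_measure_Fubini(4)[OF R.finite_measure_axioms PA.finite_measure_axioms fm, where B = K] fb)
  finally show ?thesis .
qed

context risk_averse_cost
begin

lemma closest_point_in_X: "closest_point X z \<in> X"
  using zero_in_X by (intro closest_point_in_set closed_X) auto

text \<open>A Caratheodory function is jointly measurable; Lipschitz continuity in the decision
  allows to write it as a supremum over a countable dense set of decisions.\<close>

lemma J_jointly_measurable:
  assumes x: "x \<in> borel_measurable N" "\<And>\<omega>. \<omega> \<in> space N \<Longrightarrow> x \<omega> \<in> X" and z: "z \<in> measurable N (D t)"
  shows "(\<lambda>\<omega>. J (x \<omega>) (z \<omega>)) \<in> borel_measurable N"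
proof -
  obtain Q where Q: "countable Q" "Q \<subseteq> X" "X \<subseteq> closure Q" using separable .
  have z': "z \<omega> \<in> \<Xi>" if "\<omega> \<in> space N" for \<omega>
    using measurable_space[OF z that] by (simp add: space_D)
  have Q0: "Q \<noteq> {}" using Q zero_in_X by auto
  have up: "J q \<xi> - L\<^sub>0 * norm (x - q) \<le> J x \<xi>" if "x \<in> X" "\<xi> \<in> \<Xi>" "q \<in> Q" for x \<xi> q
    using J_Lipschitz[OF that(2), of q x] that Q by (auto simp: norm_minus_commute)
  have eq: "J x \<xi> = (SUP q\<in>Q. J q \<xi> - L\<^sub>0 * norm (x - q))" if x: "x \<in> X" and \<xi>: "\<xi> \<in> \<Xi>" for x \<xi>
  proof (rule antisym)
    show "(SUP q\<in>Q. J q \<xi> - L\<^sub>0 * norm (x - q)) \<le> J x \<xi>"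
      by (intro cSUP_least Q0 up that)
    show "J x \<xi> \<le> (SUP q\<in>Q. J q \<xi> - L\<^sub>0 * norm (x - q))"
    proof (rule field_le_epsilon)
      fix e :: real assume "0 < e"
      then obtain q where q: "q \<in> Q" "dist q x < e / (2 * L\<^sub>0)"
        using Q x L0_pos closure_approachable[of x Q] by (metis divide_pos_pos mult_pos_pos subsetD zero_less_numeral)
      have "L\<^sub>0 * norm (x - q) \<le> e / 2"
        using q L0_pos by (simp add: dist_norm norm_minus_commute field_simps)
      moreover have "J x \<xi> \<le> J q \<xi> + L\<^sub>0 * norm (x - q)"
        using J_Lipschitz[OF \<xi> x, of q] q Q by (auto simp: abs_le_iff)
      moreover have "J q \<xi> - L\<^sub>0 * norm (x - q) \<le> (SUP q\<in>Q. J q \<xi> - L\<^sub>0 * norm (x - q))"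
        using up that q by (intro cSUP_upper bdd_aboveI2[where M = "J x \<xi>"]) auto
      ultimately show "J x \<xi> \<le> (SUP q\<in>Q. J q \<xi> - L\<^sub>0 * norm (x - q)) + e" by linarith
    qed
  qed
  have "(\<lambda>\<omega>. SUP q\<in>Q. J q (z \<omega>) - L\<^sub>0 * norm (x \<omega> - q)) \<in> borel_measurable N"
  proof (rule borel_measurable_cSUP)
    show "(\<lambda>\<omega>. J q (z \<omega>) - L\<^sub>0 * norm (x \<omega> - q)) \<in> borel_measurable N" if "q \<in> Q" for q
    proof -
      have "(\<lambda>\<omega>. J q (z \<omega>)) \<in> borel_measurable N"
        using that Q by (intro measurable_compose[OF z] J_measurable) auto
      then show ?thesis using x(1) by simp
    qed
    show "bdd_above ((\<lambda>q. J q (z \<omega>) - L\<^sub>0 * norm (x \<omega> - q)) ` Q)" if "\<omega> \<in> space N" for \<omega>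
      using up x(2)[OF that] z'[OF that] by (intro bdd_aboveI2[where M = "J (x \<omega>) (z \<omega>)"]) auto
  qed (rule Q)
  then show ?thesis
    using eq x(2) z' by (subst measurable_cong) auto
qed

lemma C_measurable:
  assumes x: "x \<in> borel_measurable N" "\<And>\<omega>. \<omega> \<in> space N \<Longrightarrow> x \<omega> \<in> X"
  shows "(\<lambda>\<omega>. C t (x \<omega>)) \<in> borel_measurable N"
proof -
  have "continuous_on UNIV (\<lambda>z. C t (closest_point X z))"
  proof (intro lipschitz_on_continuous_on[of L\<^sub>0] lipschitz_onI)
    fix a b
    have "dist (C t (closest_point X a)) (C t (closest_point X b)) \<le> L\<^sub>0 * dist (closest_point X a) (closest_point X b)"
      using C_Lipschitz[OF closest_point_in_X closest_point_in_X] by (simp add: dist_norm)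
    also have "\<dots> \<le> L\<^sub>0 * dist a b"
      using L0_pos zero_in_X by (intro mult_left_mono closest_point_lipschitz convex_X closed_X) auto
    finally show "dist (C t (closest_point X a)) (C t (closest_point X b)) \<le> L\<^sub>0 * dist a b" .
  qed (use L0_pos in simp)
  then have "(\<lambda>\<omega>. C t (closest_point X (x \<omega>))) \<in> borel_measurable N"
    by (intro measurable_compose[OF x(1)] borel_measurable_continuous_onI)
  then show ?thesis
    using x(2) by (subst measurable_cong[where g = "\<lambda>\<omega>. C t (closest_point X (x \<omega>))"]) (auto simp: closest_point_self)
qed

end

section \<open>Position of a round within its batch\<close>

lemma epoch_block:
  assumes "1 \<le> \<tau>" "\<tau> \<le> \<Delta>"
  shows "epoch \<Delta> (b * \<Delta> + \<tau>) = \<tau>"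
proof -
  have "\<lceil>real (b * \<Delta> + \<tau>) / real \<Delta>\<rceil> = int b + 1"
    using assms by (intro ceiling_unique) (auto simp: field_simps)
  then show ?thesis unfolding epoch_def by (simp add: nat_add_distrib)
qed

lemma epoch_range:
  assumes "1 \<le> t" "0 < \<Delta>"
  shows "epoch \<Delta> t \<in> {1..\<Delta>}"
proof -
  define b where "b = (t - 1) div \<Delta>"
  define \<tau> where "\<tau> = (t - 1) mod \<Delta> + 1"
  have "t = b * \<Delta> + \<tau>" using assms unfolding b_def \<tau>_def by simp
  moreover have "1 \<le> \<tau>" "\<tau> \<le> \<Delta>" using assms unfolding \<tau>_def by (auto simp: Suc_le_eq)
  ultimately show ?thesis using epoch_block[of \<tau> \<Delta> b] by simp
qed

section \<open>The stochastic process of iterates\<close>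

lemma measurable_ident_uniform_sphere: "(\<lambda>u. u) \<in> borel_measurable (uniform_sphere :: 'a::euclidean_space measure)"
  by (subst measurable_cong_sets[OF sets_uniform_sphere refl], rule measurable_restrict_space1) simp

locale regret_setting = shrunk_domain J X \<Xi> D r Dx U m L\<^sub>0 L\<^sub>\<xi> \<alpha> \<delta>
  for J :: "real^'d \<Rightarrow> 'b::metric_space \<Rightarrow> real" and X \<Xi> D r Dx U m L\<^sub>0 L\<^sub>\<xi> \<alpha> \<delta> +
  fixes T \<Delta> :: nat and \<phi> :: "nat \<Rightarrow> nat" and x1 :: "real^'d"
  assumes \<Delta>_pos: "0 < \<Delta>" and x1: "x1 \<in> shrunk X r \<delta>"
    and \<phi>_pos: "\<And>\<tau>. \<tau> \<in> {1..\<Delta>} \<Longrightarrow> 0 < \<phi> \<tau>"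
begin

abbreviation n :: "nat \<Rightarrow> nat" where "n t \<equiv> \<phi> (epoch \<Delta> t)"
abbreviation \<eta> :: "nat \<Rightarrow> real" where "\<eta> t \<equiv> 1 / (m * real (epoch \<Delta> t))"
abbreviation S :: "(nat \<times> nat) set" where "S \<equiv> SIGMA t:{1..T}. {1..n t}"
abbreviation PU :: "(nat \<Rightarrow> real^'d) measure" where "PU \<equiv> \<Pi>\<^sub>M t\<in>{1..T}. uniform_sphere"
abbreviation PX :: "(nat \<times> nat \<Rightarrow> 'b) measure" where "PX \<equiv> Pi\<^sub>M S (\<lambda>(t, i). D t)"
abbreviation P :: "((nat \<Rightarrow> real^'d) \<times> (nat \<times> nat \<Rightarrow> 'b)) measure" where "P \<equiv> sampling_measure T n D"
abbreviation iter :: "(nat \<Rightarrow> real^'d) \<Rightarrow> (nat \<times> nat \<Rightarrow> 'b) \<Rightarrow> nat \<Rightarrow> real^'d" where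
  "iter u \<xi> t \<equiv> iterate J X r \<alpha> \<Delta> \<delta> \<phi> \<eta> x1 u \<xi> t"
abbreviation play :: "(nat \<Rightarrow> real^'d) \<Rightarrow> (nat \<times> nat \<Rightarrow> 'b) \<Rightarrow> nat \<Rightarrow> real^'d" where
  "play u \<xi> t \<equiv> iter u \<xi> t + \<delta> *\<^sub>R u t"
abbreviation grad :: "(nat \<Rightarrow> real^'d) \<Rightarrow> (nat \<times> nat \<Rightarrow> 'b) \<Rightarrow> nat \<Rightarrow> real^'d" where
  "grad u \<xi> t \<equiv> grad_estimate J \<alpha> \<delta> (n t) (iter u \<xi> t) (u t) (\<lambda>i. \<xi> (t, i))"
abbreviation cvar_emp :: "(nat \<Rightarrow> real^'d) \<Rightarrow> (nat \<times> nat \<Rightarrow> 'b) \<Rightarrow> nat \<Rightarrow> real" where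
  "cvar_emp u \<xi> t \<equiv> CVaR \<alpha> (emp_cdf (J (play u \<xi> t)) (n t) (\<lambda>i. \<xi> (t, i)))"

lemma P_eq: "P = PU \<Otimes>\<^sub>M PX"
  by (simp add: sampling_measure_def)

lemma n_pos: "1 \<le> t \<Longrightarrow> 0 < n t"
  by (intro \<phi>_pos epoch_range \<Delta>_pos)

lemma epoch_pos: "1 \<le> t \<Longrightarrow> 0 < epoch \<Delta> t"
  using epoch_range[of t \<Delta>] \<Delta>_pos by auto

lemma prob_PU: "prob_space PU"
  by (intro prob_space_PiM prob_space_uniform_sphere)

lemma prob_PX: "prob_space PX"
  by (intro prob_space_PiM) (auto simp: prob_D)

lemma prob_P: "prob_space P"
proof -
  interpret PU: prob_space PU by (rule prob_PU)
  interpret PX: prob_space PX by (rule prob_PX)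
  interpret pair_prob_space PU PX ..
  show ?thesis unfolding P_eq by unfold_locales
qed

lemma space_P: "\<omega> \<in> space P \<longleftrightarrow> fst \<omega> \<in> space PU \<and> snd \<omega> \<in> space PX"
  by (cases \<omega>) (simp add: P_eq space_pair_measure)

lemma space_PU: "u \<in> space PU \<Longrightarrow> t \<in> {1..T} \<Longrightarrow> norm (u t) = 1"
  by (force simp: space_PiM space_uniform_sphere PiE_iff)

lemma space_PX: "\<xi> \<in> space PX \<Longrightarrow> t \<in> {1..T} \<Longrightarrow> i \<in> {1..n t} \<Longrightarrow> \<xi> (t, i) \<in> \<Xi>"
  by (force simp: space_PiM space_D PiE_iff)

lemma iter_in_shrunk: "iter u \<xi> t \<in> shrunk X r \<delta>"
  by (cases t) (auto simp: x1 closest_point_in_set shrunk_closed shrunk_nonempty)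

lemma iter_in_X: "iter u \<xi> t \<in> X"
  using iter_in_shrunk shrunk_subset by blast

lemma play_in_X: "norm (u t) = 1 \<Longrightarrow> play u \<xi> t \<in> X"
  by (rule shrunk_add_in_X[OF iter_in_shrunk]) simp

text \<open>Non-anticipation: the inequality \<open>s < t\<close> is strict, so the iterate stays
  constant while the coordinates of round \<open>t\<close> are integrated.\<close>

lemma iter_cong:
  assumes "\<And>s. 1 \<le> s \<Longrightarrow> s < t \<Longrightarrow> u s = u' s"
    and "\<And>s i. 1 \<le> s \<Longrightarrow> s < t \<Longrightarrow> i \<in> {1..n s} \<Longrightarrow> \<xi> (s, i) = \<xi>' (s, i)"
  shows "iter u \<xi> t = iter u' \<xi>' t"
  using assms
proof (induction t)
  case (Suc t)
  have IH: "iter u \<xi> t = iter u' \<xi>' t" using Suc by auto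
  show ?case
  proof (cases "t = 0")
    case False
    then have "u t = u' t" using Suc.prems(1)[of t] by simp
    moreover have "emp_cdf f (n t) (\<lambda>i. \<xi> (t, i)) = emp_cdf f (n t) (\<lambda>i. \<xi>' (t, i))" for f
      using False Suc.prems(2)[of t] by (intro emp_cdf_cong) auto
    ultimately show ?thesis
      unfolding iterate.simps grad_estimate_def IH by simp
  qed simp
qed simp

lemma u_measurable: "t \<in> {1..T} \<Longrightarrow> (\<lambda>u. u t) \<in> borel_measurable PU"
proof -
  assume "t \<in> {1..T}"
  then have "(\<lambda>u. u t) \<in> measurable PU uniform_sphere"
    by (intro measurable_component_singleton) auto
  then show ?thesis by (rule measurable_compose[OF _ measurable_ident_uniform_sphere])
qed

lemma \<xi>_measurable:
  assumes "t \<in> {1..T}" "i \<in> {1..n t}"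
  shows "(\<lambda>\<xi>. \<xi> (t, i)) \<in> measurable PX (D t)"
  using measurable_component_singleton[of "(t, i)" S "\<lambda>(t, i). D t"] assms by simp

text \<open>Measurability of the iterate is an assumption here because this lemma serves as the
  induction step that produces the next iterate.\<close>

lemma cvar_emp_measurable_step:
  assumes it: "(\<lambda>\<omega>. iter (fst \<omega>) (snd \<omega>) t) \<in> borel_measurable P" and t: "t \<in> {1..T}"
  shows "(\<lambda>\<omega>. cvar_emp (fst \<omega>) (snd \<omega>) t) \<in> borel_measurable P"
proof (rule borel_measurable_CVaR_emp_cdf[OF _ \<alpha>])
  show "0 < n t" using n_pos t by auto
  have um: "(\<lambda>\<omega>. fst \<omega> t) \<in> borel_measurable P"
    unfolding P_eq by (rule measurable_compose[OF measurable_fst u_measurable[OF t]])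
  have pX: "play (fst \<omega>) (snd \<omega>) t \<in> X" if "\<omega> \<in> space P" for \<omega>
    using that t by (intro play_in_X space_PU) (auto simp: space_P)
  show "(\<lambda>\<omega>. J (play (fst \<omega>) (snd \<omega>) t) (snd \<omega> (t, i))) \<in> borel_measurable P" if "i \<in> {1..n t}" for i
  proof (rule J_jointly_measurable[OF _ pX])
    show "(\<lambda>\<omega>. snd \<omega> (t, i)) \<in> measurable P (D t)"
      unfolding P_eq by (rule measurable_compose[OF measurable_snd \<xi>_measurable[OF t that]])
  qed (use it um in auto)
  show "\<bar>J (play (fst \<omega>) (snd \<omega>) t) (snd \<omega> (t, i))\<bar> \<le> U" if "\<omega> \<in> space P" "i \<in> {1..n t}" for \<omega> i
    using that t pX[OF that(1)] by (intro J_bounded space_PX) (auto simp: space_P)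
qed

lemma grad_eq: "grad u \<xi> t = (real CARD('d) / \<delta> * cvar_emp u \<xi> t) *\<^sub>R u t"
  by (simp add: grad_estimate_def)

lemma iter_measurable:
  assumes "t \<le> T + 1"
  shows "(\<lambda>\<omega>. iter (fst \<omega>) (snd \<omega>) t) \<in> borel_measurable P"
  using assms
proof (induction t)
  case (Suc t)
  show ?case
  proof (cases "t = 0")
    case False
    then have t: "t \<in> {1..T}" using Suc.prems by auto
    have it: "(\<lambda>\<omega>. iter (fst \<omega>) (snd \<omega>) t) \<in> borel_measurable P" using Suc by simp
    have um: "(\<lambda>\<omega>. fst \<omega> t) \<in> borel_measurable P"
      unfolding P_eq by (rule measurable_compose[OF measurable_fst u_measurable[OF t]])
    have "(\<lambda>\<omega>. iter (fst \<omega>) (snd \<omega>) t - \<eta> t *\<^sub>R grad (fst \<omega>) (snd \<omega>) t) \<in> borel_measurable P"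
      unfolding grad_eq using it um cvar_emp_measurable_step[OF it t] by measurable
    moreover have "closest_point (shrunk X r \<delta>) \<in> borel_measurable borel"
      by (intro borel_measurable_continuous_onI continuous_on_closest_point shrunk_convex shrunk_closed shrunk_nonempty)
    ultimately show ?thesis using False by (simp add: measurable_compose)
  qed simp
qed simp

lemma cvar_emp_measurable:
  "t \<in> {1..T} \<Longrightarrow> (\<lambda>\<omega>. cvar_emp (fst \<omega>) (snd \<omega>) t) \<in> borel_measurable P"
  by (intro cvar_emp_measurable_step iter_measurable) auto

lemma u_measurable_P: "t \<in> {1..T} \<Longrightarrow> (\<lambda>\<omega>. fst \<omega> t) \<in> borel_measurable P"
  unfolding P_eq by (rule measurable_compose[OF measurable_fst u_measurable])

lemma play_in_X_P: "t \<in> {1..T} \<Longrightarrow> \<omega> \<in> space P \<Longrightarrow> play (fst \<omega>) (snd \<omega>) t \<in> X"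
  by (intro play_in_X space_PU) (auto simp: space_P)

lemma C_play_measurable:
  "t \<in> {1..T} \<Longrightarrow> (\<lambda>\<omega>. C t (play (fst \<omega>) (snd \<omega>) t)) \<in> borel_measurable P"
  using iter_measurable[of t] u_measurable_P[of t]
  by (intro C_measurable play_in_X_P) auto

lemma C_iter_measurable:
  "t \<in> {1..T} \<Longrightarrow> (\<lambda>\<omega>. C t (iter (fst \<omega>) (snd \<omega>) t)) \<in> borel_measurable P"
  using iter_measurable[of t] by (intro C_measurable iter_in_X) auto

lemma cvar_emp_bounded:
  assumes "t \<in> {1..T}" "\<omega> \<in> space P"
  shows "\<bar>cvar_emp (fst \<omega>) (snd \<omega>) t\<bar> \<le> U"
proof (rule CVaR_emp_cdf_bounded[OF _ _ \<alpha>])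
  show "0 < n t" using n_pos assms by auto
  show "\<bar>J (play (fst \<omega>) (snd \<omega>) t) (snd \<omega> (t, i))\<bar> \<le> U" if "i \<in> {1..n t}" for i
    using assms that by (intro J_bounded play_in_X_P space_PX) (auto simp: space_P)
qed

text \<open>Integrating out the noise block of step \<open>t\<close>, on which the query point does not depend.\<close>

lemma expectation_noise_error:
  assumes t: "t \<in> {1..T}"
  shows "(\<integral>\<omega>. \<bar>cvar_emp (fst \<omega>) (snd \<omega>) t - C t (play (fst \<omega>) (snd \<omega>) t)\<bar> \<partial>P)
    \<le> 2 * U / (\<alpha> * sqrt (n t))"
proof -
  let ?F = "\<lambda>\<omega>. \<bar>cvar_emp (fst \<omega>) (snd \<omega>) t - C t (play (fst \<omega>) (snd \<omega>) t)\<bar>"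
  let ?B = "2 * U / (\<alpha> * sqrt (n t))"
  let ?A = "{t} \<times> {1..n t}"
  interpret PU: prob_space PU by (rule prob_PU)
  interpret PX: prob_space PX by (rule prob_PX)
  interpret pX: product_prob_space "\<lambda>(t, i :: nat). D t" I for I
  proof (rule product_prob_spaceI)
    show "prob_space (case p of (t, i :: nat) \<Rightarrow> D t)" for p by (cases p) (simp add: prob_D)
  qed
  have Fm: "?F \<in> borel_measurable (PU \<Otimes>\<^sub>M PX)"
    using cvar_emp_measurable[OF t] C_play_measurable[OF t] unfolding P_eq by simp
  have Fb: "\<bar>?F (u, \<xi>)\<bar> \<le> 2 * U" if "u \<in> space PU" "\<xi> \<in> space PX" for u \<xi>
    using cvar_emp_bounded[OF t, of "(u, \<xi>)"] C_bounded[OF play_in_X_P[OF t, of "(u, \<xi>)"], of t] that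
    by (simp add: space_P)
  note fub = finite_measure_Fubini[OF PU.finite_measure_axioms PX.finite_measure_axioms Fm Fb]
  have inner: "(\<integral>\<xi>. ?F (u, \<xi>) \<partial>PX) \<le> ?B" if u: "u \<in> space PU" for u
  proof (rule pX.integral_block_le[where A = ?A and K = "2 * U"])
    show "finite S" "?A \<subseteq> S" using t by auto
    show "(\<lambda>\<xi>. ?F (u, \<xi>)) \<in> borel_measurable PX"
      using measurable_compose[OF measurable_Pair1'[OF u] Fm] by simp
    show "\<bar>?F (u, \<xi>)\<bar> \<le> 2 * U" if "\<xi> \<in> space PX" for \<xi> by (rule Fb[OF u that])
    fix x assume x: "x \<in> space (Pi\<^sub>M (S - ?A) (\<lambda>(t, i). D t))"
    \<comment> \<open>The value \<open>undefined\<close> is a stand-in for the samples of round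
      \<open>t\<close>; since the iterate does not read them, it equals one fixed point
      \<open>w\<close> throughout the inner integral.\<close>
    have "iter u (merge (S - ?A) ?A (x, y)) t = iter u (merge (S - ?A) ?A (x, \<lambda>_. undefined)) t" for y
      by (intro iter_cong) (auto simp: merge_def)
    then obtain w where it: "\<And>y. iter u (merge (S - ?A) ?A (x, y)) t = w" by blast
    let ?x0 = "w + \<delta> *\<^sub>R u t"
    have x0: "?x0 \<in> X"
      using play_in_X[where u = u and t = t and \<xi> = "merge (S - ?A) ?A (x, \<lambda>_. undefined)", OF space_PU[OF u t]]
      unfolding it .
    have emp: "emp_cdf f (n t) (\<lambda>i. merge (S - ?A) ?A (x, y) (t, i)) = emp_cdf f (n t) (\<lambda>i. y (t, i))" for f y
      by (intro emp_cdf_cong) (auto simp: merge_def)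
    have "(\<integral>y. ?F (u, merge (S - ?A) ?A (x, y)) \<partial>Pi\<^sub>M ?A (\<lambda>(t, i). D t))
      = (\<integral>y. \<bar>CVaR \<alpha> (emp_cdf (J ?x0) (n t) (\<lambda>i. y (t, i))) - cvar_of \<alpha> (D t) (J ?x0)\<bar> \<partial>Pi\<^sub>M ?A (\<lambda>(t, i). D t))"
      unfolding fst_conv snd_conv it emp cvar_cost_eq_cvar_of ..
    also have "\<dots> \<le> ?B"
      using n_pos t x0 by (intro pX.expectation_emp_CVaR_deviation \<alpha> J_measurable)
        (auto simp: inj_on_def space_D J_bounded)
    finally show "(\<integral>y. ?F (u, merge (S - ?A) ?A (x, y)) \<partial>Pi\<^sub>M ?A (\<lambda>(t, i). D t)) \<le> ?B" .
  qed
  have "(\<integral>\<omega>. ?F \<omega> \<partial>P) = (\<integral>u. \<integral>\<xi>. ?F (u, \<xi>) \<partial>PX \<partial>PU)"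
    unfolding P_eq by (rule fub(2))
  also have "\<dots> \<le> ?B"
    by (intro PU.bounded_integral_le fub(4) inner)
  finally show ?thesis .
qed

text \<open>Here the samples are fixed first and the direction of round \<open>t\<close> is
  integrated next. The exact cost appears instead of its empirical version, so that given the past
  the direction is the only randomness left. Everything stays under one integral because the iterate
  is random.\<close>

lemma expectation_gradient_le:
  assumes t: "t \<in> {1..T}" and y: "y \<in> shrunk X r \<delta>"
  shows "(\<integral>\<omega>. real CARD('d) / \<delta> * C t (play (fst \<omega>) (snd \<omega>) t) * (fst \<omega> t \<bullet> (y - iter (fst \<omega>) (snd \<omega>) t))
      - (C t y - C t (iter (fst \<omega>) (snd \<omega>) t) + 2 * L\<^sub>0 * \<delta> - m / 2 * (norm (y - iter (fst \<omega>) (snd \<omega>) t))\<^sup>2) \<partial>P) \<le> 0"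
proof -
  let ?g = "\<lambda>x u. real CARD('d) / \<delta> * C t (x + \<delta> *\<^sub>R u) * (u \<bullet> (y - x))
    - (C t y - C t x + 2 * L\<^sub>0 * \<delta> - m / 2 * (norm (y - x))\<^sup>2)"
  let ?F = "\<lambda>\<omega>. ?g (iter (fst \<omega>) (snd \<omega>) t) (fst \<omega> t)"
  let ?K = "real CARD('d) / \<delta> * U * Dx + (2 * U + 2 * L\<^sub>0 * \<delta> + m / 2 * Dx\<^sup>2)"
  interpret PU: prob_space PU by (rule prob_PU)
  interpret PX: prob_space PX by (rule prob_PX)
  interpret \<sigma>: prob_space "uniform_sphere :: (real^'d) measure" by (rule prob_space_uniform_sphere)
  interpret pU: product_prob_space "\<lambda>_::nat. uniform_sphere :: (real^'d) measure" I for I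
    by unfold_locales
  have yX: "y \<in> X" using y shrunk_subset by auto
  have arith: "\<bar>A - (c - c' + 2 * l - k)\<bar> \<le> B + (2 * V + 2 * l + k')"
    if "\<bar>A\<bar> \<le> B" "\<bar>c\<bar> \<le> V" "\<bar>c'\<bar> \<le> V" "0 \<le> l" "0 \<le> k" "k \<le> k'" for A B c c' l k k' V :: real
    using that by linarith
  have gb: "\<bar>?g x u\<bar> \<le> ?K" if x: "x \<in> X" "x + \<delta> *\<^sub>R u \<in> X" and u: "norm u = 1" for x u
  proof -
    have "\<bar>u \<bullet> (y - x)\<bar> \<le> Dx"
      using Cauchy_Schwarz_ineq2[of u "y - x"] norm_diff_X[OF yX x(1)] u by simp
    then have CuD: "\<bar>C t (x + \<delta> *\<^sub>R u) * (u \<bullet> (y - x))\<bar> \<le> U * Dx"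
      unfolding abs_mult using C_bounded[OF x(2)] U_pos by (intro mult_mono) auto
    have c: "0 \<le> real CARD('d) / \<delta>" using \<delta> by simp
    have "\<bar>real CARD('d) / \<delta> * (C t (x + \<delta> *\<^sub>R u) * (u \<bullet> (y - x)))\<bar> \<le> real CARD('d) / \<delta> * (U * Dx)"
      unfolding abs_mult[of "real CARD('d) / \<delta>"] abs_of_nonneg[OF c] by (rule mult_left_mono[OF CuD c])
    moreover have "m / 2 * (norm (y - x))\<^sup>2 \<le> m / 2 * Dx\<^sup>2"
      using norm_diff_X[OF yX x(1)] m_pos by (intro mult_left_mono power_mono) auto
    moreover have "0 \<le> m / 2 * (norm (y - x))\<^sup>2" "0 \<le> L\<^sub>0 * \<delta>" using m_pos L0_pos \<delta> by auto
    ultimately show ?thesis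
      unfolding mult.assoc by (intro arith C_bounded yX x(1))
  qed
  have Fm: "?F \<in> borel_measurable (PU \<Otimes>\<^sub>M PX)"
    using C_play_measurable[OF t] C_iter_measurable[OF t] u_measurable_P[OF t] iter_measurable[of t] t
    unfolding P_eq by simp
  have Fb: "\<bar>?F (u, \<xi>)\<bar> \<le> ?K" if "u \<in> space PU" "\<xi> \<in> space PX" for u \<xi>
    unfolding fst_conv snd_conv using play_in_X space_PU[OF that(1) t] iter_in_X by (intro gb) auto
  note fub = finite_measure_Fubini[OF PU.finite_measure_axioms PX.finite_measure_axioms Fm Fb]
  have inner: "(\<integral>u. ?F (u, \<xi>) \<partial>PU) \<le> 0" if \<xi>: "\<xi> \<in> space PX" for \<xi>
  proof (rule pU.integral_block_le[where A = "{t}" and K = ?K])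
    show "finite {1..T}" "{t} \<subseteq> {1..T}" using t by auto
    show "(\<lambda>u. ?F (u, \<xi>)) \<in> borel_measurable PU"
      using measurable_compose[OF measurable_Pair2'[OF \<xi>] Fm] by simp
    show "\<bar>?F (u, \<xi>)\<bar> \<le> ?K" if "u \<in> space PU" for u by (rule Fb[OF that \<xi>])
    fix x :: "nat \<Rightarrow> real^'d"
    have "iter (merge ({1..T} - {t}) {t} (x, v)) \<xi> t = iter (merge ({1..T} - {t}) {t} (x, \<lambda>_. undefined)) \<xi> t" for v
      by (intro iter_cong) (auto simp: merge_def)
    then obtain x0 where it: "\<And>v. iter (merge ({1..T} - {t}) {t} (x, v)) \<xi> t = x0" by blast
    have mt: "merge ({1..T} - {t}) {t} (x, v) t = v t" for v :: "nat \<Rightarrow> real^'d"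
      by (simp add: merge_def)
    have x0: "x0 \<in> shrunk X r \<delta>" and x0X: "x0 \<in> X"
      using iter_in_shrunk[of "merge ({1..T} - {t}) {t} (x, \<lambda>_. undefined)" \<xi> t]
        iter_in_X[of "merge ({1..T} - {t}) {t} (x, \<lambda>_. undefined)" \<xi> t] unfolding it .
    note idm = measurable_ident_uniform_sphere[where 'a = "real^'d"]
    have p0: "x0 + \<delta> *\<^sub>R u \<in> X" if "u \<in> space (uniform_sphere :: (real^'d) measure)" for u
      using that by (intro shrunk_add_in_X[OF x0]) (simp add: space_uniform_sphere)
    have Cm: "(\<lambda>u. C t (x0 + \<delta> *\<^sub>R u)) \<in> borel_measurable (uniform_sphere :: (real^'d) measure)"
      using idm p0 by (intro C_measurable) auto
    have i1: "integrable uniform_sphere (\<lambda>u. C t (x0 + \<delta> *\<^sub>R u) * (u \<bullet> (y - x0)))"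
    proof (rule \<sigma>.bounded_integrable[where B = "U * Dx"])
      show "(\<lambda>u. C t (x0 + \<delta> *\<^sub>R u) * (u \<bullet> (y - x0))) \<in> borel_measurable uniform_sphere"
        using Cm idm by simp
      fix u :: "real^'d" assume u: "u \<in> space uniform_sphere"
      have "\<bar>u \<bullet> (y - x0)\<bar> \<le> Dx"
        using Cauchy_Schwarz_ineq2[of u "y - x0"] norm_diff_X[OF yX x0X] u by (simp add: space_uniform_sphere)
      then show "\<bar>C t (x0 + \<delta> *\<^sub>R u) * (u \<bullet> (y - x0))\<bar> \<le> U * Dx"
        unfolding abs_mult using C_bounded[OF p0[OF u]] U_pos by (intro mult_mono) auto
    qed
    have gm: "?g x0 \<in> borel_measurable (uniform_sphere :: (real^'d) measure)"
      using Cm idm by simp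
    have "(\<integral>v. ?F (merge ({1..T} - {t}) {t} (x, v), \<xi>) \<partial>(\<Pi>\<^sub>M t\<in>{t}. uniform_sphere))
      = (\<integral>v. ?g x0 (v t) \<partial>(\<Pi>\<^sub>M t\<in>{t}. uniform_sphere))"
      unfolding fst_conv snd_conv it mt ..
    also have "\<dots> = (\<integral>u. ?g x0 u \<partial>uniform_sphere)"
      by (rule pU.product_integral_singleton[OF gm])
    also have "\<dots> = real CARD('d) / \<delta> * (\<integral>u. C t (x0 + \<delta> *\<^sub>R u) * (u \<bullet> (y - x0)) \<partial>uniform_sphere)
      - (C t y - C t x0 + 2 * L\<^sub>0 * \<delta> - m / 2 * (norm (y - x0))\<^sup>2)"
      unfolding mult.assoc
      by (subst Bochner_Integration.integral_diff) (use i1 in \<open>simp_all add: \<sigma>.prob_space\<close>)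
    also have "\<dots> \<le> 0" using sphere_gradient_le[OF x0 y, of t] by simp
    finally show "(\<integral>v. ?F (merge ({1..T} - {t}) {t} (x, v), \<xi>) \<partial>(\<Pi>\<^sub>M t\<in>{t}. uniform_sphere)) \<le> 0" .
  qed
  have "(\<integral>\<omega>. ?F \<omega> \<partial>P) = (\<integral>\<xi>. \<integral>u. ?F (u, \<xi>) \<partial>PU \<partial>PX)"
    unfolding P_eq using fub(1,2) by simp
  also have "\<dots> \<le> 0"
    by (intro PX.bounded_integral_le fub(5) inner)
  finally show ?thesis .
qed

end

section \<open>Expected regret\<close>

lemma sum_blocks:
  fixes g :: "nat \<Rightarrow> 'a::comm_monoid_add"
  shows "(\<Sum>t=1..N * \<Delta>. g t) = (\<Sum>b<N. \<Sum>\<tau>=1..\<Delta>. g (b * \<Delta> + \<tau>))"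
proof (induction N)
  case (Suc N)
  have "(\<Sum>t=1..Suc N * \<Delta>. g t) = (\<Sum>t=1..N * \<Delta> + \<Delta>. g t)" by (simp add: add.commute)
  also have "\<dots> = (\<Sum>t=1..N * \<Delta>. g t) + (\<Sum>t=N * \<Delta> + 1..N * \<Delta> + \<Delta>. g t)"
    by (rule sum.ub_add_nat) simp
  also have "(\<Sum>t=N * \<Delta> + 1..N * \<Delta> + \<Delta>. g t) = (\<Sum>\<tau>=1..\<Delta>. g (N * \<Delta> + \<tau>))"
    using sum.shift_bounds_cl_nat_ivl[of g 1 "N * \<Delta>" \<Delta>] by (simp add: add.commute)
  finally show ?case using Suc by simp
qed simp

text \<open>The coefficient of \<open>A \<tau>\<close> is \<tau> - (\<tau> - 1) - 1 = 0. For steps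
  1/(m \<tau>) this says that the strong convexity term absorbs even the distance at the start of a
  batch.\<close>

lemma sum_weighted_telescope:
  fixes A :: "nat \<Rightarrow> real"
  shows "(\<Sum>\<tau>=1..k. real \<tau> * (A \<tau> - A (\<tau> + 1)) - A \<tau>) = - real k * A (k + 1)"
  by (induction k) (auto simp: algebra_simps)

context risk_averse_cost
begin

lemma C_drift_sum:
  assumes K: "0 < K" and x: "x \<in> X" and W: "\<And>s. s \<in> {2..T} \<Longrightarrow> wasserstein1 K \<Xi> (D (s - 1)) (D s) \<le> ereal (W s)"
    and t: "1 \<le> t\<^sub>0" "t\<^sub>0 + k \<le> T"
  shows "\<bar>C t\<^sub>0 x - C (t\<^sub>0 + k) x\<bar> \<le> L\<^sub>\<xi> / \<alpha> * (\<Sum>s=1..k. W (t\<^sub>0 + s))"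
  using t
proof (induction k)
  case (Suc k)
  have "\<bar>C (t\<^sub>0 + k) x - C (t\<^sub>0 + Suc k) x\<bar> \<le> L\<^sub>\<xi> / \<alpha> * W (t\<^sub>0 + Suc k)"
    using W[of "t\<^sub>0 + Suc k"] Suc.prems by (intro C_drift[OF x K]) auto
  then show ?case using Suc by (simp add: distrib_left)
qed simp

end

context shrunk_domain
begin

text \<open>The drift enters twice: at the batch comparator, from \<open>t\<close> back to
  \<open>t\<^sub>0\<close>, and at the current minimiser, from \<open>t\<^sub>0\<close> to
  \<open>t\<close>. Shrinking moves the comparator by \<delta>/r times its norm, which is at most
  \<open>Dx\<close> because 0 lies in \<open>X\<close>.\<close>

lemma comparator_gap:
  assumes drift: "\<And>x. x \<in> X \<Longrightarrow> \<bar>C t\<^sub>0 x - C t x\<bar> \<le> V"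
  shows "C t ((1 - \<delta> / r) *\<^sub>R arg_min_on (C t\<^sub>0) X) - C t (arg_min_on (C t) X) \<le> L\<^sub>0 * Dx / r * \<delta> + 2 * V"
proof -
  let ?x = "arg_min_on (C t\<^sub>0) X" and ?z = "arg_min_on (C t) X"
  have x: "?x \<in> X" and z: "?z \<in> X" by (rule C_argmin)+
  have y: "(1 - \<delta> / r) *\<^sub>R ?x \<in> X" using scale_in_shrunk[OF x] shrunk_subset by auto
  have "(1 - \<delta> / r) *\<^sub>R ?x - ?x = (- (\<delta> / r)) *\<^sub>R ?x" by (simp add: algebra_simps)
  then have "norm ((1 - \<delta> / r) *\<^sub>R ?x - ?x) = \<delta> / r * norm ?x"
    using \<delta> r_pos by simp
  also have "\<dots> \<le> \<delta> / r * Dx"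
    using norm_diff_X[OF x zero_in_X] \<delta> r_pos by (intro mult_left_mono) auto
  finally have "L\<^sub>0 * norm ((1 - \<delta> / r) *\<^sub>R ?x - ?x) \<le> L\<^sub>0 * (\<delta> / r * Dx)"
    using L0_pos by (intro mult_left_mono) auto
  also have "\<dots> = L\<^sub>0 * Dx / r * \<delta>" by simp
  finally have "C t ((1 - \<delta> / r) *\<^sub>R ?x) \<le> C t ?x + L\<^sub>0 * Dx / r * \<delta>"
    using C_Lipschitz[OF y x, of t] by linarith
  moreover have "C t ?x \<le> C t\<^sub>0 ?x + V" using drift[OF x] by linarith
  moreover have "C t\<^sub>0 ?x \<le> C t\<^sub>0 ?z" by (rule C_argmin(2)[OF z])
  moreover have "C t\<^sub>0 ?z \<le> C t ?z + V" using drift[OF z] by linarith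
  ultimately show ?thesis by linarith
qed

end

context regret_setting
begin

text \<open>The usual distance recursion of projected gradient descent. The estimate is split into
  its version with the exact cost, controlled by the sphere inequality, and the sampling error,
  controlled in mean. Dividing by twice the step produces the weight m \<tau>/2 in front of the
  distances.\<close>

lemma expected_step:
  assumes t: "t \<in> {1..T}" and y: "y \<in> shrunk X r \<delta>"
  defines "A \<equiv> \<lambda>s. \<integral>\<omega>. (norm (y - iter (fst \<omega>) (snd \<omega>) s))\<^sup>2 \<partial>P"
  shows "(\<integral>\<omega>. C t (iter (fst \<omega>) (snd \<omega>) t) \<partial>P) - C t y
    \<le> m / 2 * (real (epoch \<Delta> t) * (A t - A (t + 1)) - A t)
      + (real CARD('d) * U / \<delta>)\<^sup>2 / (2 * m) / epoch \<Delta> t + 2 * L\<^sub>0 * \<delta>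
      + 2 * real CARD('d) * Dx * U / (\<alpha> * \<delta>) / sqrt (n t)"
proof -
  note iterate.simps(2)[simp del]
  interpret P: prob_space P by (rule prob_P)
  let ?x = "\<lambda>\<omega>. iter (fst \<omega>) (snd \<omega>) t" and ?x' = "\<lambda>\<omega>. iter (fst \<omega>) (snd \<omega>) (t + 1)"
  let ?d = "real CARD('d) / \<delta>"
  let ?G = "real CARD('d) * U / \<delta>"
  let ?gC = "\<lambda>\<omega>. ?d * C t (play (fst \<omega>) (snd \<omega>) t) * (fst \<omega> t \<bullet> (y - ?x \<omega>))"
  let ?e = "\<lambda>\<omega>. \<bar>cvar_emp (fst \<omega>) (snd \<omega>) t - C t (play (fst \<omega>) (snd \<omega>) t)\<bar>"
  let ?N = "\<lambda>\<omega>. (norm (y - ?x \<omega>))\<^sup>2" and ?N' = "\<lambda>\<omega>. (norm (y - ?x' \<omega>))\<^sup>2"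
  let ?\<eta> = "\<eta> t"
  have \<tau>: "0 < real (epoch \<Delta> t)" using epoch_pos t by simp
  have \<eta>: "0 < ?\<eta>" using \<tau> m_pos by simp
  have d0: "0 \<le> ?d" using \<delta> by simp
  have yX: "y \<in> X" using y shrunk_subset by auto
  have inner: "\<bar>fst \<omega> t \<bullet> (y - ?x \<omega>)\<bar> \<le> Dx" if "\<omega> \<in> space P" for \<omega>
    using Cauchy_Schwarz_ineq2[of "fst \<omega> t" "y - ?x \<omega>"] norm_diff_X[OF yX iter_in_X, of "fst \<omega>" "snd \<omega>" t]
      space_PU[of "fst \<omega>" t] that t by (simp add: space_P)
  have im: "?x \<in> borel_measurable P" "?x' \<in> borel_measurable P"
    by (rule iter_measurable; use t in simp)+
  have um: "(\<lambda>\<omega>. fst \<omega> t) \<in> borel_measurable P" by (rule u_measurable_P[OF t])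
  have iN: "integrable P ?N" "integrable P ?N'"
    using im norm_diff_X[OF yX iter_in_X] by (auto intro!: P.bounded_integrable[where B = "Dx\<^sup>2"] power_mono)
  have ic: "integrable P (\<lambda>\<omega>. C t (?x \<omega>))"
    by (rule P.bounded_integrable[OF C_iter_measurable[OF t] C_bounded[OF iter_in_X]])
  have ie: "integrable P ?e"
  proof (rule P.bounded_integrable[where B = "2 * U"])
    show "?e \<in> borel_measurable P" using cvar_emp_measurable[OF t] C_play_measurable[OF t] by simp
    show "\<bar>?e \<omega>\<bar> \<le> 2 * U" if "\<omega> \<in> space P" for \<omega>
      using cvar_emp_bounded[OF t that] C_bounded[OF play_in_X_P[OF t that], of t] by linarith
  qed
  have igC: "integrable P ?gC"
  proof -
    have "integrable P (\<lambda>\<omega>. C t (play (fst \<omega>) (snd \<omega>) t) * (fst \<omega> t \<bullet> (y - ?x \<omega>)))"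
    proof (rule P.bounded_integrable[where B = "U * Dx"])
      show "(\<lambda>\<omega>. C t (play (fst \<omega>) (snd \<omega>) t) * (fst \<omega> t \<bullet> (y - ?x \<omega>))) \<in> borel_measurable P"
        using C_play_measurable[OF t] um im by simp
      show "\<bar>C t (play (fst \<omega>) (snd \<omega>) t) * (fst \<omega> t \<bullet> (y - ?x \<omega>))\<bar> \<le> U * Dx" if "\<omega> \<in> space P" for \<omega>
        unfolding abs_mult using C_bounded[OF play_in_X_P[OF t that], of t] inner[OF that] U_pos
        by (intro mult_mono) auto
    qed
    then show ?thesis unfolding mult.assoc by (rule integrable_mult_right)
  qed
  \<comment> \<open>The projection is nonexpansive and fixes \<open>y\<close>. The norm of the
    estimate is at most \<open>?G\<close>, since an empirical CVaR of costs bounded by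
    \<open>U\<close> is bounded by \<open>U\<close>.\<close>
  have step: "?N' \<omega> \<le> ?N \<omega> + 2 * ?\<eta> * (?gC \<omega> + ?d * Dx * ?e \<omega>) + ?\<eta>\<^sup>2 * ?G\<^sup>2" if \<omega>: "\<omega> \<in> space P" for \<omega>
  proof -
    let ?g = "grad (fst \<omega>) (snd \<omega>) t"
    have "?x' \<omega> = closest_point (shrunk X r \<delta>) (?x \<omega> - ?\<eta> *\<^sub>R ?g)" using t by (simp add: iterate.simps(2))
    then have "norm (y - ?x' \<omega>) \<le> norm (y - (?x \<omega> - ?\<eta> *\<^sub>R ?g))"
      using closest_point_lipschitz[OF shrunk_convex shrunk_closed shrunk_nonempty, of y "?x \<omega> - ?\<eta> *\<^sub>R ?g"]
      by (simp add: closest_point_self[OF y] dist_norm)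
    then have "?N' \<omega> \<le> (norm ((y - ?x \<omega>) + ?\<eta> *\<^sub>R ?g))\<^sup>2"
      by (intro power_mono) (auto simp: algebra_simps)
    also have "\<dots> = ?N \<omega> + 2 * ?\<eta> * (?g \<bullet> (y - ?x \<omega>)) + ?\<eta>\<^sup>2 * (norm ?g)\<^sup>2"
      unfolding power2_norm_eq_inner by (simp add: inner_add_left inner_add_right inner_commute power2_eq_square)
    also have "\<dots> \<le> ?N \<omega> + 2 * ?\<eta> * (?gC \<omega> + ?d * Dx * ?e \<omega>) + ?\<eta>\<^sup>2 * ?G\<^sup>2"
    proof (intro add_mono mult_left_mono order_refl power_mono)
      let ?i = "fst \<omega> t \<bullet> (y - ?x \<omega>)" and ?c = "C t (play (fst \<omega>) (snd \<omega>) t)"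
      let ?ce = "cvar_emp (fst \<omega>) (snd \<omega>) t"
      have "(?ce - ?c) * ?i \<le> ?e \<omega> * Dx"
        using mult_mono[OF order_refl inner[OF \<omega>], of "?e \<omega>"] abs_ge_self[of "(?ce - ?c) * ?i"]
        by (simp add: abs_mult Dx_nonneg)
      then have "?d * ((?ce - ?c) * ?i) \<le> ?d * (?e \<omega> * Dx)" by (rule mult_left_mono[OF _ d0])
      show "?g \<bullet> (y - ?x \<omega>) \<le> ?gC \<omega> + ?d * Dx * ?e \<omega>"
      proof -
        have split: "p * (ce * i) = p * c * i + p * ((ce - c) * i)" for p ce c i :: real
          by (simp add: algebra_simps)
        have "?g \<bullet> (y - ?x \<omega>) = ?d * (?ce * ?i)"
          unfolding grad_eq by (simp only: inner_scaleR_left mult.assoc)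
        then show ?thesis
          using \<open>?d * ((?ce - ?c) * ?i) \<le> ?d * (?e \<omega> * Dx)\<close> split[of ?d ?ce ?i ?c]
          by (simp only: mult.assoc mult.commute[of Dx])
      qed
      have "norm (fst \<omega> t) = 1" using \<omega> t by (intro space_PU) (auto simp: space_P)
      then have "norm ?g = ?d * \<bar>?ce\<bar>" unfolding grad_eq using \<delta> by (simp add: abs_mult)
      also have "\<dots> \<le> ?d * U" by (intro mult_left_mono d0 cvar_emp_bounded t \<omega>)
      finally show "norm ?g \<le> ?G" by simp
    qed (use \<eta> in auto)
    finally show ?thesis .
  qed
  have "A (t + 1) \<le> (\<integral>\<omega>. ?N \<omega> + 2 * ?\<eta> * (?gC \<omega> + ?d * Dx * ?e \<omega>) + ?\<eta>\<^sup>2 * ?G\<^sup>2 \<partial>P)"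
    unfolding A_def
    by (intro integral_mono step iN Bochner_Integration.integrable_add integrable_mult_right igC ie P.integrable_const)
  also have "\<dots> = A t + 2 * ?\<eta> * ((\<integral>\<omega>. ?gC \<omega> \<partial>P) + ?d * Dx * (\<integral>\<omega>. ?e \<omega> \<partial>P)) + ?\<eta>\<^sup>2 * ?G\<^sup>2"
  proof -
    have "(\<integral>\<omega>. ?gC \<omega> + ?d * Dx * ?e \<omega> \<partial>P) = (\<integral>\<omega>. ?gC \<omega> \<partial>P) + ?d * Dx * (\<integral>\<omega>. ?e \<omega> \<partial>P)"
      by (subst Bochner_Integration.integral_add[OF igC integrable_mult_right[OF ie]]) (simp only: integral_mult_right_zero)
    moreover have i2: "integrable P (\<lambda>\<omega>. 2 * ?\<eta> * (?gC \<omega> + ?d * Dx * ?e \<omega>))"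
      by (intro Bochner_Integration.integrable_add integrable_mult_right igC ie)
    have "(\<integral>\<omega>. ?N \<omega> + 2 * ?\<eta> * (?gC \<omega> + ?d * Dx * ?e \<omega>) + ?\<eta>\<^sup>2 * ?G\<^sup>2 \<partial>P)
      = (\<integral>\<omega>. ?N \<omega> \<partial>P) + (\<integral>\<omega>. 2 * ?\<eta> * (?gC \<omega> + ?d * Dx * ?e \<omega>) \<partial>P) + (\<integral>\<omega>. ?\<eta>\<^sup>2 * ?G\<^sup>2 \<partial>P)"
      by (simp only: Bochner_Integration.integral_add[OF Bochner_Integration.integrable_add[OF iN(1) i2] P.integrable_const]
          Bochner_Integration.integral_add[OF iN(1) i2])
    moreover have "(\<integral>\<omega>. ?\<eta>\<^sup>2 * ?G\<^sup>2 \<partial>P) = ?\<eta>\<^sup>2 * ?G\<^sup>2"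
      by (simp only: lebesgue_integral_const P.prob_space) simp
    ultimately show ?thesis
      unfolding A_def by (simp only: integral_mult_right_zero)
  qed
  finally have main: "A (t + 1) \<le> A t + 2 * ?\<eta> * ((\<integral>\<omega>. ?gC \<omega> \<partial>P) + ?d * Dx * (\<integral>\<omega>. ?e \<omega> \<partial>P)) + ?\<eta>\<^sup>2 * ?G\<^sup>2" .
  have "(\<integral>\<omega>. ?gC \<omega> \<partial>P) - (C t y - (\<integral>\<omega>. C t (?x \<omega>) \<partial>P) + 2 * L\<^sub>0 * \<delta> - m / 2 * A t)
    = (\<integral>\<omega>. ?gC \<omega> - (C t y - C t (?x \<omega>) + 2 * L\<^sub>0 * \<delta> - m / 2 * ?N \<omega>) \<partial>P)"
    unfolding A_def using igC ic iN(1) by (simp add: P.prob_space)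
  also have "\<dots> \<le> 0" by (rule expectation_gradient_le[OF t y])
  finally have 1: "(\<integral>\<omega>. ?gC \<omega> \<partial>P) \<le> C t y - (\<integral>\<omega>. C t (?x \<omega>) \<partial>P) + 2 * L\<^sub>0 * \<delta> - m / 2 * A t" by simp
  have "?d * Dx * (\<integral>\<omega>. ?e \<omega> \<partial>P) \<le> ?d * Dx * (2 * U / (\<alpha> * sqrt (n t)))"
    by (intro mult_left_mono mult_nonneg_nonneg d0 Dx_nonneg expectation_noise_error t)
  also have "\<dots> = 2 * real CARD('d) * Dx * U / (\<alpha> * \<delta>) / sqrt (n t)" (is "_ = ?E") by (simp add: mult_ac)
  finally have "A (t + 1) \<le> A t + 2 * ?\<eta> * (C t y - (\<integral>\<omega>. C t (?x \<omega>) \<partial>P) + 2 * L\<^sub>0 * \<delta> - m / 2 * A t + ?E) + ?\<eta>\<^sup>2 * ?G\<^sup>2"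
    using main 1 \<eta> by (smt (verit) mult_left_mono)
  then have "(A (t + 1) - A t) / (2 * ?\<eta>) \<le> C t y - (\<integral>\<omega>. C t (?x \<omega>) \<partial>P) + 2 * L\<^sub>0 * \<delta> - m / 2 * A t + ?E + ?\<eta> * ?G\<^sup>2 / 2"
    using \<eta> by (subst pos_divide_le_eq) (auto simp: algebra_simps power2_eq_square)
  moreover have "(A (t + 1) - A t) / (2 * ?\<eta>) = - (m / 2 * (real (epoch \<Delta> t) * (A t - A (t + 1))))"
    using m_pos \<tau> by (simp add: field_simps)
  moreover have "?\<eta> * ?G\<^sup>2 / 2 = ?G\<^sup>2 / (2 * m) / epoch \<Delta> t" by simp
  moreover have "m / 2 * (real (epoch \<Delta> t) * (A t - A (t + 1)) - A t) = m / 2 * (real (epoch \<Delta> t) * (A t - A (t + 1))) - m / 2 * A t"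
    by (rule right_diff_distrib)
  ultimately show ?thesis by linarith
qed

lemma expected_play_le:
  assumes t: "t \<in> {1..T}"
  shows "(\<integral>\<omega>. C t (play (fst \<omega>) (snd \<omega>) t) \<partial>P) \<le> (\<integral>\<omega>. C t (iter (fst \<omega>) (snd \<omega>) t) \<partial>P) + L\<^sub>0 * \<delta>"
proof -
  interpret P: prob_space P by (rule prob_P)
  have ip: "integrable P (\<lambda>\<omega>. C t (play (fst \<omega>) (snd \<omega>) t))"
    by (rule P.bounded_integrable[OF C_play_measurable[OF t] C_bounded[OF play_in_X_P[OF t]]])
  have ic: "integrable P (\<lambda>\<omega>. C t (iter (fst \<omega>) (snd \<omega>) t))"
    by (rule P.bounded_integrable[OF C_iter_measurable[OF t] C_bounded[OF iter_in_X]])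
  have "(\<integral>\<omega>. C t (play (fst \<omega>) (snd \<omega>) t) \<partial>P) \<le> (\<integral>\<omega>. C t (iter (fst \<omega>) (snd \<omega>) t) + L\<^sub>0 * \<delta> \<partial>P)"
  proof (rule integral_mono[OF ip Bochner_Integration.integrable_add[OF ic P.integrable_const]])
    fix \<omega> assume \<omega>: "\<omega> \<in> space P"
    have "norm (fst \<omega> t) = 1" using \<omega> t by (intro space_PU) (auto simp: space_P)
    then have "norm (play (fst \<omega>) (snd \<omega>) t - iter (fst \<omega>) (snd \<omega>) t) = \<delta>" using \<delta> by simp
    then show "C t (play (fst \<omega>) (snd \<omega>) t) \<le> C t (iter (fst \<omega>) (snd \<omega>) t) + L\<^sub>0 * \<delta>"
      using C_Lipschitz[OF play_in_X_P[OF t \<omega>] iter_in_X, of t "fst \<omega>" "snd \<omega>" t] by simp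
  qed
  then show ?thesis using ic by (simp add: P.prob_space)
qed

abbreviation gap :: "nat \<Rightarrow> real" where
  "gap t \<equiv> (\<integral>\<omega>. C t (play (fst \<omega>) (snd \<omega>) t) \<partial>P) - C t (arg_min_on (C t) X)"

text \<open>The part of the one-step bound that depends on the epoch and therefore recurs in every
  batch: gradient variance and sampling error.\<close>

definition step_cost :: "nat \<Rightarrow> real" where
  "step_cost \<tau> = (real CARD('d) * U / \<delta>)\<^sup>2 / (2 * m) / real \<tau> + 2 * real CARD('d) * Dx * U / (\<alpha> * \<delta>) / sqrt (real (\<phi> \<tau>))"

lemma step_cost_nonneg: "0 \<le> step_cost \<tau>"
  using m_pos \<alpha> \<delta> U_pos Dx_nonneg by (simp add: step_cost_def)

text \<open>The length \<open>k\<close> may be smaller than \<open>\<Delta>\<close> to cover the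
  last batch. The factor 3 collects two units of smoothing bias and one for playing the perturbed
  point; \<open>L\<^sub>0 * Dx / r\<close> is the cost of shrinking the comparator.\<close>

lemma batch_gap:
  assumes K: "0 < K" and W: "\<And>s. s \<in> {2..T} \<Longrightarrow> wasserstein1 K \<Xi> (D (s - 1)) (D s) \<le> ereal (W s)"
    and W0: "\<And>s. 0 \<le> W s" and k: "k \<le> \<Delta>" "b * \<Delta> + k \<le> T"
  shows "(\<Sum>\<tau>=1..k. gap (b * \<Delta> + \<tau>) - (3 * L\<^sub>0 + L\<^sub>0 * Dx / r) * \<delta>)
    \<le> (\<Sum>\<tau>=1..\<Delta>. step_cost \<tau>) + real \<Delta> * (2 * L\<^sub>\<xi> / \<alpha> * (\<Sum>s=1..\<Delta>. W (b * \<Delta> + s)))"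
proof -
  let ?init = "b * \<Delta> + 1"
  let ?V = "L\<^sub>\<xi> / \<alpha> * (\<Sum>s=1..\<Delta>. W (b * \<Delta> + s))"
  let ?y = "(1 - \<delta> / r) *\<^sub>R arg_min_on (C ?init) X"
  let ?A = "\<lambda>s. \<integral>\<omega>. (norm (?y - iter (fst \<omega>) (snd \<omega>) s))\<^sup>2 \<partial>P"
  have y: "?y \<in> shrunk X r \<delta>" by (rule scale_in_shrunk[OF C_argmin(1)])
  have V0: "0 \<le> ?V" using W0 L\<xi>_pos \<alpha> by (intro mult_nonneg_nonneg sum_nonneg divide_nonneg_nonneg) auto
  have one: "gap (b * \<Delta> + \<tau>) - (3 * L\<^sub>0 + L\<^sub>0 * Dx / r) * \<delta>
    \<le> m / 2 * (real \<tau> * (?A (b * \<Delta> + \<tau>) - ?A (b * \<Delta> + (\<tau> + 1))) - ?A (b * \<Delta> + \<tau>)) + step_cost \<tau> + 2 * ?V"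
    if \<tau>: "\<tau> \<in> {1..k}" for \<tau>
  proof -
    let ?t = "b * \<Delta> + \<tau>"
    have t: "?t \<in> {1..T}" using \<tau> k by auto
    have ep: "epoch \<Delta> ?t = \<tau>" using \<tau> k by (intro epoch_block) auto
    have "\<bar>C ?init x - C ?t x\<bar> \<le> ?V" if x: "x \<in> X" for x
    proof -
      have "\<bar>C ?init x - C (?init + (\<tau> - 1)) x\<bar> \<le> L\<^sub>\<xi> / \<alpha> * (\<Sum>s=1..\<tau> - 1. W (?init + s))"
      proof (rule C_drift_sum[OF K x W])
        show "?init + (\<tau> - 1) \<le> T" using \<tau> k by simp
      qed auto
      \<comment> \<open>Drift inside the batch starts with the second epoch. Enlarging the range to
        \<open>{1..\<Delta>}\<close> lets the ranges of consecutive batches tile the horizon, so the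
        total variation is later counted once.\<close>
      also have "(\<Sum>s=1..\<tau> - 1. W (?init + s)) = (\<Sum>s=2..\<tau>. W (b * \<Delta> + s))"
        by (rule sum.reindex_bij_witness[of _ "\<lambda>s. s - 1" "\<lambda>s. s + 1"]) auto
      also have "L\<^sub>\<xi> / \<alpha> * \<dots> \<le> ?V"
        using \<tau> k L\<xi>_pos \<alpha> W0 by (intro mult_left_mono sum_mono2) auto
      finally show ?thesis using \<tau> by simp
    qed
    then have "C ?t ?y - C ?t (arg_min_on (C ?t) X) \<le> L\<^sub>0 * Dx / r * \<delta> + 2 * ?V"
      by (rule comparator_gap)
    moreover have "(3 * L\<^sub>0 + L\<^sub>0 * Dx / r) * \<delta> = 2 * L\<^sub>0 * \<delta> + L\<^sub>0 * \<delta> + L\<^sub>0 * Dx / r * \<delta>"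
      by (simp add: algebra_simps)
    moreover have "(p - z) - kk \<le> M + (S1 + S2) + v"
      if "p \<le> i + l" "i - q \<le> M + S1 + l' + S2" "q - z \<le> c + v" "kk = l' + l + c"
      for p z kk M S1 S2 v i l q l' c :: real
      using that by linarith
    ultimately show ?thesis
      unfolding step_cost_def
      using expected_play_le[OF t] expected_step[OF t y, unfolded ep add.assoc[of "b * \<Delta>" \<tau> 1]] by blast
  qed
  have "(\<Sum>\<tau>=1..k. gap (b * \<Delta> + \<tau>) - (3 * L\<^sub>0 + L\<^sub>0 * Dx / r) * \<delta>)
    \<le> (\<Sum>\<tau>=1..k. m / 2 * (real \<tau> * (?A (b * \<Delta> + \<tau>) - ?A (b * \<Delta> + (\<tau> + 1))) - ?A (b * \<Delta> + \<tau>)) + step_cost \<tau> + 2 * ?V)"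
    by (rule sum_mono[OF one])
  also have "\<dots> = m / 2 * (\<Sum>\<tau>=1..k. real \<tau> * (?A (b * \<Delta> + \<tau>) - ?A (b * \<Delta> + (\<tau> + 1))) - ?A (b * \<Delta> + \<tau>))
      + (\<Sum>\<tau>=1..k. step_cost \<tau>) + real k * (2 * ?V)"
    by (simp only: sum.distrib sum_distrib_left[symmetric] sum_constant card_atLeastAtMost) simp
  also have "(\<Sum>\<tau>=1..k. real \<tau> * (?A (b * \<Delta> + \<tau>) - ?A (b * \<Delta> + (\<tau> + 1))) - ?A (b * \<Delta> + \<tau>)) = - real k * ?A (b * \<Delta> + (k + 1))"
    by (rule sum_weighted_telescope[of "\<lambda>\<tau>. ?A (b * \<Delta> + \<tau>)"])
  also have "m / 2 * (- real k * ?A (b * \<Delta> + (k + 1))) \<le> 0"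
  proof -
    have "0 \<le> ?A (b * \<Delta> + (k + 1))" by (intro integral_nonneg_AE AE_I2) simp
    then have "0 \<le> m / 2 * (real k * ?A (b * \<Delta> + (k + 1)))" using m_pos by (intro mult_nonneg_nonneg) auto
    then show ?thesis by linarith
  qed
  also have "(\<Sum>\<tau>=1..k. step_cost \<tau>) \<le> (\<Sum>\<tau>=1..\<Delta>. step_cost \<tau>)"
    using k step_cost_nonneg by (intro sum_mono2) auto
  also have "real k * (2 * ?V) \<le> real \<Delta> * (2 * ?V)"
    using k V0 by (intro mult_right_mono) auto
  finally show ?thesis by (simp add: mult.assoc)
qed

lemma sum_gap_le:
  assumes K: "0 < K" and W: "\<And>s. s \<in> {2..T} \<Longrightarrow> wasserstein1 K \<Xi> (D (s - 1)) (D s) \<le> ereal (W s)"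
    and W0: "\<And>s. s \<in> {2..T} \<Longrightarrow> 0 \<le> W s" and V: "(\<Sum>s=2..T. W s) \<le> V" and N: "T \<le> N * \<Delta>"
  shows "(\<Sum>t=1..T. gap t) \<le> real N * (\<Sum>\<tau>=1..\<Delta>. step_cost \<tau>)
    + real T * ((3 * L\<^sub>0 + L\<^sub>0 * Dx / r) * \<delta>) + real \<Delta> * (2 * L\<^sub>\<xi> / \<alpha> * V)"
proof -
  let ?\<kappa> = "(3 * L\<^sub>0 + L\<^sub>0 * Dx / r) * \<delta>"
  \<comment> \<open>Padding \<open>w\<close> and \<open>g\<close> with zeros turns the horizon into
    \<open>N\<close> complete batches, and makes the variation nonnegative at every index.\<close>
  define w where "w s = (if s \<in> {2..T} then W s else 0)" for s
  define g where "g t = (if t \<le> T then gap t - ?\<kappa> else 0)" for t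
  have "(\<Sum>t=1..T. gap t - ?\<kappa>) = (\<Sum>t=1..N * \<Delta>. g t)"
    using N by (intro sum.mono_neutral_cong_left) (auto simp: g_def)
  also have "\<dots> = (\<Sum>b<N. \<Sum>\<tau>=1..\<Delta>. g (b * \<Delta> + \<tau>))" by (rule sum_blocks)
  also have "\<dots> \<le> (\<Sum>b<N. (\<Sum>\<tau>=1..\<Delta>. step_cost \<tau>) + real \<Delta> * (2 * L\<^sub>\<xi> / \<alpha> * (\<Sum>s=1..\<Delta>. w (b * \<Delta> + s))))"
  proof (rule sum_mono)
    fix b
    \<comment> \<open>Truncated subtraction gives the true length of the last batch and 0 for
      batches beyond the horizon.\<close>
    let ?k = "min \<Delta> (T - b * \<Delta>)"
    have "(\<Sum>\<tau>=1..\<Delta>. g (b * \<Delta> + \<tau>)) = (\<Sum>\<tau>=1..?k. gap (b * \<Delta> + \<tau>) - ?\<kappa>)"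
      by (intro sum.mono_neutral_cong_right) (auto simp: g_def)
    also have "\<dots> \<le> (\<Sum>\<tau>=1..\<Delta>. step_cost \<tau>) + real \<Delta> * (2 * L\<^sub>\<xi> / \<alpha> * (\<Sum>s=1..\<Delta>. w (b * \<Delta> + s)))"
    proof (cases "b * \<Delta> \<le> T")
      case True
      then show ?thesis
        using W W0 by (intro batch_gap[OF K]) (auto simp: w_def)
    next
      case False
      then have "?k = 0" by simp
      moreover have "0 \<le> (\<Sum>\<tau>=1..\<Delta>. step_cost \<tau>)" by (intro sum_nonneg step_cost_nonneg)
      moreover have "0 \<le> real \<Delta> * (2 * L\<^sub>\<xi> / \<alpha> * (\<Sum>s=1..\<Delta>. w (b * \<Delta> + s)))"
        using L\<xi>_pos \<alpha> W0 by (intro mult_nonneg_nonneg sum_nonneg) (auto simp: w_def)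
      ultimately show ?thesis by simp
    qed
    finally show "(\<Sum>\<tau>=1..\<Delta>. g (b * \<Delta> + \<tau>))
      \<le> (\<Sum>\<tau>=1..\<Delta>. step_cost \<tau>) + real \<Delta> * (2 * L\<^sub>\<xi> / \<alpha> * (\<Sum>s=1..\<Delta>. w (b * \<Delta> + s)))" .
  qed
  also have "\<dots> = real N * (\<Sum>\<tau>=1..\<Delta>. step_cost \<tau>) + real \<Delta> * (2 * L\<^sub>\<xi> / \<alpha> * (\<Sum>b<N. \<Sum>s=1..\<Delta>. w (b * \<Delta> + s)))"
    by (simp only: sum.distrib sum_distrib_left[symmetric] sum_constant card_lessThan)
  also have "(\<Sum>b<N. \<Sum>s=1..\<Delta>. w (b * \<Delta> + s)) = (\<Sum>s=1..N * \<Delta>. w s)" by (rule sum_blocks[symmetric])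
  also have "\<dots> = (\<Sum>s=2..T. W s)"
    using N by (intro sum.mono_neutral_cong_right) (auto simp: w_def)
  also have "real \<Delta> * (2 * L\<^sub>\<xi> / \<alpha> * (\<Sum>s=2..T. W s)) \<le> real \<Delta> * (2 * L\<^sub>\<xi> / \<alpha> * V)"
    using V L\<xi>_pos \<alpha> by (intro mult_left_mono) auto
  finally show ?thesis by (simp add: sum_subtractf)
qed

section \<open>From the expected regret to high probability\<close>

abbreviation regret :: "(nat \<Rightarrow> real^'d) \<times> (nat \<times> nat \<Rightarrow> 'b) \<Rightarrow> real" where
  "regret \<equiv> algorithm_regret J X r \<alpha> D T \<Delta> \<delta> \<phi> \<eta> x1"

lemma regret_eq:
  "regret \<omega> = (\<Sum>t=1..T. C t (play (fst \<omega>) (snd \<omega>) t) - C t (arg_min_on (C t) X))"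
  by (simp add: algorithm_regret_def dynamic_regret_def case_prod_unfold sum_subtractf)

lemma achieves_regretI:
  assumes B: "0 < B" and \<gamma>: "0 < \<gamma>" and le: "(\<Sum>t=1..T. gap t) \<le> \<gamma> * B"
  shows "achieves_regret J X r m \<alpha> D T \<Delta> \<delta> \<phi> x1 \<gamma> B"
proof -
  interpret P: prob_space P by (rule prob_P)
  have ip: "integrable P (\<lambda>\<omega>. C t (play (fst \<omega>) (snd \<omega>) t))" if t: "t \<in> {1..T}" for t
    by (rule P.bounded_integrable[OF C_play_measurable[OF t] C_bounded[OF play_in_X_P[OF t]]])
  have int: "integrable P regret"
    unfolding regret_eq by (intro Bochner_Integration.integrable_sum Bochner_Integration.integrable_diff ip P.integrable_const)
  have "(\<integral>\<omega>. regret \<omega> \<partial>P) = (\<Sum>t=1..T. \<integral>\<omega>. C t (play (fst \<omega>) (snd \<omega>) t) - C t (arg_min_on (C t) X) \<partial>P)"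
    unfolding regret_eq
    by (intro Bochner_Integration.integral_sum Bochner_Integration.integrable_diff ip P.integrable_const)
  also have "\<dots> = (\<Sum>t=1..T. gap t)"
  proof (rule sum.cong[OF refl])
    fix t assume "t \<in> {1..T}"
    then show "(\<integral>\<omega>. C t (play (fst \<omega>) (snd \<omega>) t) - C t (arg_min_on (C t) X) \<partial>P) = gap t"
      by (subst Bochner_Integration.integral_diff[OF ip]) (simp_all add: P.prob_space)
  qed
  finally have E: "(\<integral>\<omega>. regret \<omega> \<partial>P) \<le> \<gamma> * B" using le by simp
  \<comment> \<open>Nonnegativity holds on the whole space, term by term: every played point lies in
    \<open>X\<close>, where the comparator of that round is a minimiser.\<close>
  have nonneg: "0 \<le> regret \<omega>" if "\<omega> \<in> space P" for \<omega>
    unfolding regret_eq using that by (intro sum_nonneg) (simp add: C_argmin(2) play_in_X_P)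
  have m: "regret \<in> borel_measurable P" using int by simp
  have sets: "{\<omega> \<in> space P. regret \<omega> \<le> B} \<in> sets P" "{\<omega> \<in> space P. B \<le> regret \<omega>} \<in> sets P"
    using m by measurable
  have "measure P {\<omega> \<in> space P. B \<le> regret \<omega>} \<le> (\<integral>\<omega>. regret \<omega> \<partial>P) / B"
    using nonneg B by (intro integral_Markov_inequality_measure[OF int sets.empty_sets]) auto
  also have "\<dots> \<le> \<gamma>" using E B by (simp add: pos_divide_le_eq)
  finally have "1 - \<gamma> \<le> measure P (space P - {\<omega> \<in> space P. B \<le> regret \<omega>})"
    using P.prob_compl[OF sets(2)] by simp
  also have "\<dots> \<le> measure P {\<omega> \<in> space P. regret \<omega> \<le> B}"
    using sets by (intro P.finite_measure_mono) auto
  finally show ?thesis by (simp add: achieves_regret_def)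
qed

end

section \<open>Choice of the parameters\<close>

lemma sum_inverse_le_ln:
  assumes "1 \<le> n"
  shows "(\<Sum>\<tau>=1..n. 1 / real \<tau>) \<le> 1 + ln (real n)"
  using assms
proof (induction n rule: dec_induct)
  case (step n)
  have n: "0 < real n" using step by simp
  have "ln (real n / real (Suc n)) \<le> real n / real (Suc n) - 1"
    using n by (intro ln_le_minus_one) simp
  also have "real n / real (Suc n) - 1 = - (1 / real (Suc n))" by (simp add: field_simps)
  also have "ln (real n / real (Suc n)) = ln (real n) - ln (real (Suc n))" using n by (simp add: ln_div)
  finally have "1 / real (Suc n) \<le> ln (real (Suc n)) - ln (real n)" by linarith
  then show ?case using step by simp
qed simp

text \<open>An error below 1 is at most half of \<open>k\<close> once \<open>k\<close> is at least
  2, so rounding in either direction costs a factor of at most 2.\<close>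

lemma rounds_bounds:
  assumes "rounds k q" "1 < k"
  shows "1 < q" "q / 2 \<le> real k" "real k \<le> 2 * q"
proof -
  have "2 \<le> real k" using assms by simp
  then show "1 < q" "q / 2 \<le> real k" "real k \<le> 2 * q"
    using assms unfolding rounds_def by linarith+
qed

text \<open>In powers of s = V/T, which is below 1 because \<open>q\<close> exceeds 1, each estimate
  compares two exponents: \<open>3 * p \<le> w\<close> serves the variance,
  \<open>4 * p \<le> w * a\<close> the sampling error and \<open>w + p \<le> 1\<close> the
  drift.\<close>

lemma rate_balance:
  fixes T V p w a q \<delta> :: real
  assumes T: "0 < T" "0 < V" and q: "q = (T / V) powr w" "1 < q" and \<delta>: "\<delta> = (V / T) powr p"
    and pw: "0 < p" "0 < w" "3 * p \<le> w" "4 * p \<le> w * a" "w + p \<le> 1"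
  shows "0 < \<delta>" "1 / (q * \<delta>\<^sup>2) \<le> \<delta>" "q powr (- (a / 2)) / \<delta> \<le> \<delta>" "q * V \<le> T * \<delta>"
    "T * \<delta> = T powr (1 - p) * V powr p"
proof -
  define s where "s = V / T"
  have s: "0 < s" using T by (simp add: s_def)
  have qs: "q = s powr (- w)" using T by (simp add: q s_def powr_minus powr_divide field_simps)
  have "s < 1"
  proof (rule ccontr)
    assume "\<not> s < 1"
    then have "s powr (- w) \<le> s powr 0" using pw by (intro powr_mono) auto
    then show False using q(2) qs s by simp
  qed
  then have mono: "s powr y \<le> s powr x" if "x \<le> y" for x y
    using s that by (intro powr_mono') auto
  have \<delta>s: "\<delta> = s powr p" by (simp add: \<delta> s_def)
  show "0 < \<delta>" using s by (simp add: \<delta>s)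
  have "1 / (q * \<delta>\<^sup>2) = s powr (w - 2 * p)"
    using s by (simp add: qs \<delta>s power2_eq_square powr_diff powr_minus powr_add field_simps flip: powr_add)
  then show "1 / (q * \<delta>\<^sup>2) \<le> \<delta>" unfolding \<delta>s using pw by (simp add: mono)
  have "q powr (- (a / 2)) / \<delta> = s powr (w * a / 2 - p)"
    using s by (simp add: qs \<delta>s powr_powr powr_diff)
  then show "q powr (- (a / 2)) / \<delta> \<le> \<delta>" unfolding \<delta>s using pw by (simp add: mono)
  have "q * s = s powr (1 - w)" using s by (simp add: qs powr_diff powr_minus field_simps)
  also have "\<dots> \<le> \<delta>" unfolding \<delta>s using pw by (simp add: mono)
  finally show "q * V \<le> T * \<delta>" using T by (simp add: s_def field_simps)
  show "T * \<delta> = T powr (1 - p) * V powr p"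
    using T by (simp add: \<delta> powr_divide powr_diff)
qed

lemma achieves_regret_cong:
  fixes J :: "real^'d \<Rightarrow> 'b \<Rightarrow> real"
  assumes "\<And>t. t \<in> {1..T} \<Longrightarrow> D t = D' t"
  shows "achieves_regret J X r m \<alpha> D T \<Delta> \<delta> \<phi> x1 \<gamma> B = achieves_regret J X r m \<alpha> D' T \<Delta> \<delta> \<phi> x1 \<gamma> B"
proof -
  have "(sampling_measure T n D :: ((nat \<Rightarrow> real^'d) \<times> _) measure) = sampling_measure T n D'" for n :: "nat \<Rightarrow> nat"
    unfolding sampling_measure_def using assms by (intro arg_cong2[where f = pair_measure] PiM_cong refl) auto
  moreover have "algorithm_regret J X r \<alpha> D T \<Delta> \<delta> \<phi> \<eta> x1 = algorithm_regret J X r \<alpha> D' T \<Delta> \<delta> \<phi> \<eta> x1" for \<eta>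
    unfolding algorithm_regret_def dynamic_regret_def using assms
    by (intro ext) (auto intro!: arg_cong2[where f = "(-)"] sum.cong)
  ultimately show ?thesis unfolding achieves_regret_def by simp
qed

context regret_setting
begin

lemma sum_gap_rate:
  fixes V c a p w q :: real
  assumes K: "0 < K" and W: "\<And>s. s \<in> {2..T} \<Longrightarrow> wasserstein1 K \<Xi> (D (s - 1)) (D s) \<le> ereal (W s)"
    and W0: "\<And>s. s \<in> {2..T} \<Longrightarrow> 0 \<le> W s" and V: "(\<Sum>s=2..T. W s) \<le> V" "0 < V"
    and \<Delta>: "1 < \<Delta>" "\<Delta> < T" and a: "0 < a" and c: "0 < c"
    and \<phi>: "(\<Sum>\<tau>=1..\<Delta>. 1 / sqrt (real (\<phi> \<tau>))) \<le> c * real \<Delta> powr (1 - a / 2)"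
    and pw: "0 < p" "0 < w" "3 * p \<le> w" "4 * p \<le> w * a" "w + p \<le> 1"
    and \<delta>': "\<delta> = (V / real T) powr p" and rounds: "rounds \<Delta> ((real T / V) powr w)"
  shows "(\<Sum>t=1..T. gap t) \<le> (4 * (real CARD('d) * U)\<^sup>2 / m + 4 * c * real CARD('d) * Dx * U / \<alpha> * 2 powr (a / 2)
      + (3 * L\<^sub>0 + L\<^sub>0 * Dx / r) + 4 * L\<^sub>\<xi> / \<alpha>) * (ln (real T) * (real T powr (1 - p) * V powr p))"
proof -
  define q where "q = (real T / V) powr w"
  \<comment> \<open>At least the number of batches, possibly one more; \<open>N * \<Delta>\<close>
    exceeds \<open>T\<close> by at most \<open>\<Delta>\<close>, hence stays below
    \<open>2 * T\<close>.\<close>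
  define N where "N = T div \<Delta> + 1"
  define R where "R = real T * \<delta>"
  let ?n = "real CARD('d)"
  let ?G = "(?n * U / \<delta>)\<^sup>2 / (2 * m)" and ?E = "2 * ?n * Dx * U / (\<alpha> * \<delta>)"
  have T: "0 < real T" "3 \<le> T" using \<Delta> by auto
  note q = rounds_bounds[OF rounds \<Delta>(1), folded q_def]
  note rate = rate_balance[OF T(1) V(2) q_def q(1) \<delta>' pw]
  have R1: "R = real T powr (1 - p) * V powr p" unfolding R_def by (rule rate(5))
  have R0: "0 < R" unfolding R_def using rate(1) T(1) by (intro mult_pos_pos)
  \<comment> \<open>The horizon is at least 3, hence at least e, so one logarithm can absorb all the
    constant terms.\<close>
  have lnT: "1 \<le> ln (real T)"
  proof -
    have "exp 1 \<le> real T" using exp_le T by linarith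
    then show ?thesis using T by (simp add: ln_ge_iff)
  qed
  have \<Delta>0: "0 < real \<Delta>" using \<Delta> by simp
  have N\<Delta>: "T \<le> N * \<Delta>" "real N * real \<Delta> \<le> 2 * real T"
  proof -
    have "N * \<Delta> = T div \<Delta> * \<Delta> + \<Delta>" by (simp add: N_def)
    moreover have "T div \<Delta> * \<Delta> \<le> T" "T < T div \<Delta> * \<Delta> + \<Delta>"
      using div_mult_mod_eq[of T \<Delta>] mod_less_divisor[OF \<Delta>_pos, of T] by linarith+
    ultimately have "T \<le> N * \<Delta>" "N * \<Delta> \<le> 2 * T" using \<Delta> by linarith+
    moreover from this(2) have "real (N * \<Delta>) \<le> real (2 * T)" by (simp only: of_nat_le_iff)
    ultimately show "T \<le> N * \<Delta>" "real N * real \<Delta> \<le> 2 * real T" by simp_all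
  qed
  have N: "real N \<le> 2 * real T / real \<Delta>" using N\<Delta>(2) \<Delta>0 by (simp add: pos_le_divide_eq)
  have N': "real N \<le> 4 * real T / q"
  proof -
    have "2 * real T / real \<Delta> \<le> 2 * real T / (q / 2)"
      using q T by (intro divide_left_mono) auto
    then show ?thesis using N by simp
  qed
  have G0: "0 \<le> ?G" and E0: "0 \<le> ?E" using m_pos \<alpha> \<delta> U_pos Dx_nonneg by auto
  have cost: "(\<Sum>\<tau>=1..\<Delta>. step_cost \<tau>) = ?G * (\<Sum>\<tau>=1..\<Delta>. 1 / real \<tau>) + ?E * (\<Sum>\<tau>=1..\<Delta>. 1 / sqrt (real (\<phi> \<tau>)))"
    unfolding step_cost_def by (simp only: sum.distrib sum_distrib_left times_divide_eq_right mult_1_right)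
  have "(\<Sum>\<tau>=1..\<Delta>. 1 / real \<tau>) \<le> 1 + ln (real \<Delta>)" using \<Delta> by (intro sum_inverse_le_ln) auto
  also have "\<dots> \<le> 2 * ln (real T)"
  proof -
    have "ln (real \<Delta>) \<le> ln (real T)" using \<Delta> by simp
    then show ?thesis using lnT by linarith
  qed
  finally have H: "(\<Sum>\<tau>=1..\<Delta>. 1 / real \<tau>) \<le> 2 * ln (real T)" .
  \<comment> \<open>The constant 4 arises as 4 from \<open>N'\<close>, 1/2 from \<open>?G\<close>
    and 2 from the harmonic sum.\<close>
  have "real N * (?G * (\<Sum>\<tau>=1..\<Delta>. 1 / real \<tau>)) \<le> (4 * real T / q) * (?G * (2 * ln (real T)))"
    using T q by (intro mult_mono[OF N' mult_left_mono[OF H G0] _ mult_nonneg_nonneg[OF G0 sum_nonneg]]) auto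
  also have "\<dots> = 4 * (?n * U)\<^sup>2 / m * (ln (real T) * (real T * (1 / (q * \<delta>\<^sup>2))))"
    using rate(1) q m_pos by (simp add: field_simps power2_eq_square)
  also have "\<dots> \<le> 4 * (?n * U)\<^sup>2 / m * (ln (real T) * R)"
    unfolding R_def using rate(2) lnT m_pos by (intro mult_left_mono) auto
  finally have t1: "real N * (?G * (\<Sum>\<tau>=1..\<Delta>. 1 / real \<tau>)) \<le> 4 * (?n * U)\<^sup>2 / m * (ln (real T) * R)" .
  have pow: "real \<Delta> powr (- (a / 2)) \<le> 2 powr (a / 2) * q powr (- (a / 2))"
  proof -
    have "real \<Delta> powr (- (a / 2)) \<le> (q / 2) powr (- (a / 2))"
      using q a by (intro powr_mono2') auto
    also have "\<dots> = 2 powr (a / 2) * q powr (- (a / 2))"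
      using q by (simp add: powr_divide powr_minus field_simps)
    finally show ?thesis .
  qed
  have lnR: "x * R \<le> x * (ln (real T) * R)" if "0 \<le> x" for x
    using mult_right_mono[OF lnT, of R] R0 that by (intro mult_left_mono) auto
  \<comment> \<open>The bound on \<open>N\<close> in terms of \<open>\<Delta>\<close> is used here
    before passing to \<open>q\<close>: dividing by \<open>\<Delta>\<close> leaves the exponent
    \<open>- (a / 2)\<close>, which is negative for every \<open>a\<close>, while the sign of
    \<open>1 - a / 2\<close> varies.\<close>
  have "real N * (?E * (\<Sum>\<tau>=1..\<Delta>. 1 / sqrt (real (\<phi> \<tau>))))
    \<le> (2 * real T / real \<Delta>) * (?E * (c * real \<Delta> powr (1 - a / 2)))"
    using T by (intro mult_mono[OF N mult_left_mono[OF \<phi> E0] _ mult_nonneg_nonneg[OF E0 sum_nonneg]]) auto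
  also have "\<dots> = 2 * real T * ?E * c * real \<Delta> powr (- (a / 2))"
  proof -
    have "real \<Delta> powr (1 - a / 2) = real \<Delta> * real \<Delta> powr (- (a / 2))"
      using powr_add[of "real \<Delta>" 1 "- (a / 2)"] \<Delta>0 by simp
    then show ?thesis using \<Delta>0 by simp
  qed
  also have "\<dots> \<le> 2 * real T * ?E * c * (2 powr (a / 2) * q powr (- (a / 2)))"
    using pow T E0 c by (intro mult_left_mono mult_nonneg_nonneg) auto
  also have "\<dots> = 4 * c * ?n * Dx * U / \<alpha> * 2 powr (a / 2) * (real T * (q powr (- (a / 2)) / \<delta>))"
    using rate(1) \<alpha> by (simp add: field_simps)
  also have "\<dots> \<le> 4 * c * ?n * Dx * U / \<alpha> * 2 powr (a / 2) * R"
    unfolding R_def using rate(3) c Dx_nonneg U_pos \<alpha> by (intro mult_left_mono) auto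
  also have "\<dots> \<le> 4 * c * ?n * Dx * U / \<alpha> * 2 powr (a / 2) * (ln (real T) * R)"
    using c Dx_nonneg U_pos \<alpha> by (intro lnR) auto
  finally have t2: "real N * (?E * (\<Sum>\<tau>=1..\<Delta>. 1 / sqrt (real (\<phi> \<tau>))))
    \<le> 4 * c * ?n * Dx * U / \<alpha> * 2 powr (a / 2) * (ln (real T) * R)" .
  have "real T * ((3 * L\<^sub>0 + L\<^sub>0 * Dx / r) * \<delta>) = (3 * L\<^sub>0 + L\<^sub>0 * Dx / r) * R"
    by (simp add: R_def)
  also have "\<dots> \<le> (3 * L\<^sub>0 + L\<^sub>0 * Dx / r) * (ln (real T) * R)"
    using L0_pos Dx_nonneg r_pos by (intro lnR) auto
  finally have t3: "real T * ((3 * L\<^sub>0 + L\<^sub>0 * Dx / r) * \<delta>) \<le> (3 * L\<^sub>0 + L\<^sub>0 * Dx / r) * (ln (real T) * R)" .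
  have "real \<Delta> * (2 * L\<^sub>\<xi> / \<alpha> * V) = 2 * L\<^sub>\<xi> / \<alpha> * (real \<Delta> * V)" by simp
  also have "\<dots> \<le> 2 * L\<^sub>\<xi> / \<alpha> * (2 * q * V)"
    using q(3) V L\<xi>_pos \<alpha> by (intro mult_left_mono mult_right_mono) auto
  also have "\<dots> = 4 * L\<^sub>\<xi> / \<alpha> * (q * V)" by simp
  also have "\<dots> \<le> 4 * L\<^sub>\<xi> / \<alpha> * R"
    unfolding R_def using rate(4) L\<xi>_pos \<alpha> by (intro mult_left_mono) auto
  also have "\<dots> \<le> 4 * L\<^sub>\<xi> / \<alpha> * (ln (real T) * R)"
    using L\<xi>_pos \<alpha> by (intro lnR) auto
  finally have t4: "real \<Delta> * (2 * L\<^sub>\<xi> / \<alpha> * V) \<le> 4 * L\<^sub>\<xi> / \<alpha> * (ln (real T) * R)" .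
  have "(\<Sum>t=1..T. gap t) \<le> real N * (\<Sum>\<tau>=1..\<Delta>. step_cost \<tau>)
    + real T * ((3 * L\<^sub>0 + L\<^sub>0 * Dx / r) * \<delta>) + real \<Delta> * (2 * L\<^sub>\<xi> / \<alpha> * V)"
    by (rule sum_gap_le[OF K W W0 V(1) N\<Delta>(1)])
  also have "\<dots> \<le> 4 * (?n * U)\<^sup>2 / m * (ln (real T) * R) + 4 * c * ?n * Dx * U / \<alpha> * 2 powr (a / 2) * (ln (real T) * R)
      + (3 * L\<^sub>0 + L\<^sub>0 * Dx / r) * (ln (real T) * R) + 4 * L\<^sub>\<xi> / \<alpha> * (ln (real T) * R)"
    unfolding cost distrib_left[of "real N"] by (intro add_mono t1 t2 t3 t4)
  also have "\<dots> = (4 * (?n * U)\<^sup>2 / m + 4 * c * ?n * Dx * U / \<alpha> * 2 powr (a / 2)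
      + (3 * L\<^sub>0 + L\<^sub>0 * Dx / r) + 4 * L\<^sub>\<xi> / \<alpha>) * (ln (real T) * R)"
    by (simp only: distrib_right)
  finally show ?thesis unfolding R1 .
qed

end

theorem theorem2:
  fixes r Dx U m L\<^sub>0 L\<^sub>\<xi> K \<alpha> a c \<gamma> :: real
  assumes "0 < r" "0 < U" "0 < m" "0 < L\<^sub>0" "0 < L\<^sub>\<xi>" "0 < K"
    and "0 < \<alpha>" "\<alpha> \<le> 1" "0 < a" "0 < c" "0 < \<gamma>" "\<gamma> < 1"
  shows "\<exists>C>0. \<exists>k::nat.
    \<forall>(X::(real^'d) set) (\<Xi>::'b::metric_space set) (J::real^'d \<Rightarrow> 'b \<Rightarrow> real)
      (D::nat \<Rightarrow> 'b measure) (T::nat) (V\<^sub>D::real) (\<Delta>::nat) (\<delta>::real) (\<phi>::nat \<Rightarrow> nat) (x1::real^'d).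
    closed X \<and> convex X \<and> bounded X \<and> cball 0 r \<subseteq> X \<and> diameter X = Dx \<and>
    (\<forall>x\<in>X. \<forall>\<xi>\<in>\<Xi>. \<bar>J x \<xi>\<bar> \<le> U) \<and>
    (\<forall>\<xi>\<in>\<Xi>. strongly_convex_grad m X (\<lambda>x. J x \<xi>)) \<and>
    (\<forall>\<xi>\<in>\<Xi>. \<forall>x\<in>X. \<forall>y\<in>X. \<bar>J x \<xi> - J y \<xi>\<bar> \<le> L\<^sub>0 * norm (x - y)) \<and>
    (\<forall>x\<in>X. L\<^sub>\<xi>-lipschitz_on \<Xi> (J x)) \<and>
    (\<forall>t\<in>{1..T}. prob_space (D t) \<and> sets (D t) = sets (restrict_space borel \<Xi>)) \<and>
    0 < V\<^sub>D \<and> (\<Sum>t=2..T. wasserstein1 K \<Xi> (D (t - 1)) (D t)) \<le> ereal V\<^sub>D \<and>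
    1 < \<Delta> \<and> \<Delta> < T \<and> 0 < \<delta> \<and> \<delta> < r \<and> x1 \<in> shrunk X r \<delta> \<and>
    (\<forall>\<tau>\<in>{1..\<Delta>}. 0 < \<phi> \<tau>) \<and>
    (\<Sum>\<tau>=1..\<Delta>. 1 / sqrt (real (\<phi> \<tau>))) \<le> c * real \<Delta> powr (1 - a / 2)
    \<longrightarrow>
      (a \<le> 4 / 3 \<and>
       \<delta> = (V\<^sub>D / real T) powr (a / (4 + a)) \<and>
       rounds \<Delta> ((real T / V\<^sub>D) powr (4 / (4 + a)))
       \<longrightarrow> achieves_regret J X r m \<alpha> D T \<Delta> \<delta> \<phi> x1 \<gamma>
             (C * ln (real T) ^ k * (real T powr (4 / (4 + a)) * V\<^sub>D powr (a / (4 + a)))))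
    \<and> (a > 4 / 3 \<and>
       \<delta> = (V\<^sub>D / real T) powr (1 / 4) \<and>
       rounds \<Delta> ((real T / V\<^sub>D) powr (3 / 4))
       \<longrightarrow> achieves_regret J X r m \<alpha> D T \<Delta> \<delta> \<phi> x1 \<gamma>
             (C * ln (real T) ^ k * (real T powr (3 / 4) * V\<^sub>D powr (1 / 4))))"
proof -
  \<comment> \<open>The division by \<gamma> is the price of Markov. \<open>Dx\<close> is fixed
    before any set \<open>X\<close>, so a negative value is possible and the absolute value keeps
    \<open>C\<close> positive.\<close>
  define C where "C = (4 * (real CARD('d) * U)\<^sup>2 / m + 4 * c * real CARD('d) * \<bar>Dx\<bar> * U / \<alpha> * 2 powr (a / 2)
      + (3 * L\<^sub>0 + L\<^sub>0 * \<bar>Dx\<bar> / r) + 4 * L\<^sub>\<xi> / \<alpha>) / \<gamma>"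
  have C: "0 < C"
    unfolding C_def using assms by (intro divide_pos_pos add_nonneg_pos add_nonneg_nonneg) auto
  \<comment> \<open>Both regimes are instances of one statement with free exponents \<open>p\<close>
    of \<delta> and \<open>w\<close> of \<open>\<Delta>\<close>, subject to the balance
    conditions.\<close>
  have main: "achieves_regret J X r m \<alpha> D T \<Delta> \<delta> \<phi> x1 \<gamma> (C * ln (real T) ^ 1 * (real T powr (1 - p) * V powr p))"
    if X: "closed X" "convex X" "bounded X" "cball 0 r \<subseteq> X" "diameter X = Dx"
      and J: "\<forall>x\<in>X. \<forall>\<xi>\<in>\<Xi>. \<bar>J x \<xi>\<bar> \<le> U" "\<forall>\<xi>\<in>\<Xi>. strongly_convex_grad m X (\<lambda>x. J x \<xi>)"
        "\<forall>\<xi>\<in>\<Xi>. \<forall>x\<in>X. \<forall>y\<in>X. \<bar>J x \<xi> - J y \<xi>\<bar> \<le> L\<^sub>0 * norm (x - y)" "\<forall>x\<in>X. L\<^sub>\<xi>-lipschitz_on \<Xi> (J x)"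
      and D: "\<forall>t\<in>{1..T}. prob_space (D t) \<and> sets (D t) = sets (restrict_space borel \<Xi>)"
      and V: "0 < V" "(\<Sum>t=2..T. wasserstein1 K \<Xi> (D (t - 1)) (D t)) \<le> ereal V"
      and \<Delta>: "1 < \<Delta>" "\<Delta> < T" and \<delta>: "0 < \<delta>" "\<delta> < r" "x1 \<in> shrunk X r \<delta>"
      and \<phi>: "\<forall>\<tau>\<in>{1..\<Delta>}. 0 < \<phi> \<tau>" "(\<Sum>\<tau>=1..\<Delta>. 1 / sqrt (real (\<phi> \<tau>))) \<le> c * real \<Delta> powr (1 - a / 2)"
      and pw: "0 < p" "0 < w" "3 * p \<le> w" "4 * p \<le> w * a" "w + p \<le> 1"
      and \<delta>': "\<delta> = (V / real T) powr p" and rounds: "rounds \<Delta> ((real T / V) powr w)"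
    for X :: "(real^'d) set" and \<Xi> :: "'b set" and J D T V \<Delta> \<delta> \<phi> x1 p w
  proof -
    \<comment> \<open>The locale asks for a probability measure at every index, while the hypotheses
      cover rounds 1 to \<open>T\<close> only; \<open>D 1\<close> fills the rest, and the regret
      sees only the original rounds.\<close>
    define D' where "D' t = D (if t \<in> {1..T} then t else 1)" for t
    have D'D: "D' t = D t" if "t \<in> {1..T}" for t using that by (simp add: D'_def)
    have D': "prob_space (D' t)" "sets (D' t) = sets (restrict_space borel \<Xi>)" for t
    proof -
      have "(if t \<in> {1..T} then t else 1) \<in> {1..T}" using \<Delta> by auto
      note b = bspec[OF D this, folded D'_def]
      show "prob_space (D' t)" using b by (rule conjunct1)
      show "sets (D' t) = sets (restrict_space borel \<Xi>)" using b by (rule conjunct2)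
    qed
    have J': "\<And>x \<xi>. x \<in> X \<Longrightarrow> \<xi> \<in> \<Xi> \<Longrightarrow> \<bar>J x \<xi>\<bar> \<le> U"
      "\<And>\<xi>. \<xi> \<in> \<Xi> \<Longrightarrow> strongly_convex_grad m X (\<lambda>x. J x \<xi>)"
      "\<And>\<xi> x y. \<xi> \<in> \<Xi> \<Longrightarrow> x \<in> X \<Longrightarrow> y \<in> X \<Longrightarrow> \<bar>J x \<xi> - J y \<xi>\<bar> \<le> L\<^sub>0 * norm (x - y)"
      "\<And>x. x \<in> X \<Longrightarrow> L\<^sub>\<xi>-lipschitz_on \<Xi> (J x)"
      using J by simp_all
    have \<phi>': "0 < \<Delta>" "\<And>\<tau>. \<tau> \<in> {1..\<Delta>} \<Longrightarrow> 0 < \<phi> \<tau>" using \<Delta> \<phi>(1) by simp_all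
    interpret regret_setting J X \<Xi> D' r Dx U m L\<^sub>0 L\<^sub>\<xi> \<alpha> \<delta> T \<Delta> \<phi> x1
      by (intro regret_setting.intro shrunk_domain.intro risk_averse_cost.intro
          shrunk_domain_axioms.intro regret_setting_axioms.intro) (fact assms X J' D' \<delta> \<phi>')+
    \<comment> \<open>Each distance is finite, being a nonnegative summand of a sum bounded by a
      real number, so its conversion to a real loses nothing on the horizon.\<close>
    define W where "W s = real_of_ereal (wasserstein1 K \<Xi> (D (s - 1)) (D s))" for s
    have w0: "0 \<le> wasserstein1 K \<Xi> (D (s - 1)) (D s)" for s by (rule wasserstein1_nonneg[OF assms(6)])
    have W: "wasserstein1 K \<Xi> (D (s - 1)) (D s) = ereal (W s)" if s: "s \<in> {2..T}" for s
    proof -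
      have "wasserstein1 K \<Xi> (D (s - 1)) (D s) \<le> (\<Sum>t=2..T. wasserstein1 K \<Xi> (D (t - 1)) (D t))"
        using s w0 sum_mono2[of "{2..T}" "{s}" "\<lambda>t. wasserstein1 K \<Xi> (D (t - 1)) (D t)"] by simp
      then have "wasserstein1 K \<Xi> (D (s - 1)) (D s) \<le> ereal V" using V(2) by (rule order_trans)
      then have "\<bar>wasserstein1 K \<Xi> (D (s - 1)) (D s)\<bar> \<noteq> \<infinity>" using w0[of s] by auto
      then show ?thesis by (simp add: W_def ereal_real)
    qed
    have "ereal (\<Sum>s=2..T. W s) = (\<Sum>t=2..T. wasserstein1 K \<Xi> (D (t - 1)) (D t))"
      using W by (simp add: sum_ereal[symmetric] del: sum_ereal)
    then have sumW: "(\<Sum>s=2..T. W s) \<le> V" using V(2) by (metis ereal_less_eq(3))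
    have "(\<Sum>t=1..T. gap t) \<le> (4 * (real CARD('d) * U)\<^sup>2 / m + 4 * c * real CARD('d) * Dx * U / \<alpha> * 2 powr (a / 2)
      + (3 * L\<^sub>0 + L\<^sub>0 * Dx / r) + 4 * L\<^sub>\<xi> / \<alpha>) * (ln (real T) * (real T powr (1 - p) * V powr p))"
    proof (rule sum_gap_rate[OF assms(6) _ _ sumW V(1) \<Delta> assms(9,10) \<phi>(2) pw \<delta>' rounds])
      show "wasserstein1 K \<Xi> (D' (s - 1)) (D' s) \<le> ereal (W s)" if "s \<in> {2..T}" for s
        using W[OF that] that by (subst (1 2) D'D) auto
      show "0 \<le> W s" for s using w0 by (simp add: W_def real_of_ereal_pos)
    qed
    also have "\<dots> = \<gamma> * (C * ln (real T) ^ 1 * (real T powr (1 - p) * V powr p))"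
      unfolding C_def using assms Dx_nonneg by simp
    finally have "achieves_regret J X r m \<alpha> D' T \<Delta> \<delta> \<phi> x1 \<gamma> (C * ln (real T) ^ 1 * (real T powr (1 - p) * V powr p))"
      using C V \<Delta> assms by (intro achieves_regretI) auto
    then show ?thesis
      by (subst achieves_regret_cong[where D' = D']) (rule D'D[symmetric])
  qed
  have e1: "1 - a / (4 + a) = 4 / (4 + a)" using assms(9) by (simp add: field_simps)
  \<comment> \<open>In this regime the variance condition is equivalent to a \<le> 4/3 and the other
    two balance conditions are equalities. In \<open>pw2\<close> the variance and drift conditions
    are equalities, and the sampling condition is what requires \<open>a\<close> to be at least
    4/3.\<close>
  have pw1: "0 < a / (4 + a)" "0 < 4 / (4 + a)" "3 * (a / (4 + a)) \<le> 4 / (4 + a)"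
    "4 * (a / (4 + a)) \<le> 4 / (4 + a) * a" "4 / (4 + a) + a / (4 + a) \<le> 1" if "a \<le> 4 / 3"
    using assms(9) that by (auto simp: add_divide_distrib[symmetric] divide_right_mono)
  have pw2: "(0::real) < 1 / 4" "(0::real) < 3 / 4" "3 * (1 / 4) \<le> (3 / 4 :: real)"
    "4 * (1 / 4) \<le> 3 / 4 * a" "3 / 4 + 1 / 4 \<le> (1::real)" if "a > 4 / 3"
    using that by auto
  have e2: "1 - 1 / 4 = (3 / 4 :: real)" by simp
  show ?thesis
  proof (intro exI[of _ C] conjI C exI[of _ 1] allI impI, goal_cases)
    case (1 X \<Xi> J D T V \<Delta> \<delta> \<phi> x1)
    note rate = main[where X = X and \<Xi> = \<Xi> and J = J and D = D and T = T and V = V and \<Delta> = \<Delta>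
        and \<delta> = \<delta> and \<phi> = \<phi> and ?x1.0 = x1
        and p = "a / (4 + a)" and w = "4 / (4 + a)", unfolded e1]
    from 1 show ?case
      by (elim conjE) (rule rate; (assumption | rule pw1))
  next
    case (2 X \<Xi> J D T V \<Delta> \<delta> \<phi> x1)
    note rate = main[where X = X and \<Xi> = \<Xi> and J = J and D = D and T = T and V = V and \<Delta> = \<Delta>
        and \<delta> = \<delta> and \<phi> = \<phi> and ?x1.0 = x1
        and p = "1 / 4" and w = "3 / 4", unfolded e2]
    from 2 show ?case
      by (elim conjE) (rule rate; (assumption | rule pw2))
  qed
qed

end
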